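(* Let $h\colon[-1,1]\to[-1,1]$ be a homeomorphism of class $C^\omega$ on $[-1,1]\setminus\{0\}$ having a unique critical point, located at $0$, and this critical point is non-flat. Put $\tilde\mu_P:=h_*\mu_P$, let $f:=h\circ T\circ h^{-1}$ (a $C^\omega$-unimodal map), where $T=T_{\lambda_F}$ is the Fibonacci tent map, and let $\tilde c:=h(0)$. Then $f$ has a Lorenz-like singularity at $\tilde c$, and the following hold: \begin{enumerate} \item $\chi_{\tilde\mu_P}(f)$ is not defined (the integral $\int\log|f'|\,d\tilde\mu_P$ does not exist, even as an extended real number). \item For every $x\in\overline{\mathcal O_f(\tilde c)}$, the pointwise Lyapunov exponent of $f$ at $x$ does not exist (the limit $\lim_{n\to\infty}\frac1n\log|(f^n)'(x)|$ does not exist) if $\mathcal O_f(x)\cap\mathcal S(f)=\emptyset$, and it is not defined (for all $n$ large enough $\log|(f^n)'(x)|$ is not defined) if $\mathcal O_f(x)\cap\mathcal S(f)\neq\emptyset$. \item $\log(\operatorname{dist}(\cdot,\mathcal S(f)))\notin L^1(\tilde\mu_P)$. \item $f$ has exponential recurrence of the Lorenz-like singularity orbit, that is, $$\limsup_{n\to\infty}\frac{-\log|f^n(\tilde c)-\tilde c|}{n}\in(0,+\infty).$$ \end{enumerate}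
   Context: Fibonacci tent map. Let $S(0)=1$, $S(1)=2$, $S(k)=S(k-1)+S(k-2)$ for $k\ge2$. For $s\in(0,2]$ let $T_s\colon[-1,1]\to[-1,1]$, $T_s(x)=s(1-|x|)-1$. For $j\ge1$ let $e_j\in\{0,1\}$ be $0$ if $T_s^j(y)\in[-1,0)$, and $1$ if $T_s^j(y)\in(0,1]$, for all $y>0$ sufficiently close to $0$ (kneading invariant). $T_s$ has Fibonacci recurrence if $e_1=1$ and, with $Q(k)=\max\{0,k-2\}$, for every $k\ge1$ $$e_{S(k-1)+1}e_{S(k-1)+2}\cdots e_{S(k)}=e_1e_2\cdots e_{S(Q(k))-1}\,(1-e_{S(Q(k))})$$ as words. It is known that some parameter $\lambda_F\in(0,2]$ gives a map $T_{\lambda_F}$ with Fibonacci recurrence; fix it and write $T=T_{\lambda_F}$. It is known that $T$ restricted to the Cantor set $\overline{\mathcal O_T(0)}$ is minimal and uniquely ergodic; $\mu_P$ is the unique ergodic $T$-invariant probability measure supported on $\overline{\mathcal O_T(0)}$. Notation. $\mathcal O_g(x)=\{g^n(x):n\ge0\}$; $h_*\mu=\mu\circ h^{-1}$; $\operatorname{dist}(x,A)=\inf\{|x-y|:y\in A\}$. A continuous map $f\colon[-1,1]\to[-1,1]$ is unimodal with turning point $c\in(-1,1)$ if it is increasing on $[-1,c)$ and decreasing on $(c,1]$ (if $h$ reverses orientation, "increasing" and "decreasing" are to be interchanged). A critical point of $g$ is a point $\hat c$ with $g'(\hat c)=0$; $\operatorname{Crit}(g)$ is the set of critical points. For a unimodal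 $f$ with turning point $c$, $\mathcal S(f):=\operatorname{Crit}(f)\cup\{c\}$; $f$ is $C^\omega$-unimodal if it is real analytic outside $\mathcal S(f)$. Here the turning point of $f=h\circ T\circ h^{-1}$ is $\tilde c=h(0)$. A critical point $\hat c$ of $g$ is non-flat if there are $\alpha^+,\alpha^-,M,\delta>0$ with $\left|\log\frac{|g'(x)|}{|x-\hat c|^{\alpha^+}}\right|\le M$ for all $x\in(\hat c,\hat c+\delta)$ and $\left|\log\frac{|g'(x)|}{|x-\hat c|^{\alpha^-}}\right|\le M$ for all $x\in(\hat c-\delta,\hat c)$. A point $c$ is a Lorenz-like singularity of $f$ if there are $\ell^+,\ell^-\in(0,1)$, $L>0$, $\delta>0$ with $\frac{1}{L|x-c|^{\ell^+}}\le|f'(x)|\le\frac{L}{|x-c|^{\ell^+}}$ for all $x\in(c,c+\delta)$ and $\frac{1}{L|x-c|^{\ell^-}}\le|f'(x)|\le\frac{L}{|x-c|^{\ell^-}}$ for all $x\in(c-\delta,c)$. Lyapunov exponents. $\chi_\mu(f)=\int\log|f'|\,d\mu$ if the integral exists. For $x$ with $\mathcal O_f(x)\cap\mathcal S(f)=\emptyset$, the pointwise Lyapunov exponent is $\chi_f(x)=\lim_{n\to\infty}\frac1n\log|(f^n)'(x)|$ if the limit exists. *)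

theory Defs
  imports "HOL-Probability.Probability"
begin

text \<open>
  Maps of the interval \<open>[-1,1]\<close> are represented by functions on all of \<open>real\<close> whose values outside
  \<open>[-1,1]\<close> are irrelevant: derivatives are taken within \<open>[-1,1]\<close> (one-sided at the endpoints) and
  measures live on the Borel sets of \<open>[-1,1]\<close>.
\<close>

abbreviation deriv_I :: "(real \<Rightarrow> real) \<Rightarrow> real \<Rightarrow> real" where
  "deriv_I g x \<equiv> vector_derivative g (at x within {-1..1})"

abbreviation borel_I :: "real measure" where
  "borel_I \<equiv> restrict_space borel {-1..1}"

definition forward_orbit :: "('a \<Rightarrow> 'a) \<Rightarrow> 'a \<Rightarrow> 'a set" where
  "forward_orbit g x = {(g ^^ n) x | n. True}"

definition tent :: "real \<Rightarrow> real \<Rightarrow> real" where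
  "tent s x = s * (1 - \<bar>x\<bar>) - 1"

text \<open>
  For \<open>s > 0\<close> the \<open>j\<close>-th iterate of \<open>tent s\<close> is affine with nonzero slope on a right neighbourhood
  of \<open>0\<close>, so one of the first two alternatives always applies.
\<close>

definition kneading :: "real \<Rightarrow> nat \<Rightarrow> nat" where
  "kneading s j =
     (if \<forall>\<^sub>F y in at_right 0. (tent s ^^ j) y \<in> {-1..<0} then 0
      else if \<forall>\<^sub>F y in at_right 0. (tent s ^^ j) y \<in> {0<..1} then 1
      else undefined)"

fun fib_time :: "nat \<Rightarrow> nat" where
  "fib_time 0 = 1"
| "fib_time (Suc 0) = 2"
| "fib_time (Suc (Suc k)) = fib_time (Suc k) + fib_time k"

text \<open>Truncated subtraction \<open>k - 2\<close> is the kneading map \<open>max {0, k - 2}\<close>.\<close>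

definition fibonacci_recurrence :: "real \<Rightarrow> bool" where
  "fibonacci_recurrence s \<longleftrightarrow>
     kneading s 1 = 1 \<and>
     (\<forall>k\<ge>1. map (kneading s) [fib_time (k - 1) + 1..<fib_time k + 1] =
            map (kneading s) [1..<fib_time (k - 2)] @ [1 - kneading s (fib_time (k - 2))])"

definition invariant_prob :: "(real \<Rightarrow> real) \<Rightarrow> real measure \<Rightarrow> bool" where
  "invariant_prob g \<mu> \<longleftrightarrow>
     prob_space \<mu> \<and> sets \<mu> = sets borel_I \<and> g \<in> measurable \<mu> \<mu> \<and> distr \<mu> \<mu> g = \<mu>"

definition ergodic_prob :: "(real \<Rightarrow> real) \<Rightarrow> real measure \<Rightarrow> bool" where
  "ergodic_prob g \<mu> \<longleftrightarrow>
     invariant_prob g \<mu> \<and>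
     (\<forall>A\<in>sets \<mu>. g -` A \<inter> space \<mu> = A \<longrightarrow> measure \<mu> A = 0 \<or> measure \<mu> A = 1)"

definition supported_on :: "real measure \<Rightarrow> real set \<Rightarrow> bool" where
  "supported_on \<mu> K \<longleftrightarrow> emeasure \<mu> (space \<mu> - K) = 0"

text \<open>
  Local power series relative to \<open>S\<close>; at an endpoint of an interval this is analyticity up to the
  endpoint.
\<close>

definition real_analytic_on :: "(real \<Rightarrow> real) \<Rightarrow> real set \<Rightarrow> bool" where
  "real_analytic_on g S \<longleftrightarrow>
     (\<forall>x\<in>S. \<exists>r>0. \<exists>a. \<forall>y\<in>S. \<bar>y - x\<bar> < r \<longrightarrow> (\<lambda>n. a n * (y - x) ^ n) sums g y)"

definition Crit :: "(real \<Rightarrow> real) \<Rightarrow> real set" where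
  "Crit g = {x\<in>{-1..1}. (g has_real_derivative 0) (at x within {-1..1})}"

definition Sing :: "(real \<Rightarrow> real) \<Rightarrow> real \<Rightarrow> real set" where
  "Sing f c = Crit f \<union> {c}"

definition unimodal :: "(real \<Rightarrow> real) \<Rightarrow> real \<Rightarrow> bool" where
  "unimodal f c \<longleftrightarrow>
     continuous_on {-1..1} f \<and> f ` {-1..1} \<subseteq> {-1..1} \<and> c \<in> {-1<..<1} \<and>
     strict_mono_on {-1..<c} f \<and> strict_antimono_on {c<..1} f"

definition reversed_unimodal :: "(real \<Rightarrow> real) \<Rightarrow> real \<Rightarrow> bool" where
  "reversed_unimodal f c \<longleftrightarrow>
     continuous_on {-1..1} f \<and> f ` {-1..1} \<subseteq> {-1..1} \<and> c \<in> {-1<..<1} \<and>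
     strict_antimono_on {-1..<c} f \<and> strict_mono_on {c<..1} f"

text \<open>
  The logarithm of \<open>\<bar>g'(x)\<bar>\<close> is defined as a real number. This is spelled out where needed because
  \<open>vector_derivative\<close> is arbitrary at points of non-differentiability and \<open>ln 0 = 0\<close>.
\<close>

definition log_deriv_defined :: "(real \<Rightarrow> real) \<Rightarrow> real \<Rightarrow> bool" where
  "log_deriv_defined g x \<longleftrightarrow>
     g differentiable (at x within {-1..1}) \<and> deriv_I g x \<noteq> 0"

definition non_flat :: "(real \<Rightarrow> real) \<Rightarrow> real \<Rightarrow> bool" where
  "non_flat g c \<longleftrightarrow>
     (\<exists>ap>0. \<exists>am>0. \<exists>M>0. \<exists>\<delta>>0.
        (\<forall>x\<in>{c<..<c + \<delta>}. log_deriv_defined g x \<and>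
           \<bar>ln (\<bar>deriv_I g x\<bar> / \<bar>x - c\<bar> powr ap)\<bar> \<le> M) \<and>
        (\<forall>x\<in>{c - \<delta><..<c}. log_deriv_defined g x \<and>
           \<bar>ln (\<bar>deriv_I g x\<bar> / \<bar>x - c\<bar> powr am)\<bar> \<le> M))"

definition lorenz_like :: "(real \<Rightarrow> real) \<Rightarrow> real \<Rightarrow> bool" where
  "lorenz_like f c \<longleftrightarrow>
     (\<exists>lp\<in>{0<..<1}. \<exists>lm\<in>{0<..<1}. \<exists>L>0. \<exists>\<delta>>0.
        (\<forall>x\<in>{c<..<c + \<delta>}. f differentiable (at x within {-1..1}) \<and>
           1 / (L * \<bar>x - c\<bar> powr lp) \<le> \<bar>deriv_I f x\<bar> \<and>
           \<bar>deriv_I f x\<bar> \<le> L / \<bar>x - c\<bar> powr lp) \<and>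
        (\<forall>x\<in>{c - \<delta><..<c}. f differentiable (at x within {-1..1}) \<and>
           1 / (L * \<bar>x - c\<bar> powr lm) \<le> \<bar>deriv_I f x\<bar> \<and>
           \<bar>deriv_I f x\<bar> \<le> L / \<bar>x - c\<bar> powr lm))"

definition elog :: "real \<Rightarrow> ereal" where
  "elog t = (if t = 0 then -\<infinity> else ereal (ln t))"

text \<open>
  The integral of a measurable \<open>\<phi>\<close> exists in \<open>[-\<infinity>,\<infinity>]\<close> iff its positive or its negative part has
  finite integral; \<open>e2ennreal\<close> maps negative numbers to \<open>0\<close>.
\<close>

definition extended_integral_exists :: "'a measure \<Rightarrow> ('a \<Rightarrow> ereal) \<Rightarrow> bool" where
  "extended_integral_exists \<mu> \<phi> \<longleftrightarrow>
     (\<integral>\<^sup>+x. e2ennreal (\<phi> x) \<partial>\<mu>) < \<infinity> \<or> (\<integral>\<^sup>+x. e2ennreal (- \<phi> x) \<partial>\<mu>) < \<infinity>"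

end

theory Submission
  imports Defs "HOL-Complex_Analysis.Complex_Analysis"
begin

text \<open>
  Write \<open>c\<^sub>n = T\<^sup>n(0)\<close>, \<open>S(k)\<close> for the Fibonacci times and \<open>d\<^sub>k = \<bar>c\<^sub>m\<bar>\<close> with \<open>m = S(k)\<close>. Fibonacci
  recurrence says that after time \<open>S(k)\<close> the kneading sequence repeats itself for \<open>S(k-1) - 1\<close>
  symbols and then differs. As long as the symbols of two points agree, \<open>T\<close> multiplies their distance
  by exactly \<open>lam\<close>; when they differ, the points lie on opposite sides of \<open>0\<close>, so that their distance
  is the sum of their distances to \<open>0\<close>. This turns the combinatorics into the exact recursion
  \<open>d\<^bsub>k+1\<^esub> + d\<^bsub>k-1\<^esub> = lam\<^bsup>S(k-1)\<^esup> d\<^sub>k\<close> (\<open>return_dist_rec\<close>). Since the orbit is bounded, \<open>d\<^sub>k\<close> must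
  decrease, and then it decreases superexponentially: \<open>-ln d\<^sub>k\<close> lies between constant multiples of
  \<open>S(k)\<close> for large \<open>k\<close>.

  Two facts about orbits carry everything else. The first is that \<open>S(k)\<close> is essentially a closest
  return time: \<open>\<bar>c\<^sub>n\<bar> \<ge> d\<^bsub>k+1\<^esub>\<close> for \<open>1 \<le> n < S(k+1)\<close> (\<open>crit_orbit_lower\<close>); it bounds the
  recurrence of the turning point from above, and it shows that \<open>0\<close> is not periodic. The second is that
  every orbit in the attractor comes \<open>11 d\<^sub>j\<close>-close to \<open>0\<close> within \<open>S(j+1)\<close> steps
  (\<open>attractor_recurrence\<close>). So the time needed for a return and the logarithm of its distance are
  comparable.

  For an invariant probability measure on the attractor, the second fact gives the set
  \<open>{\<bar>x\<bar> \<le> 11 d\<^sub>j}\<close> measure at least \<open>1 / (S(j+1) + 1)\<close>, while \<open>-ln \<bar>x\<bar>\<close> is at least a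
  constant times \<open>S(j)\<close> on it. The integral of \<open>-ln \<bar>x\<bar>\<close> over these sets stays away from \<open>0\<close> although
  they shrink to the null set \<open>{0}\<close>, hence \<open>ln \<bar>x\<bar>\<close> is not integrable (\<open>nn_integral_log_pole\<close>).

  The conjugate map satisfies \<open>\<bar>f'(h p)\<bar> = lam \<bar>h'(T p)\<bar> / \<bar>h'(p)\<bar>\<close>, and \<open>\<bar>h'(p)\<bar>\<close> behaves like a
  power of \<open>\<bar>p\<bar>\<close> at \<open>0\<close> and is bounded away from \<open>0\<close> and \<open>\<infinity>\<close> elsewhere. So \<open>ln \<bar>f'\<bar>\<close> has a pole of
  the above kind at \<open>p = 0\<close> with sign \<open>+\<close>, and one at \<open>T p = 0\<close> with sign \<open>-\<close>; invariance of the measure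
  makes both integrals infinite, and the integral of \<open>ln \<bar>f'\<bar>\<close> does not exist. Telescoping gives
  \<open>ln \<bar>(f\<^sup>n)'(h p)\<bar> = n ln lam + ln \<bar>h'(T\<^sup>n p)\<bar> - ln \<bar>h'(p)\<bar>\<close>: at a close return \<open>n\<close> the middle term
  is at most \<open>-const n\<close>, and one step later it is bounded, because \<open>T\<^bsup>n+1\<^esup> p\<close> is then close to
  \<open>T(0) \<noteq> 0\<close>. The averages therefore oscillate. If the orbit of \<open>p\<close> meets \<open>0\<close>, then \<open>T\<^sup>n\<close> has a fold at
  \<open>p\<close> which later iterates cannot undo, because they are local diffeomorphisms along the orbit of \<open>T(0)\<close>.

  Analyticity of \<open>f\<close> involves the inverse of \<open>h\<close>; a local power series of \<open>h\<close> extends to a holomorphic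
  function, and the holomorphic inverse function theorem applies.
\<close>

section \<open>Fibonacci times\<close>

lemma fib_time_pos: "fib_time k \<ge> 1"
  by (induction k rule: fib_time.induct) auto

lemma fib_time_ge: "fib_time k \<ge> k + 1"
proof (induction k rule: fib_time.induct)
  case (3 k)
  then show ?case using fib_time_pos[of k] by simp
qed auto

lemma fib_time_step: "k \<ge> 1 \<Longrightarrow> fib_time (Suc k) = fib_time k + fib_time (k - 1)"
  by (cases k) auto

lemma fib_time_less_Suc: "fib_time k < fib_time (Suc k)"
proof (cases k)
  case (Suc j)
  then show ?thesis using fib_time_pos[of j] by simp
qed auto

lemma strict_mono_fib_time: "strict_mono fib_time"
  by (rule strict_mono_Suc_iff[THEN iffD2]) (auto intro: fib_time_less_Suc)

lemma fib_time_mono: "i \<le> j \<Longrightarrow> fib_time i \<le> fib_time j"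
  using strict_mono_fib_time strict_mono_mono monoD by blast

lemma fib_time_Suc_le: "fib_time (Suc k) \<le> 2 * fib_time k"
proof (cases k)
  case (Suc j)
  then show ?thesis using fib_time_mono[of j "Suc j"] by simp
qed auto

lemma fib_time_bracket:
  assumes "n \<ge> 1"
  obtains k where "fib_time k \<le> n" "n < fib_time (Suc k)"
proof -
  have fin: "finite {k. fib_time k \<le> n}"
    by (rule finite_subset[of _ "{..n}"]) (use fib_time_ge in \<open>auto simp: Suc_le_eq intro: order.trans less_imp_le\<close>)
  have ne: "{k. fib_time k \<le> n} \<noteq> {}" using assms by (auto intro: exI[of _ 0])
  define k where "k = Max {k. fib_time k \<le> n}"
  have "fib_time k \<le> n" using Max_in[OF fin ne] by (simp add: k_def)
  moreover have "\<not> fib_time (Suc k) \<le> n"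
    using Max_ge[OF fin, of "Suc k"] by (auto simp: k_def)
  ultimately show thesis using that by auto
qed

section \<open>Iterates of tent maps and the kneading sequence\<close>

lemma tent_mem: "s \<in> {0..2} \<Longrightarrow> x \<in> {-1..1} \<Longrightarrow> tent s x \<in> {-1..1}"
proof -
  assume a: "s \<in> {0..2}" "x \<in> {-1..1}"
  have "s * (1 - \<bar>x\<bar>) \<le> 2 * 1" using a by (intro mult_mono) auto
  moreover have "0 \<le> s * (1 - \<bar>x\<bar>)" using a by auto
  ultimately show ?thesis by (simp add: tent_def)
qed

lemma tent_iter_mem: "s \<in> {0..2} \<Longrightarrow> x \<in> {-1..1} \<Longrightarrow> (tent s ^^ n) x \<in> {-1..1}"
proof (induction n)
  case (Suc n)
  then show ?case using tent_mem[of s "(tent s ^^ n) x"] by simp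
qed simp

lemma continuous_on_tent_iter: "continuous_on A (tent s ^^ n)"
proof (induction n)
  case (Suc n)
  have "continuous_on ((tent s ^^ n) ` A) (tent s)"
    unfolding tent_def by (intro continuous_intros)
  then show ?case using Suc continuous_on_compose by (auto simp: o_def)
qed (simp add: id_def)

lemma isCont_tent_iter: "isCont (tent s ^^ n) x"
  using continuous_on_tent_iter[of UNIV] by (auto simp: continuous_on_eq_continuous_at)

lemma abs_diff_same_side: "x * y \<ge> 0 \<Longrightarrow> \<bar>\<bar>x\<bar> - \<bar>y\<bar>\<bar> = \<bar>x - y\<bar>" for x y :: real
  by (auto simp: abs_if zero_le_mult_iff)

lemma tent_iter_lipschitz:
  "s \<ge> 0 \<Longrightarrow> \<bar>(tent s ^^ n) x - (tent s ^^ n) y\<bar> \<le> s ^ n * \<bar>x - y\<bar>"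
proof (induction n)
  case (Suc n)
  define u v where "u = (tent s ^^ n) x" and "v = (tent s ^^ n) y"
  have "tent s u - tent s v = s * (\<bar>v\<bar> - \<bar>u\<bar>)"
    by (simp add: tent_def algebra_simps)
  then have "\<bar>tent s u - tent s v\<bar> = s * \<bar>\<bar>u\<bar> - \<bar>v\<bar>\<bar>"
    using Suc.prems by (simp add: abs_mult abs_minus_commute)
  also have "\<dots> \<le> s * (s ^ n * \<bar>x - y\<bar>)"
    using Suc by (intro mult_left_mono order.trans[OF abs_triangle_ineq3]) (auto simp: u_def v_def)
  finally show ?case by (simp add: u_def v_def mult.assoc)
qed simp

text \<open>
  A tent map is affine with slope \<open>\<plusminus>s\<close> on each side of \<open>0\<close>, so distances are multiplied by exactly \<open>s\<close> as
  long as the two orbits do not separate. The product may vanish: a point at \<open>0\<close> belongs to both sides.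
\<close>

lemma tent_iter_same_side:
  assumes "s \<ge> 0" and "\<And>i. i < n \<Longrightarrow> (tent s ^^ i) x * (tent s ^^ i) y \<ge> 0"
  shows "\<bar>(tent s ^^ n) x - (tent s ^^ n) y\<bar> = s ^ n * \<bar>x - y\<bar>"
  using assms(2)
proof (induction n)
  case (Suc n)
  define u v where "u = (tent s ^^ n) x" and "v = (tent s ^^ n) y"
  have "tent s u - tent s v = s * (\<bar>v\<bar> - \<bar>u\<bar>)"
    by (simp add: tent_def algebra_simps)
  then have "\<bar>tent s u - tent s v\<bar> = s * \<bar>\<bar>u\<bar> - \<bar>v\<bar>\<bar>"
    using assms(1) by (simp add: abs_mult abs_minus_commute)
  also have "\<dots> = s * \<bar>u - v\<bar>"
    using Suc.prems[of n] by (simp add: abs_diff_same_side u_def v_def)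
  finally show ?case using Suc by (simp add: u_def v_def)
qed simp

text \<open>
  Tent maps are even, so the sign of the initial point may be chosen at will when comparing orbits.
\<close>

lemma tent_iter_abs: "m \<ge> 1 \<Longrightarrow> (tent s ^^ m) \<bar>x\<bar> = (tent s ^^ m) x"
proof -
  assume "m \<ge> 1"
  then obtain n where "m = Suc n" by (cases m) auto
  then show ?thesis by (simp only: funpow_Suc_right o_apply tent_def abs_idempotent)
qed

lemma affine_sign_at_right:
  fixes a b :: real
  assumes "b \<noteq> 0"
  shows "(\<forall>\<^sub>F y in at_right 0. a + b * y > 0) \<or> (\<forall>\<^sub>F y in at_right 0. a + b * y < 0)"
proof -
  have tend: "((\<lambda>y. a + b * y) \<longlongrightarrow> a + b * 0) (at_right 0)" by (intro tendsto_intros)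
  have pos: "\<forall>\<^sub>F y in at_right 0. y > (0::real)" by (simp add: eventually_at_right_less)
  consider "a > 0" | "a < 0" | "a = 0" "b > 0" | "a = 0" "b < 0" using assms by linarith
  then show ?thesis
  proof cases
    case 1
    then show ?thesis using order_tendstoD(1)[OF tend, of 0] by simp
  next
    case 2
    then show ?thesis using order_tendstoD(2)[OF tend, of 0] by simp
  next
    case 3
    then show ?thesis using pos by (auto elim: eventually_mono)
  next
    case 4
    have "\<forall>\<^sub>F y in at_right 0. a + b * y < 0"
      using pos by (rule eventually_mono) (use 4 in \<open>auto simp: mult_less_0_iff\<close>)
    then show ?thesis ..
  qed
qed

text \<open>
  An affine function with nonzero slope has a constant sign to the right of \<open>0\<close>, even if it vanishes at
  \<open>0\<close>; so the next fold is not seen there and affinity persists.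
\<close>

lemma tent_iter_affine_at_right:
  assumes "s > 0"
  shows "\<exists>a b. b \<noteq> 0 \<and> (\<forall>\<^sub>F y in at_right 0. (tent s ^^ n) y = a + b * y)"
proof (induction n)
  case 0
  show ?case by (rule exI[of _ 0], rule exI[of _ 1]) auto
next
  case (Suc n)
  then obtain a b where b: "b \<noteq> 0" and ev: "\<forall>\<^sub>F y in at_right 0. (tent s ^^ n) y = a + b * y"
    by blast
  from affine_sign_at_right[OF b, of a] show ?case
  proof
    assume "\<forall>\<^sub>F y in at_right 0. a + b * y > 0"
    then have "\<forall>\<^sub>F y in at_right 0. (tent s ^^ Suc n) y = (s - s * a - 1) + (- s * b) * y"
      using ev by eventually_elim (simp add: tent_def algebra_simps)
    then show ?thesis using b assms
      by (intro exI[of _ "s - s * a - 1"] exI[of _ "- s * b"]) simp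
  next
    assume "\<forall>\<^sub>F y in at_right 0. a + b * y < 0"
    then have "\<forall>\<^sub>F y in at_right 0. (tent s ^^ Suc n) y = (s + s * a - 1) + (s * b) * y"
      using ev by eventually_elim (simp add: tent_def algebra_simps)
    then show ?thesis using b assms
      by (intro exI[of _ "s + s * a - 1"] exI[of _ "s * b"]) simp
  qed
qed

lemma kneading_cases:
  assumes "s \<in> {0<..2}"
  shows "kneading s j = 0 \<and> (\<forall>\<^sub>F y in at_right 0. (tent s ^^ j) y < 0) \<or>
         kneading s j = 1 \<and> (\<forall>\<^sub>F y in at_right 0. (tent s ^^ j) y > 0)"
proof -
  obtain a b where b: "b \<noteq> 0" and ev: "\<forall>\<^sub>F y in at_right 0. (tent s ^^ j) y = a + b * y"
    using tent_iter_affine_at_right[of s j] assms by auto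
  have "\<forall>\<^sub>F y in at_right 0. y < (1::real)" "\<forall>\<^sub>F y in at_right 0. y > (0::real)"
    by (auto simp: eventually_at_right_less intro: order_tendstoD(2)[OF tendsto_ident_at])
  then have bnd: "\<forall>\<^sub>F y in at_right 0. (tent s ^^ j) y \<in> {-1..1}"
    by eventually_elim (rule tent_iter_mem, use assms in auto)
  from affine_sign_at_right[OF b, of a] show ?thesis
  proof
    assume p: "\<forall>\<^sub>F y in at_right 0. a + b * y > 0"
    then have 1: "\<forall>\<^sub>F y in at_right 0. (tent s ^^ j) y \<in> {0<..1}"
      using ev bnd by eventually_elim auto
    have "\<not> (\<forall>\<^sub>F y in at_right 0. (tent s ^^ j) y \<in> {-1..<0})"
    proof
      assume "\<forall>\<^sub>F y in at_right 0. (tent s ^^ j) y \<in> {-1..<0}"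
      then have "\<forall>\<^sub>F y in at_right (0::real). False" using 1 by eventually_elim auto
      then show False by simp
    qed
    then have "kneading s j = 1" using 1 by (simp add: kneading_def)
    moreover have "\<forall>\<^sub>F y in at_right 0. (tent s ^^ j) y > 0" using 1 by (rule eventually_mono) auto
    ultimately show ?thesis by simp
  next
    assume p: "\<forall>\<^sub>F y in at_right 0. a + b * y < 0"
    then have 1: "\<forall>\<^sub>F y in at_right 0. (tent s ^^ j) y \<in> {-1..<0}"
      using ev bnd by eventually_elim auto
    then have "kneading s j = 0" by (simp add: kneading_def)
    moreover have "\<forall>\<^sub>F y in at_right 0. (tent s ^^ j) y < 0" using 1 by (rule eventually_mono) auto
    ultimately show ?thesis by simp
  qed
qed

lemma kneading_sign:
  assumes "s \<in> {0<..2}"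
  shows "\<forall>\<^sub>F y in at_right 0. kneading s j = 0 \<and> (tent s ^^ j) y < 0 \<or>
                           kneading s j = 1 \<and> (tent s ^^ j) y > 0"
  using kneading_cases[OF assms, of j] by auto

lemma kneading_eq_same_side:
  assumes "s \<in> {0<..2}" "kneading s i = kneading s j"
  shows "\<forall>\<^sub>F y in at_right 0. (tent s ^^ i) y * (tent s ^^ j) y \<ge> 0"
  using kneading_sign[OF assms(1), of i] kneading_sign[OF assms(1), of j]
  by eventually_elim (use assms(2) in \<open>auto simp: zero_le_mult_iff\<close>)

lemma kneading_flip_opposite_side:
  assumes "s \<in> {0<..2}" "kneading s i = 1 - kneading s j"
  shows "\<forall>\<^sub>F y in at_right 0. (tent s ^^ i) y * (tent s ^^ j) y \<le> 0"
  using kneading_sign[OF assms(1), of i] kneading_sign[OF assms(1), of j]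
  by eventually_elim (use assms(2) in \<open>auto simp: mult_le_0_iff\<close>)

section \<open>Close returns of the turning point\<close>

locale fibonacci_tent =
  fixes lam :: real
  assumes lam_range: "lam \<in> {0<..2}" and recurrence: "fibonacci_recurrence lam"
begin

abbreviation T where "T \<equiv> tent lam"

definition crit_orbit :: "nat \<Rightarrow> real" where "crit_orbit n = (T ^^ n) 0"

lemma crit_orbit_add: "(T ^^ m) (crit_orbit n) = crit_orbit (n + m)"
  by (simp add: crit_orbit_def funpow_add add.commute[of n])

definition return_dist :: "nat \<Rightarrow> real" where "return_dist k = \<bar>crit_orbit (fib_time k)\<bar>"

lemma kneading_word:
  "map (kneading lam) [fib_time (Suc j) + 1..<fib_time (Suc (Suc j)) + 1] =
   map (kneading lam) [1..<fib_time j] @ [1 - kneading lam (fib_time j)]"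
proof -
  have "\<forall>k\<ge>1. map (kneading lam) [fib_time (k - 1) + 1..<fib_time k + 1] =
            map (kneading lam) [1..<fib_time (k - 2)] @ [1 - kneading lam (fib_time (k - 2))]"
    using recurrence unfolding fibonacci_recurrence_def by blast
  from this[rule_format, of "Suc (Suc j)"] show ?thesis
    by (simp del: upt_Suc fib_time.simps)
qed

lemma kneading_repeat:
  assumes "k \<ge> 1" "1 \<le> i" "i < fib_time (k - 1)"
  shows "kneading lam (fib_time k + i) = kneading lam i"
proof -
  obtain j where k: "k = Suc j" using assms by (cases k) auto
  from arg_cong[OF kneading_word[of j], of "\<lambda>xs. xs ! (i - 1)"] show ?thesis
    using assms by (simp add: k nth_append del: upt_Suc)
qed

lemma kneading_flip:
  assumes "k \<ge> 1"
  shows "kneading lam (fib_time (Suc k)) = 1 - kneading lam (fib_time (k - 1))"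
proof -
  obtain j where k: "k = Suc j" using assms by (cases k) auto
  from arg_cong[OF kneading_word[of j], of last] show ?thesis
    using fib_time_less_Suc[of k] by (simp add: k last_map del: fib_time.simps)
qed

text \<open>
  For small \<open>y > 0\<close> compare the orbits of \<open>u = T\<^bsup>S(k)\<^esup> y\<close> and \<open>y\<close>: by \<open>kneading_repeat\<close> they stay on the same
  sides, except perhaps at time \<open>0\<close>, where \<open>u\<close> is replaced by \<open>\<bar>u\<bar>\<close>. The claim is the limit \<open>y \<rightarrow> 0\<close>. Working
  with \<open>y > 0\<close> is necessary because the kneading sequence records one-sided signs, and at this stage some \<open>c\<^sub>n\<close>
  might vanish.
\<close>

lemma crit_orbit_shadow:
  assumes "k \<ge> 1" "m \<le> fib_time (k - 1)"
  shows "\<bar>crit_orbit (fib_time k + m) - crit_orbit m\<bar> = lam ^ m * return_dist k"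
proof (cases "m = 0")
  case True
  then show ?thesis by (simp add: crit_orbit_def return_dist_def)
next
  case False
  \<comment> \<open>vanishes for small positive arguments, hence also at zero by continuity\<close>
  define F where "F y = \<bar>(T ^^ m) ((T ^^ fib_time k) y) - (T ^^ m) y\<bar>
      - lam ^ m * \<bar>\<bar>(T ^^ fib_time k) y\<bar> - \<bar>y\<bar>\<bar>" for y
  have "isCont F 0" unfolding F_def
    by (intro continuous_intros isCont_tent_iter continuous_within_compose3[OF isCont_tent_iter]) 
  then have lim: "(F \<longlongrightarrow> F 0) (at_right 0)"
    by (simp add: isCont_def filterlim_at_split)
  have "\<forall>\<^sub>F y in at_right 0. \<forall>i\<in>{1..<m}. (T ^^ (fib_time k + i)) y * (T ^^ i) y \<ge> 0"
    using assms by (intro eventually_ball_finite) (auto intro!: kneading_eq_same_side lam_range kneading_repeat)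
  moreover have "\<forall>\<^sub>F y in at_right 0. y > (0::real)" by (simp add: eventually_at_right_less)
  ultimately have "\<forall>\<^sub>F y in at_right 0. F y = 0"
  proof eventually_elim
    case (elim y)
    define u where "u = (T ^^ fib_time k) y"
    have "(T ^^ i) \<bar>u\<bar> * (T ^^ i) y \<ge> 0" if "i < m" for i
    proof (cases "i = 0")
      case False
      then have "(T ^^ i) \<bar>u\<bar> = (T ^^ (fib_time k + i)) y"
        by (simp add: tent_iter_abs u_def add.commute[of _ i] funpow_add)
      then show ?thesis using elim that False by auto
    qed (use elim in simp)
    then have "\<bar>(T ^^ m) \<bar>u\<bar> - (T ^^ m) y\<bar> = lam ^ m * \<bar>\<bar>u\<bar> - y\<bar>"
      using lam_range by (intro tent_iter_same_side) auto
    then show ?case using False elim by (simp add: F_def tent_iter_abs flip: u_def)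
  qed
  then have "(F \<longlongrightarrow> 0) (at_right 0)" by (rule tendsto_eventually)
  with lim have "F 0 = 0" by (intro tendsto_unique[OF trivial_limit_at_right_real])
  then show ?thesis
    by (simp add: F_def crit_orbit_def return_dist_def add.commute[of _ m] funpow_add)
qed

text \<open>
  At time \<open>S(k-1)\<close> the symbols differ, so the two points compared in \<open>crit_orbit_shadow\<close> have opposite signs and
  their distance is the sum of their absolute values.
\<close>

lemma return_dist_rec:
  assumes "k \<ge> 1"
  shows "return_dist (Suc k) + return_dist (k - 1) = lam ^ fib_time (k - 1) * return_dist k"
proof -
  let ?a = "crit_orbit (fib_time (Suc k))" and ?b = "crit_orbit (fib_time (k - 1))"
  have "isCont (\<lambda>y. (T ^^ fib_time (Suc k)) y * (T ^^ fib_time (k - 1)) y) 0"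
    by (intro continuous_intros isCont_tent_iter)
  then have "((\<lambda>y. (T ^^ fib_time (Suc k)) y * (T ^^ fib_time (k - 1)) y) \<longlongrightarrow> ?a * ?b) (at_right 0)"
    by (simp add: isCont_def filterlim_at_split crit_orbit_def)
  then have "?a * ?b \<le> 0"
    by (rule tendsto_upperbound)
      (rule kneading_flip_opposite_side[OF lam_range kneading_flip[OF assms]], simp)
  then have "\<bar>?a - ?b\<bar> = \<bar>?a\<bar> + \<bar>?b\<bar>" by (auto simp: mult_le_0_iff)
  then show ?thesis
    using crit_orbit_shadow[OF assms order.refl] by (simp add: return_dist_def fib_time_step[OF assms])
qed

lemma lam_gt_1: "lam > 1"
proof -
  have "kneading lam 1 = 1" using recurrence by (simp add: fibonacci_recurrence_def)
  then have "\<forall>\<^sub>F y in at_right 0. T y > 0" using kneading_cases[OF lam_range, of 1] by auto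
  moreover have "\<forall>\<^sub>F y in at_right 0. y > (0::real)" by (simp add: eventually_at_right_less)
  ultimately have "\<forall>\<^sub>F y in at_right (0::real). lam > 1"
  proof eventually_elim
    case (elim y)
    have "lam * y > 0" using lam_range elim by simp
    then show ?case using elim by (simp add: tent_def algebra_simps)
  qed
  then show ?thesis by simp
qed

lemma return_dist_0: "return_dist 0 = lam - 1"
  using lam_gt_1 by (simp add: return_dist_def crit_orbit_def tent_def)

lemma return_dist_1: "return_dist (Suc 0) = (lam - 1)\<^sup>2"
proof -
  have "crit_orbit 2 = - (lam - 1)\<^sup>2" using lam_gt_1
    by (simp add: crit_orbit_def tent_def eval_nat_numeral algebra_simps)
  then show ?thesis by (simp add: return_dist_def numeral_2_eq_2)
qed

lemma return_dist_nonneg: "return_dist k \<ge> 0"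
  by (simp add: return_dist_def)

lemma return_dist_le_1: "return_dist k \<le> 1"
  using tent_iter_mem[of lam 0 "fib_time k"] lam_range by (auto simp: return_dist_def crit_orbit_def)

text \<open>
  This is \<open>d\<^sub>2 \<ge> 0\<close>, with \<open>d\<^sub>0 = lam - 1\<close> and \<open>d\<^sub>1 = (lam - 1)\<^sup>2\<close> inserted into the recursion.
\<close>

lemma lam_golden: "lam\<^sup>2 \<ge> lam + 1"
proof -
  have "lam * (lam - 1)\<^sup>2 - (lam - 1) \<ge> 0"
    using return_dist_rec[of 1] return_dist_0 return_dist_1 return_dist_nonneg[of 2]
    by (simp add: numeral_2_eq_2)
  then have "(lam - 1) * (lam * (lam - 1) - 1) \<ge> 0" by (simp add: power2_eq_square algebra_simps)
  then have "lam * (lam - 1) - 1 \<ge> 0" using lam_gt_1 mult_pos_neg[of "lam - 1" "lam * (lam - 1) - 1"]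
    by linarith
  then show ?thesis by (simp add: power2_eq_square algebra_simps)
qed

text \<open>
  Rational bounds that make the contraction factors \<open>lam\<^bsup>-S(k)\<^esup>\<close> explicit; values just below the golden ratio suffice.
\<close>

lemma lam_bounds: "lam \<ge> 8/5" "lam\<^sup>2 \<ge> 13/5" "lam ^ 3 \<ge> 104/25"
proof -
  show 1: "lam \<ge> 8/5"
  proof (rule ccontr)
    assume "\<not> 8/5 \<le> lam"
    then have "lam * (lam - 1) \<le> 8/5 * (8/5 - 1)" using lam_gt_1 by (intro mult_mono) auto
    then show False using lam_golden by (simp add: power2_eq_square algebra_simps)
  qed
  show 2: "lam\<^sup>2 \<ge> 13/5" using 1 lam_golden by simp
  have "lam ^ 3 = lam * lam\<^sup>2" by (simp add: eval_nat_numeral)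
  also have "\<dots> \<ge> 8/5 * (13/5)" using 1 2 by (intro mult_mono) auto
  finally show "lam ^ 3 \<ge> 104/25" by simp
qed

lemma lam_power_ge: "m \<le> n \<Longrightarrow> lam ^ m \<le> lam ^ n"
  using lam_gt_1 by (intro power_increasing) auto

lemma lam_power_pos: "lam ^ n > 0" using lam_gt_1 by simp

text \<open>
  Dropping \<open>d\<^bsub>k+1\<^esub>\<close> from the recursion gives \<open>d\<^sub>k \<ge> lam\<^bsup>-S(k-1)\<^esup> d\<^bsub>k-1\<^esub>\<close>, and the exponents add up to
  less than \<open>S(k+1)\<close>.
\<close>

lemma return_dist_lower: "return_dist k * lam ^ fib_time (Suc k) \<ge> lam - 1"
proof (induction k)
  case 0
  have "(lam - 1) * 1 \<le> (lam - 1) * lam ^ 2" using lam_gt_1 by (intro mult_left_mono) auto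
  then show ?case by (simp add: return_dist_0 numeral_2_eq_2)
next
  case (Suc k)
  have "return_dist k \<le> lam ^ fib_time k * return_dist (Suc k)"
  proof (cases k)
    case 0
    have "(lam - 1) * 1 \<le> (lam - 1) * (lam * (lam - 1))"
      using lam_gt_1 lam_golden by (intro mult_left_mono) (auto simp: power2_eq_square algebra_simps)
    then show ?thesis
      by (simp add: 0 return_dist_0 return_dist_1 power2_eq_square algebra_simps)
  next
    case (Suc j)
    then show ?thesis using return_dist_rec[of "Suc k"] return_dist_nonneg[of "Suc (Suc k)"] by simp
  qed
  then have "return_dist k * lam ^ fib_time (Suc k)
      \<le> (lam ^ fib_time k * return_dist (Suc k)) * lam ^ fib_time (Suc k)"
    using lam_power_pos by (intro mult_right_mono) (auto intro: less_imp_le)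
  also have "\<dots> = return_dist (Suc k) * lam ^ fib_time (Suc (Suc k))"
    by (simp add: power_add)
  finally show ?case using Suc by linarith
qed

lemma return_dist_pos: "return_dist k > 0"
proof -
  have "return_dist k * lam ^ fib_time (Suc k) > 0" using return_dist_lower[of k] lam_gt_1 by linarith
  then show ?thesis using lam_power_pos by (rule zero_less_mult_pos2)
qed

text \<open>
  If the sequence increased once, the recursion would make it grow geometrically for ever, contrary to
  \<open>d\<^sub>k \<le> 1\<close>.
\<close>

lemma return_dist_Suc_le: "return_dist (Suc k) \<le> return_dist k"
proof (cases "k = 0")
  case True
  have "(lam - 1) * (lam - 1) \<le> (lam - 1) * 1" using lam_gt_1 lam_range by (intro mult_left_mono) auto
  then show ?thesis using True return_dist_0 return_dist_1 by (simp add: power2_eq_square)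
next
  case False
  show ?thesis
  proof (rule ccontr)
    assume neg: "\<not> return_dist (Suc k) \<le> return_dist k"
    have grow: "return_dist (k + i) \<le> return_dist (Suc (k + i)) \<and>
        return_dist (Suc (k + i)) \<ge> (8/5) ^ i * return_dist (Suc k)" for i
    proof (induction i)
      case 0
      then show ?case using neg by simp
    next
      case (Suc i)
      let ?n = "k + i"
      have "lam ^ 2 \<le> lam ^ fib_time ?n"
        using fib_time_ge[of ?n] False by (intro lam_power_ge) linarith
      then have "13/5 * return_dist (Suc ?n) \<le> lam ^ fib_time ?n * return_dist (Suc ?n)"
        using lam_bounds(2) return_dist_nonneg by (intro mult_right_mono) auto
      then have "return_dist (Suc (Suc ?n)) \<ge> 8/5 * return_dist (Suc ?n)"
        using return_dist_rec[of "Suc ?n"] Suc.IH by auto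
      moreover from this have "return_dist (Suc (Suc ?n)) \<ge> return_dist (Suc ?n)"
        using return_dist_nonneg[of "Suc ?n"] by linarith
      ultimately show ?case using Suc.IH by auto
    qed
    obtain i where "(8/5) ^ i > 1 / return_dist (Suc k)"
      using real_arch_pow[of "8/5"] by auto
    then have "(8/5) ^ i * return_dist (Suc k) > 1"
      using return_dist_pos[of "Suc k"] by (simp add: field_simps)
    then show False using grow[of i] return_dist_le_1[of "Suc (k + i)"] by linarith
  qed
qed

lemma return_dist_antimono: "i \<le> j \<Longrightarrow> return_dist j \<le> return_dist i"
  by (rule lift_Suc_antimono_le[of return_dist]) (auto intro: return_dist_Suc_le)

lemma return_dist_Suc_le_power:
  "lam ^ fib_time k * return_dist (Suc k) \<le> 2 * return_dist k"
  using return_dist_rec[of "Suc k"] return_dist_Suc_le[of k] return_dist_Suc_le[of "Suc k"] by simp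

lemma return_dist_upper: "return_dist (Suc k) \<le> 2 / lam ^ fib_time k"
  using return_dist_Suc_le_power[of k] return_dist_le_1[of k] lam_power_pos[of "fib_time k"]
  by (simp add: field_simps)

lemma return_dist_ratio: 
  assumes "k \<ge> 1" shows "return_dist (Suc k) \<le> 4/5 * return_dist k"
proof -
  have "lam ^ 2 \<le> lam ^ fib_time k" using fib_time_ge[of k] assms by (intro lam_power_ge) linarith
  then have "13/5 * return_dist (Suc k) \<le> lam ^ fib_time k * return_dist (Suc k)"
    using lam_bounds(2) return_dist_nonneg by (intro mult_right_mono) auto
  then show ?thesis using return_dist_Suc_le_power[of k] return_dist_nonneg[of "Suc k"] by linarith
qed

text \<open>
  Let \<open>S(k) < n < S(k+1)\<close> and \<open>r = S(k+1) - n < S(k-1)\<close>. By induction \<open>c\<^sub>r\<close> is not close to \<open>0\<close>. If \<open>c\<^sub>n\<close> were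
  very close to \<open>0\<close>, then, \<open>T\<^sup>r\<close> being \<open>lam\<^sup>r\<close>-Lipschitz, its image \<open>T\<^sup>r(c\<^sub>n)\<close> would be close to \<open>c\<^sub>r\<close>; but this
  image has absolute value \<open>d\<^bsub>k+1\<^esub>\<close>. The index \<open>k+1\<close> instead of \<open>k\<close> in the bound leaves the slack that
  the crude numerical bounds on \<open>lam\<close> need.
\<close>

lemma crit_orbit_lower:
  "1 \<le> n \<Longrightarrow> n < fib_time (Suc k) \<Longrightarrow> \<bar>crit_orbit n\<bar> \<ge> return_dist (Suc k)"
proof (induction k arbitrary: n rule: less_induct)
  case (less k)
  show ?case
  proof (cases "n \<le> fib_time k")
    case True
    show ?thesis
    proof (cases "n = fib_time k")
      case True
      then show ?thesis using return_dist_Suc_le[of k] by (simp add: return_dist_def)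
    next
      case False
      then obtain j where j: "k = Suc j" using \<open>n \<le> fib_time k\<close> less.prems by (cases k) auto
      have "return_dist k \<le> \<bar>crit_orbit n\<bar>"
        unfolding j using less.prems False True j by (intro less.IH) auto
      then show ?thesis using return_dist_Suc_le[of k] by simp
    qed
  next
    case False
    have "k \<noteq> 0" using False less.prems by (cases k) auto
    have "k \<noteq> 1"
    proof
      assume "k = 1"
      then show False using False less.prems by (auto simp: numeral_2_eq_2)
    qed
    then obtain i where k: "k = Suc (Suc i)" using \<open>k \<noteq> 0\<close> by (cases k; cases "k - 1") auto
    define r where "r = fib_time (Suc k) - n"
    have r: "1 \<le> r" "r < fib_time (Suc i)" "n + r = fib_time (Suc k)" using False less.prems by (auto simp: r_def k)
    have IH: "\<bar>crit_orbit r\<bar> \<ge> return_dist (Suc i)" using r k by (intro less.IH) auto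
    have "\<bar>crit_orbit (fib_time (Suc k)) - crit_orbit r\<bar> \<le> lam ^ r * \<bar>crit_orbit n - 0\<bar>"
      using tent_iter_lipschitz[of lam r "crit_orbit n" 0] lam_gt_1
      by (simp only: crit_orbit_add r(3)) (simp add: crit_orbit_def)
    then have 1: "return_dist (Suc i) \<le> return_dist (Suc k) + lam ^ r * \<bar>crit_orbit n\<bar>"
      using IH by (simp add: return_dist_def)
    have "lam ^ r * return_dist (Suc k) + return_dist (Suc k) \<le> return_dist (Suc i)"
    proof -
      let ?x = "lam ^ r * return_dist (Suc k)"
      have "lam ^ 2 * ?x = lam ^ (r + 2) * return_dist (Suc k)" by (simp add: power_add power2_eq_square)
      also have "\<dots> \<le> lam ^ fib_time k * return_dist (Suc k)"
        using r(2) fib_time_pos[of i] return_dist_nonneg k by (intro mult_right_mono lam_power_ge) auto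
      also have "\<dots> \<le> 2 * return_dist k" by (rule return_dist_Suc_le_power)
      finally have "13/5 * ?x \<le> 2 * return_dist k"
        using mult_right_mono[OF lam_bounds(2), of ?x] return_dist_nonneg[of "Suc k"] lam_power_pos[of r]
        by (meson mult_nonneg_nonneg less_imp_le order.trans)
      moreover have "104/25 * return_dist (Suc k) \<le> 2 * return_dist k"
      proof -
        have "lam ^ 3 \<le> lam ^ fib_time k" using fib_time_ge[of k] k by (intro lam_power_ge) linarith
        then have "104/25 * return_dist (Suc k) \<le> lam ^ fib_time k * return_dist (Suc k)"
          using lam_bounds(3) return_dist_nonneg by (intro mult_right_mono) auto
        then show ?thesis using return_dist_Suc_le_power[of k] by linarith
      qed
      moreover have "13/5 * return_dist k \<le> 2 * return_dist (Suc i)"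
      proof -
        have "lam ^ 2 \<le> lam ^ fib_time (Suc i)" using fib_time_ge[of "Suc i"] by (intro lam_power_ge) linarith
        then have "13/5 * return_dist k \<le> lam ^ fib_time (Suc i) * return_dist k"
          using lam_bounds(2) return_dist_nonneg by (intro mult_right_mono) auto
        then show ?thesis using return_dist_Suc_le_power[of "Suc i"] k by simp
      qed
      ultimately show ?thesis using return_dist_nonneg[of "Suc i"] by linarith
    qed
    with 1 have "lam ^ r * return_dist (Suc k) \<le> lam ^ r * \<bar>crit_orbit n\<bar>" by linarith
    then show ?thesis using lam_power_pos[of r] by simp
  qed
qed

lemma crit_orbit_nonzero: "n \<ge> 1 \<Longrightarrow> crit_orbit n \<noteq> 0"
proof -
  assume n: "n \<ge> 1"
  have "n < fib_time (Suc n)" using fib_time_ge[of "Suc n"] by simp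
  from crit_orbit_lower[OF n this] show ?thesis using return_dist_pos[of "Suc n"] by auto
qed

text \<open>
  For \<open>m = S(k+1) + m'\<close>, a close return at a time \<open>n' \<ge> m'\<close> is shadowed at time \<open>S(k+1) + n'\<close>, with an error of
  at most \<open>2 d\<^sub>k\<close>, as long as \<open>n' \<le> S(k)\<close>; otherwise \<open>S(k+2)\<close> itself is the return time. The errors add up;
  since \<open>d\<^bsub>k+1\<^esub> \<le> 4/5 d\<^sub>k\<close>, they are absorbed by the decrease of the term \<open>-10 d\<^sub>k\<close>.
\<close>

lemma crit_orbit_recurrence_ind:
  assumes "j \<ge> 1" "j \<le> k" "m < fib_time (Suc k)"
  shows "\<exists>n. m \<le> n \<and> n \<le> m + fib_time (Suc j) \<and>
    \<bar>crit_orbit n\<bar> \<le> 11 * return_dist j - 10 * return_dist k"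
  using assms(2,3)
proof (induction "k" arbitrary: m rule: dec_induct)
  case base
  have "return_dist (Suc j) \<le> return_dist j" by (rule return_dist_Suc_le)
  then show ?case using base by (intro exI[of _ "fib_time (Suc j)"]) (auto simp: return_dist_def)
next
  case (step k)
  have dec: "10 * return_dist (Suc k) \<le> 8 * return_dist k"
    using return_dist_ratio[of k] step(1) assms(1) by simp
  show ?case
  proof (cases "m < fib_time (Suc k)")
    case True
    then show ?thesis using step.IH[OF True] return_dist_Suc_le[of k] by fastforce
  next
    case False
    define m' where "m' = m - fib_time (Suc k)"
    have m: "m = fib_time (Suc k) + m'" "m' < fib_time k" using False step.prems by (auto simp: m'_def)
    then have "m' < fib_time (Suc k)" using fib_time_less_Suc[of k] by linarith
    from step.IH[OF this] obtain n' where
      n': "m' \<le> n'" "n' \<le> m' + fib_time (Suc j)" "\<bar>crit_orbit n'\<bar> \<le> 11 * return_dist j - 10 * return_dist k"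
      by blast
    show ?thesis
    proof (cases "n' \<le> fib_time k")
      case True
      have "\<bar>crit_orbit (fib_time (Suc k) + n') - crit_orbit n'\<bar> = lam ^ n' * return_dist (Suc k)"
        using crit_orbit_shadow[of "Suc k" n'] True by simp
      also have "\<dots> \<le> lam ^ fib_time k * return_dist (Suc k)"
        using True return_dist_nonneg by (intro mult_right_mono lam_power_ge) auto
      also have "\<dots> \<le> 2 * return_dist k" by (rule return_dist_Suc_le_power)
      finally have "\<bar>crit_orbit (fib_time (Suc k) + n')\<bar> \<le> 11 * return_dist j - 10 * return_dist (Suc k)"
        using n'(3) dec by linarith
      then show ?thesis using n' m by (intro exI[of _ "fib_time (Suc k) + n'"]) auto
    next
      case False
      have "return_dist (Suc (Suc k)) \<le> return_dist j" "return_dist (Suc k) \<le> return_dist j"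
        using step(1) by (auto intro!: return_dist_antimono)
      then have "\<bar>crit_orbit (fib_time (Suc (Suc k)))\<bar> \<le> 11 * return_dist j - 10 * return_dist (Suc k)"
        by (simp add: return_dist_def)
      then show ?thesis using n' m False by (intro exI[of _ "fib_time (Suc (Suc k))"]) auto
    qed
  qed
qed

lemma crit_orbit_recurrence:
  assumes "j \<ge> 1"
  shows "\<exists>n\<ge>m. n \<le> m + fib_time (Suc j) \<and> \<bar>crit_orbit n\<bar> \<le> 11 * return_dist j"
proof -
  have "m < fib_time (Suc (m + j))" using fib_time_ge[of "Suc (m + j)"] by simp
  from crit_orbit_recurrence_ind[OF assms _ this] show ?thesis
    using return_dist_nonneg[of "m + j"] by fastforce
qed

abbreviation attractor where "attractor \<equiv> closure (forward_orbit T 0)"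

text \<open>
  Only finitely many times occur, so the property is closed and passes from the orbit of \<open>0\<close> to its closure.
\<close>

lemma attractor_recurrence:
  assumes "p \<in> attractor" "j \<ge> 1"
  shows "\<exists>n\<le>fib_time (Suc j). \<bar>(T ^^ n) p\<bar> \<le> 11 * return_dist j"
proof -
  \<comment> \<open>the union over finitely many times is closed\<close>
  define C where "C = (\<Union>n\<in>{..fib_time (Suc j)}. {x. \<bar>(T ^^ n) x\<bar> \<le> 11 * return_dist j})"
  have "closed C" unfolding C_def
    by (intro closed_UN finite_atMost ballI closed_Collect_le continuous_intros continuous_on_tent_iter)
  moreover have "forward_orbit T 0 \<subseteq> C"
  proof
    fix x assume "x \<in> forward_orbit T 0"
    then obtain m where x: "x = crit_orbit m" by (auto simp: forward_orbit_def crit_orbit_def)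
    obtain n where n: "n \<ge> m" "n \<le> m + fib_time (Suc j)" "\<bar>crit_orbit n\<bar> \<le> 11 * return_dist j"
      using crit_orbit_recurrence[OF assms(2)] by blast
    have "(T ^^ (n - m)) x = crit_orbit n"
      using n(1) by (simp add: x crit_orbit_add)
    then show "x \<in> C" using n by (auto simp: C_def intro!: bexI[of _ "n - m"])
  qed
  ultimately have "attractor \<subseteq> C" by (rule closure_minimal[rotated])
  then show ?thesis using assms(1) by (auto simp: C_def)
qed

text \<open>
  The factor \<open>11\<close> is the one of \<open>attractor_recurrence\<close>.
\<close>

lemma neg_ln_return_dist:
  assumes "0 < \<bar>x\<bar>" "\<bar>x\<bar> \<le> 11 * return_dist (Suc i)"
  shows "- ln \<bar>x\<bar> \<ge> real (fib_time i) * ln lam - ln 22"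
proof -
  have "\<bar>x\<bar> \<le> 22 / lam ^ fib_time i" using assms return_dist_upper[of i] by (simp add: field_simps)
  then have "ln \<bar>x\<bar> \<le> ln (22 / lam ^ fib_time i)" using assms lam_power_pos by simp
  also have "\<dots> = ln 22 - real (fib_time i) * ln lam"
    using lam_gt_1 by (simp add: ln_div ln_realpow)
  finally show ?thesis by simp
qed

lemma return_dist_tendsto_0: "return_dist \<longlonglongrightarrow> 0"
proof (rule LIMSEQ_offset[of _ 1])
  have "(\<lambda>i. 2 * (1 / lam) ^ i) \<longlonglongrightarrow> 2 * 0"
    using lam_gt_1 by (intro tendsto_intros LIMSEQ_power_zero) auto
  then have lim: "(\<lambda>i. 2 * (1 / lam) ^ i) \<longlonglongrightarrow> 0" by simp
  show "(\<lambda>i. return_dist (i + 1)) \<longlonglongrightarrow> 0"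
  proof (rule tendsto_sandwich[OF always_eventually always_eventually tendsto_const lim])
    show "\<forall>i. return_dist (i + 1) \<le> 2 * (1 / lam) ^ i"
    proof
      fix i
      have "lam ^ i \<le> lam ^ fib_time i" using fib_time_ge[of i] by (intro lam_power_ge) linarith
      then have "2 / lam ^ fib_time i \<le> 2 / lam ^ i"
        using lam_gt_1 by (intro divide_left_mono) auto
      then show "return_dist (i + 1) \<le> 2 * (1 / lam) ^ i"
        using return_dist_upper[of i] by (simp add: power_one_over)
    qed
  qed (auto simp: return_dist_nonneg)
qed

end

section \<open>The logarithmic pole of the invariant measure\<close>

locale fibonacci_measure = fibonacci_tent +
  fixes \<mu> :: "real measure"
  assumes ergodic: "ergodic_prob T \<mu>" and supported: "supported_on \<mu> attractor"
begin

lemma invariant: "invariant_prob T \<mu>" using ergodic by (simp add: ergodic_prob_def)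

sublocale prob_space \<mu> using invariant by (simp add: invariant_prob_def)

lemma sets_mu: "sets \<mu> = sets borel_I" using invariant by (simp add: invariant_prob_def)

lemma space_mu: "space \<mu> = {-1..1}"
  using sets_eq_imp_space_eq[OF sets_mu] by (simp add: space_restrict_space)

lemma borel_subset_sets: "A \<in> sets borel \<Longrightarrow> A \<inter> {-1..1} \<in> sets \<mu>"
  unfolding sets_mu by (subst Int_commute, rule sets_restrict_space_iff[THEN iffD2]) auto

lemma borel_measurable_mu: "g \<in> borel_measurable borel \<Longrightarrow> g \<in> borel_measurable \<mu>"
  by (subst measurable_cong_sets[OF sets_mu refl]) (rule measurable_restrict_space1)

lemma T_measurable: "T \<in> measurable \<mu> \<mu>" and distr_T: "distr \<mu> \<mu> T = \<mu>"
  using invariant by (auto simp: invariant_prob_def)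

lemma T_iter_measurable: "(T ^^ n) \<in> measurable \<mu> \<mu>"
proof (induction n)
  case (Suc n)
  then show ?case using measurable_comp[OF Suc T_measurable] by (simp add: o_def)
qed (simp add: id_def)

lemma prob_T_iter_vimage:
  assumes "A \<in> sets \<mu>"
  shows "prob ((T ^^ n) -` A \<inter> {-1..1}) = prob A"
  using assms
proof (induction n arbitrary: A)
  case (Suc n)
  have TA: "T -` A \<inter> {-1..1} \<in> sets \<mu>" using measurable_sets[OF T_measurable Suc.prems] by (simp add: space_mu)
  have "(T ^^ Suc n) -` A \<inter> {-1..1} = (T ^^ n) -` (T -` A \<inter> {-1..1}) \<inter> {-1..1}"
    using tent_iter_mem[of lam _ n] lam_range by auto
  then have "prob ((T ^^ Suc n) -` A \<inter> {-1..1}) = prob (T -` A \<inter> {-1..1})"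
    using Suc.IH[OF TA] by simp
  also have "\<dots> = measure (distr \<mu> \<mu> T) A"
    using T_measurable Suc.prems by (subst measure_distr) (auto simp: space_mu)
  finally show ?case by (simp only: distr_T)
next
  case 0
  then show ?case using sets.sets_into_space[OF 0] by (simp add: space_mu Int_absorb2)
qed

text \<open>
  The preimages of \<open>0\<close> under different iterates are disjoint because \<open>0\<close> is not periodic, and they all have the
  same measure.
\<close>

lemma prob_critical_point: "prob {0} = 0"
proof -
  have zero: "{0} \<in> sets \<mu>" using borel_subset_sets[of "{0}"] by simp
  define A where "A n = (T ^^ n) -` {0} \<inter> {-1..1}" for n
  have meas: "A n \<in> sets \<mu>" for n
    using measurable_sets[OF T_iter_measurable zero, of n] by (simp add: A_def space_mu)
  have disj: "A m \<inter> A n = {}" if "m < n" for m n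
  proof -
    have "(T ^^ n) x \<noteq> 0" if "(T ^^ m) x = 0" for x
    proof -
      have "(T ^^ n) x = (T ^^ (n - m)) ((T ^^ m) x)"
        using \<open>m < n\<close> by (metis comp_apply funpow_add le_add_diff_inverse2 less_imp_le)
      then show ?thesis using crit_orbit_nonzero[of "n - m"] that \<open>m < n\<close> by (simp add: crit_orbit_def)
    qed
    then show ?thesis by (auto simp: A_def)
  qed
  have "real N * prob {0} \<le> 1" for N
  proof -
    have "real N * prob {0} = (\<Sum>n<N. prob (A n))"
      using prob_T_iter_vimage[OF zero] by (simp add: A_def)
    also have "\<dots> = prob (\<Union>n<N. A n)"
    proof (rule finite_measure_finite_Union[symmetric])
      show "disjoint_family_on A {..<N}"
        using disj unfolding disjoint_family_on_def by (metis Int_commute linorder_neqE_nat)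
    qed (use meas in auto)
    finally show ?thesis by simp
  qed
  then have "\<not> prob {0} > 0" using reals_Archimedean3[of "prob {0}"] by (meson not_less)
  then show ?thesis using measure_nonneg[of \<mu> "{0}"] by linarith
qed

text \<open>
  By \<open>attractor_recurrence\<close> the attractor is covered by the preimages of the neighbourhood under the first
  \<open>S(j+1) + 1\<close> iterates, which all have the same measure.
\<close>

lemma prob_near_critical:
  assumes "j \<ge> 1"
  shows "1 \<le> (real (fib_time (Suc j)) + 1) * prob ({x. \<bar>x\<bar> \<le> 11 * return_dist j} \<inter> {-1..1})"
proof -
  define V where "V = {x. \<bar>x\<bar> \<le> 11 * return_dist j} \<inter> {-1..1}"
  have V: "V \<in> sets \<mu>" unfolding V_def by (rule borel_subset_sets) measurable
  define A where "A n = (T ^^ n) -` V \<inter> {-1..1}" for n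
  have meas: "A n \<in> sets \<mu>" for n
    using measurable_sets[OF T_iter_measurable V, of n] by (simp add: A_def space_mu)
  have K: "attractor \<inter> {-1..1} \<in> sets \<mu>" by (rule borel_subset_sets) simp
  have "emeasure \<mu> (space \<mu> - attractor) = 0" using supported by (simp add: supported_on_def)
  moreover have "space \<mu> - attractor = space \<mu> - (attractor \<inter> {-1..1})" by (auto simp: space_mu)
  ultimately have "1 = prob (attractor \<inter> {-1..1})"
    using prob_compl[OF K] by (simp add: emeasure_eq_measure)
  also have "prob (attractor \<inter> {-1..1}) \<le> prob (\<Union>n\<in>{..fib_time (Suc j)}. A n)"
  proof (rule finite_measure_mono)
    show "attractor \<inter> {-1..1} \<subseteq> (\<Union>n\<in>{..fib_time (Suc j)}. A n)"
    proof
      fix x assume x: "x \<in> attractor \<inter> {-1..1}"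
      then obtain n where n: "n \<le> fib_time (Suc j)" "\<bar>(T ^^ n) x\<bar> \<le> 11 * return_dist j"
        using attractor_recurrence[of x j] assms by auto
      then have "x \<in> A n" using x tent_iter_mem[of lam x n] lam_range by (auto simp: A_def V_def)
      then show "x \<in> (\<Union>n\<in>{..fib_time (Suc j)}. A n)" using n(1) by auto
    qed
  qed (use meas in auto)
  also have "\<dots> \<le> (\<Sum>n\<in>{..fib_time (Suc j)}. prob (A n))"
    by (rule finite_measure_subadditive_finite) (use meas in auto)
  also have "\<dots> = (real (fib_time (Suc j)) + 1) * prob V"
    using prob_T_iter_vimage[OF V] by (simp add: A_def)
  finally show ?thesis by (simp add: V_def)
qed

text \<open>
  A function on the whole interval that is a lower bound for the integrands near \<open>0\<close>. It vanishes at \<open>0\<close>, so that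
  no value of an integrand at a singularity enters.
\<close>

definition log_pole :: "real \<Rightarrow> real \<Rightarrow> real \<Rightarrow> real \<Rightarrow> ennreal" where
  "log_pole \<kappa> B \<delta> x = ennreal (- \<kappa> * ln \<bar>x\<bar> - B) * indicator {x. 0 < \<bar>x\<bar> \<and> \<bar>x\<bar> < \<delta>} x"

lemma log_pole_measurable: "log_pole \<kappa> B \<delta> \<in> borel_measurable borel"
  unfolding log_pole_def by measurable

text \<open>
  If the integral were finite, the integrals over the sets \<open>{\<bar>x\<bar> \<le> 11 d\<^sub>j}\<close> would tend to \<open>0\<close> by dominated
  convergence. But the integrand is of order \<open>S(j)\<close> there, and the measure of the set is at least of order
  \<open>1 / S(j)\<close>.
\<close>

lemma nn_integral_log_pole:
  assumes "\<kappa> > 0" "\<delta> > 0"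
  shows "(\<integral>\<^sup>+x. log_pole \<kappa> B \<delta> x \<partial>\<mu>) = \<infinity>"
proof (rule ccontr)
  let ?g = "log_pole \<kappa> B \<delta>"
  define V where "V j = {x. \<bar>x\<bar> \<le> 11 * return_dist j}" for j
  have Vb [measurable]: "V j \<in> sets borel" for j unfolding V_def by measurable
  assume "(\<integral>\<^sup>+x. ?g x \<partial>\<mu>) \<noteq> \<infinity>"
  then have fin: "(\<integral>\<^sup>+x. ?g x \<partial>\<mu>) < \<infinity>" by (simp add: top.not_eq_extremum)
  have g: "?g \<in> borel_measurable \<mu>" by (intro borel_measurable_mu log_pole_measurable)
  have ind: "indicator (V j) \<in> borel_measurable \<mu>" for j
    by (intro borel_measurable_mu) (simp add: Vb)
  have "(\<lambda>j. \<integral>\<^sup>+x. ?g x * indicator (V j) x \<partial>\<mu>) \<longlonglongrightarrow> (\<integral>\<^sup>+x. 0 \<partial>\<mu>)"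
  proof (rule nn_integral_dominated_convergence[where w = ?g])
    show "AE x in \<mu>. (\<lambda>j. ?g x * indicator (V j) x) \<longlonglongrightarrow> 0"
    proof (intro AE_I2)
      fix x
      show "(\<lambda>j. ?g x * indicator (V j) x) \<longlonglongrightarrow> 0"
      proof (cases "x = 0")
        case False
        have "(\<lambda>j. 11 * return_dist j) \<longlonglongrightarrow> 11 * 0" by (intro tendsto_intros return_dist_tendsto_0)
        then have "\<forall>\<^sub>F j in sequentially. 11 * return_dist j < \<bar>x\<bar>"
          by (rule order_tendstoD(2)) (use False in simp)
        then have "\<forall>\<^sub>F j in sequentially. ?g x * indicator (V j) x = 0"
          by eventually_elim (simp add: V_def)
        then show ?thesis by (rule tendsto_eventually)
      qed (simp add: log_pole_def)
    qed
    show "AE x in \<mu>. ?g x * indicator (V j) x \<le> ?g x" for j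
      by (intro AE_I2) (simp split: split_indicator)
  qed (use fin in \<open>auto intro!: borel_measurable_times_ennreal g ind\<close>)
  then have lim: "(\<lambda>j. \<integral>\<^sup>+x. ?g x * indicator (V j) x \<partial>\<mu>) \<longlonglongrightarrow> 0" by simp
  \<comment> \<open>half of \<open>\<kappa> ln lam\<close> absorbs the constants; the factor \<open>5\<close> bounds \<open>(S(i+2) + 1) / S(i)\<close>\<close>
  define e where "e = \<kappa> * ln lam / 10"
  have e: "e > 0" using assms lam_gt_1 by (simp add: e_def)
  have low: "(\<integral>\<^sup>+x. ?g x * indicator (V (Suc i)) x \<partial>\<mu>) \<ge> ennreal e"
    if d: "11 * return_dist (Suc i) < \<delta>" and i: "real (fib_time i) * (5 * e) \<ge> \<kappa> * ln 22 + B" for i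
  proof -
    define a where "a = \<kappa> * (real (fib_time i) * ln lam - ln 22) - B"
    have a: "a \<ge> real (fib_time i) * (5 * e)" using i by (simp add: a_def e_def algebra_simps)
    then have a0: "a \<ge> 0" using e by (meson mult_nonneg_nonneg of_nat_0_le_iff order.trans less_imp_le zero_le_numeral)
    have V: "V (Suc i) \<inter> {-1..1} \<in> sets \<mu>" by (intro borel_subset_sets Vb)
    have zero: "{0} \<in> sets \<mu>" using borel_subset_sets[of "{0}"] by simp
    have W: "V (Suc i) \<inter> {-1..1} - {0} \<in> sets \<mu>" using V zero by (rule sets.Diff)
    have "real (fib_time (Suc (Suc i))) \<le> 4 * real (fib_time i)"
      using fib_time_Suc_le[of i] fib_time_Suc_le[of "Suc i"] by linarith
    then have N: "real (fib_time (Suc (Suc i))) + 1 \<le> 5 * real (fib_time i)"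
      using fib_time_pos[of i] by linarith
    have pV: "prob (V (Suc i) \<inter> {-1..1} - {0}) = prob (V (Suc i) \<inter> {-1..1})"
      using prob_critical_point zero V by (intro measure_Diff_null_set) (auto simp: null_sets_def emeasure_eq_measure)
    have "1 \<le> (real (fib_time (Suc (Suc i))) + 1) * prob (V (Suc i) \<inter> {-1..1})"
      using prob_near_critical[of "Suc i"] by (simp only: V_def)
    also have "\<dots> \<le> 5 * real (fib_time i) * prob (V (Suc i) \<inter> {-1..1})"
      using N by (intro mult_right_mono) auto
    finally have p: "1 \<le> 5 * real (fib_time i) * prob (V (Suc i) \<inter> {-1..1})" .
    have "e * 1 \<le> e * (5 * real (fib_time i) * prob (V (Suc i) \<inter> {-1..1}))"
      using p e by (intro mult_left_mono) auto
    also have "\<dots> = real (fib_time i) * (5 * e) * prob (V (Suc i) \<inter> {-1..1})" by simp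
    also have "\<dots> \<le> a * prob (V (Suc i) \<inter> {-1..1})" using a by (intro mult_right_mono) auto
    finally have "ennreal e \<le> ennreal a * emeasure \<mu> (V (Suc i) \<inter> {-1..1} - {0})"
      using a0 pV by (simp add: emeasure_eq_measure ennreal_mult[symmetric] ennreal_leI)
    also have "\<dots> = (\<integral>\<^sup>+x. ennreal a * indicator (V (Suc i) \<inter> {-1..1} - {0}) x \<partial>\<mu>)"
      using W by (simp add: nn_integral_cmult_indicator)
    also have "\<dots> \<le> (\<integral>\<^sup>+x. ?g x * indicator (V (Suc i)) x \<partial>\<mu>)"
    proof (intro nn_integral_mono)
      fix x
      show "ennreal a * indicator (V (Suc i) \<inter> {-1..1} - {0}) x \<le> ?g x * indicator (V (Suc i)) x"
      proof (cases "x \<in> V (Suc i) \<inter> {-1..1} - {0}")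
        case True
        then have "a \<le> - \<kappa> * ln \<bar>x\<bar> - B"
          using neg_ln_return_dist[of x i] mult_left_mono[of "real (fib_time i) * ln lam - ln 22" "- ln \<bar>x\<bar>" \<kappa>] assms(1)
          by (simp add: a_def V_def)
        then show ?thesis using True d by (simp add: log_pole_def V_def ennreal_leI)
      qed simp
    qed
    finally show ?thesis .
  qed
  have "(\<lambda>i. 11 * return_dist (Suc i)) \<longlonglongrightarrow> 11 * 0"
    by (intro tendsto_intros LIMSEQ_Suc return_dist_tendsto_0)
  then have ev1: "\<forall>\<^sub>F i in sequentially. 11 * return_dist (Suc i) < \<delta>"
    by (rule order_tendstoD(2)) (use assms(2) in simp)
  have ev2: "\<forall>\<^sub>F i in sequentially. real (fib_time i) * (5 * e) \<ge> \<kappa> * ln 22 + B"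
  proof -
    obtain N where N: "real N * (5 * e) > \<kappa> * ln 22 + B"
      using reals_Archimedean3[of "5 * e"] e by auto
    show ?thesis
      using eventually_ge_at_top[of N]
    proof eventually_elim
      case (elim i)
      then have "real N \<le> real (fib_time i)" using fib_time_ge[of i] by linarith
      then have "real N * (5 * e) \<le> real (fib_time i) * (5 * e)" using e by (intro mult_right_mono) auto
      then show ?case using N by linarith
    qed
  qed
  have "\<forall>\<^sub>F i in sequentially. ennreal e \<le> (\<integral>\<^sup>+x. ?g x * indicator (V (Suc i)) x \<partial>\<mu>)"
    using ev1 ev2 by eventually_elim (rule low)
  then have "ennreal e \<le> 0"
    by (intro tendsto_lowerbound[OF LIMSEQ_Suc[OF lim]]) auto
  then show False using e by (simp add: ennreal_eq_0_iff)
qed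

lemma nn_integral_log_pole_T:
  assumes "\<kappa> > 0" "\<delta> > 0"
  shows "(\<integral>\<^sup>+x. log_pole \<kappa> B \<delta> (T x) \<partial>\<mu>) = \<infinity>"
proof -
  have "(\<integral>\<^sup>+x. log_pole \<kappa> B \<delta> x \<partial>distr \<mu> \<mu> T) = (\<integral>\<^sup>+x. log_pole \<kappa> B \<delta> (T x) \<partial>\<mu>)"
    by (intro nn_integral_distr T_measurable) (simp add: distr_T borel_measurable_mu log_pole_measurable)
  then show ?thesis using nn_integral_log_pole[OF assms] by (simp add: distr_T)
qed

end

section \<open>Real analyticity through holomorphic extensions\<close>

text \<open>
  The point \<open>x\<close> may be an endpoint, so the series is only known to converge on one side. Convergence at a
  single point \<open>y \<noteq> x\<close> suffices for a disc of radius \<open>\<bar>y - x\<bar>\<close> in the complex plane.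
\<close>

lemma real_analytic_on_holomorphic_extension:
  assumes "real_analytic_on g S" "x \<in> S" "x islimpt S"
  obtains r H where "r > 0" "H holomorphic_on ball (complex_of_real x) r"
    "\<And>y. y \<in> S \<Longrightarrow> \<bar>y - x\<bar> < r \<Longrightarrow> H (complex_of_real y) = complex_of_real (g y)"
proof -
  obtain r a where r: "r > 0"
    and a: "\<And>y. y \<in> S \<Longrightarrow> \<bar>y - x\<bar> < r \<Longrightarrow> (\<lambda>n. a n * (y - x) ^ n) sums g y"
    using assms(1,2) unfolding real_analytic_on_def by blast
  obtain y where y: "y \<in> S" "y \<noteq> x" "\<bar>y - x\<bar> < r"
    using assms(3) r unfolding islimpt_approachable dist_real_def by blast
  define A where "A n = complex_of_real (a n)" for n
  define H where "H w = (\<Sum>n. A n * (w - of_real x) ^ n)" for w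
  have "(\<lambda>n. complex_of_real (a n * (y - x) ^ n)) sums complex_of_real (g y)"
    by (rule sums_of_real[OF a[OF y(1,3)]])
  then have "summable (\<lambda>n. complex_of_real (a n * (y - x) ^ n))" by (rule sums_summable)
  then have "summable (\<lambda>n. A n * (of_real (y - x)) ^ n)" by (simp add: A_def)
  then have "summable (\<lambda>n. A n * (w - of_real x) ^ n)" if "norm (w - of_real x) < \<bar>y - x\<bar>" for w
    by (rule powser_inside) (use that in \<open>simp only: norm_of_real\<close>)
  then have sums: "(\<lambda>n. A n * (w - of_real x) ^ n) sums H w"
    if "w \<in> ball (of_real x) \<bar>y - x\<bar>" for w
    using that unfolding H_def by (intro summable_sums) (simp add: dist_norm norm_minus_commute)
  have "H (of_real z) = of_real (g z)" if z: "z \<in> S" "\<bar>z - x\<bar> < \<bar>y - x\<bar>" for z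
  proof -
    have "(\<lambda>n. complex_of_real (a n * (z - x) ^ n)) sums of_real (g z)"
      using a[OF z(1)] z(2) y(3) by (intro sums_of_real) simp
    then have "(\<lambda>n. A n * (of_real z - of_real x) ^ n) sums of_real (g z)" by (simp add: A_def)
    then show ?thesis unfolding H_def by (rule sums_unique[symmetric])
  qed
  then show ?thesis using y(2) power_series_holomorphic[OF sums] by (intro that[of "\<bar>y - x\<bar>" H]) auto
qed

text \<open>
  The extension is only known to be real on \<open>S\<close>, so the real parts of its Taylor coefficients are taken.
\<close>

lemma power_series_of_holomorphic_extension:
  assumes "r > 0" "H holomorphic_on ball (complex_of_real x) r"
    and "\<And>y. y \<in> S \<Longrightarrow> \<bar>y - x\<bar> < r \<Longrightarrow> H (complex_of_real y) = complex_of_real (g y)"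
  shows "\<exists>r>0. \<exists>a. \<forall>y\<in>S. \<bar>y - x\<bar> < r \<longrightarrow> (\<lambda>n. a n * (y - x) ^ n) sums g y"
proof -
  define A where "A n = (deriv ^^ n) H (of_real x) / fact n" for n
  have "(\<lambda>n. Re (A n) * (y - x) ^ n) sums g y" if y: "y \<in> S" "\<bar>y - x\<bar> < r" for y
  proof -
    have "complex_of_real y \<in> ball (of_real x) r"
      using y(2) by (simp add: dist_of_real dist_real_def abs_minus_commute)
    from holomorphic_power_series[OF assms(2) this]
    have "(\<lambda>n. A n * of_real ((y - x) ^ n)) sums of_real (g y)"
      using assms(3)[OF y] by (simp add: A_def)
    from sums_Re[OF this] show ?thesis by simp
  qed
  then show ?thesis using assms(1) by (intro exI[of _ r] conjI exI[of _ "\<lambda>n. Re (A n)"]) auto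
qed

section \<open>Derivatives of the homeomorphism and its inverse\<close>

lemma deriv_I_eq:
  assumes "(g has_real_derivative D) (at x within {-1..1})" "x \<in> {-1..1}"
  shows "deriv_I g x = D"
  by (rule vector_derivative_within_closed_interval)
    (use assms in \<open>auto simp: has_real_derivative_iff_has_vector_derivative\<close>)

lemma has_real_derivative_within_compose:
  fixes f g :: "real \<Rightarrow> real"
  assumes "(g has_real_derivative D) (at x within S)" "(f has_real_derivative E) (at (g x) within R)"
    and "g ` S \<subseteq> R"
  shows "((\<lambda>y. f (g y)) has_real_derivative E * D) (at x within S)"
  using DERIV_image_chain[OF DERIV_subset[OF assms(2,3)] assms(1)] by (simp add: o_def)

lemma deriv_I_differentiable:
  assumes "g differentiable (at x within {-1..1})" "x \<in> {-1..1}"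
  shows "(g has_real_derivative deriv_I g x) (at x within {-1..1})"
proof -
  from assms(1) obtain D where "(g has_real_derivative D) (at x within {-1..1})"
    by (rule real_differentiableE)
  then show ?thesis using deriv_I_eq assms(2) by metis
qed

locale interval_homeo =
  fixes h hinv :: "real \<Rightarrow> real"
  assumes homeo: "homeomorphism {-1..1} {-1..1} h hinv"
    and analytic: "real_analytic_on h ({-1..1} - {0})"
    and crit: "Crit h = {0}"
begin

lemma h_mem: "x \<in> {-1..1} \<Longrightarrow> h x \<in> {-1..1}"
  and hinv_mem: "x \<in> {-1..1} \<Longrightarrow> hinv x \<in> {-1..1}"
  and hinv_h: "x \<in> {-1..1} \<Longrightarrow> hinv (h x) = x"
  and h_hinv: "x \<in> {-1..1} \<Longrightarrow> h (hinv x) = x"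
  using homeo unfolding homeomorphism_def by blast+

lemma cont_h: "continuous_on {-1..1} h" and cont_hinv: "continuous_on {-1..1} hinv"
  using homeo unfolding homeomorphism_def by blast+

lemma inj_h: "inj_on h {-1..1}"
  by (rule inj_on_inverseI[of _ hinv]) (rule hinv_h)

lemma h_eq_iff: "x \<in> {-1..1} \<Longrightarrow> y \<in> {-1..1} \<Longrightarrow> h x = h y \<longleftrightarrow> x = y"
  using inj_h by (simp add: inj_on_eq_iff)

lemma h_monotone: "strict_mono_on {-1..1} h \<or> strict_antimono_on {-1..1} h"
  using injective_eq_monotone_map[OF is_interval_cc cont_h] inj_h by blast

definition c where "c = h 0"

lemma c_mem: "c \<in> {-1<..<1}"
  using h_monotone
proof
  assume "strict_mono_on {-1..1} h"
  then have "h (-1) < h 0" "h 0 < h 1" by (auto simp: strict_mono_on_def)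
  then show ?thesis using h_mem[of 1] h_mem[of "-1"] by (auto simp: c_def)
next
  assume "strict_antimono_on {-1..1} h"
  then have "h (-1) > h 0" "h 0 > h 1" by (auto simp: monotone_on_def)
  then show ?thesis using h_mem[of 1] h_mem[of "-1"] by (auto simp: c_def)
qed

lemma holomorphic_extension_h:
  assumes "p \<in> {-1..1}" "p \<noteq> 0"
  obtains r H where "r > 0" "H holomorphic_on ball (complex_of_real p) r"
    "\<And>y. y \<in> {-1..1} \<Longrightarrow> \<bar>y - p\<bar> < r \<Longrightarrow> y \<noteq> 0 \<and> H (complex_of_real y) = complex_of_real (h y)"
proof -
  have lim: "p islimpt ({-1..1} - {0})"
  proof -
    have "p islimpt {-1..1}" using assms by (intro islimpt_Icc[THEN iffD2]) auto
    then have "p islimpt ({-1..1} \<inter> (-{0}))"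
      by (rule islimpt_Int_eventually) (use assms in \<open>auto intro!: tendsto_imp_eventually_ne[OF tendsto_ident_at]\<close>)
    then show ?thesis by (simp add: Diff_eq)
  qed
  obtain r H where r: "r > 0" "H holomorphic_on ball (complex_of_real p) r"
    "\<And>y. y \<in> {-1..1} - {0} \<Longrightarrow> \<bar>y - p\<bar> < r \<Longrightarrow> H (complex_of_real y) = complex_of_real (h y)"
    by (rule real_analytic_on_holomorphic_extension[OF analytic _ lim]) (use assms in auto)
  show ?thesis
  proof (rule that[of "min r \<bar>p\<bar>" H])
    show "H holomorphic_on ball (complex_of_real p) (min r \<bar>p\<bar>)"
      using r(2) by (rule holomorphic_on_subset) auto
    show "min r \<bar>p\<bar> > 0" using assms r(1) by simp
    fix y assume y: "y \<in> {-1..1}" "\<bar>y - p\<bar> < min r \<bar>p\<bar>"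
    then have "y \<noteq> 0" by auto
    then show "y \<noteq> 0 \<and> H (complex_of_real y) = complex_of_real (h y)" using r(3)[of y] y by simp
  qed
qed

lemma h_deriv_extension:
  assumes "H holomorphic_on ball (complex_of_real p) r" "y \<in> {-1..1}" "\<bar>y - p\<bar> < r"
    and "\<And>y. y \<in> {-1..1} \<Longrightarrow> \<bar>y - p\<bar> < r \<Longrightarrow> H (complex_of_real y) = complex_of_real (h y)"
  shows "(h has_real_derivative Re (deriv H (of_real y))) (at y within {-1..1})"
proof -
  have "complex_of_real y \<in> ball (of_real p) r"
    using assms(3) by (simp add: dist_of_real dist_real_def abs_minus_commute)
  then have "(H has_field_derivative deriv H (of_real y)) (at (of_real y))"
    using assms(1) by (intro holomorphic_derivI) auto
  then have "((\<lambda>t. H (of_real t)) has_vector_derivative deriv H (of_real y)) (at y within {-1..1})"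
    by (rule has_vector_derivative_real_field)
  from bounded_linear.has_vector_derivative[OF bounded_linear_Re this]
  have "((\<lambda>t. Re (H (of_real t))) has_real_derivative Re (deriv H (of_real y))) (at y within {-1..1})"
    by (simp add: has_real_derivative_iff_has_vector_derivative)
  then show ?thesis
    by (rule has_field_derivative_transform_within[where d = "r - \<bar>y - p\<bar>"])
      (use assms in \<open>auto simp: dist_real_def\<close>)
qed

abbreviation dh where "dh \<equiv> deriv_I h"

lemma h_deriv: "p \<in> {-1..1} \<Longrightarrow> (h has_real_derivative dh p) (at p within {-1..1})"
proof -
  assume p: "p \<in> {-1..1}"
  have "h differentiable (at p within {-1..1})"
  proof (cases "p = 0")
    case True
    then show ?thesis using crit unfolding Crit_def by (auto simp: real_differentiable_def)
  next
    case False
    obtain r H where r: "r > 0" "H holomorphic_on ball (complex_of_real p) r"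
      "\<And>y. y \<in> {-1..1} \<Longrightarrow> \<bar>y - p\<bar> < r \<Longrightarrow> y \<noteq> 0 \<and> H (complex_of_real y) = complex_of_real (h y)"
      using holomorphic_extension_h[OF p False] by blast
    have "(h has_real_derivative Re (deriv H (of_real p))) (at p within {-1..1})"
      by (rule h_deriv_extension[OF r(2)]) (use p r in auto)
    then show ?thesis by (auto simp: real_differentiable_def)
  qed
  then show ?thesis using p by (rule deriv_I_differentiable)
qed

lemma dh_eq_0_iff:
  assumes p: "p \<in> {-1..1}" shows "dh p = 0 \<longleftrightarrow> p = 0"
proof
  assume "dh p = 0"
  then have "p \<in> Crit h" using h_deriv[OF p] p by (simp add: Crit_def)
  then show "p = 0" by (simp add: crit)
next
  assume "p = 0"
  then have "p \<in> Crit h" by (simp add: crit)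
  then show "dh p = 0" unfolding Crit_def by (intro deriv_I_eq) auto
qed

lemma continuous_on_dh: "continuous_on ({-1..1} - {0}) dh"
  unfolding continuous_on_eq_continuous_within
proof
  fix p :: real assume p: "p \<in> {-1..1} - {0}"
  obtain r H where r: "r > 0" "H holomorphic_on ball (complex_of_real p) r"
      "\<And>y. y \<in> {-1..1} \<Longrightarrow> \<bar>y - p\<bar> < r \<Longrightarrow> y \<noteq> 0 \<and> H (complex_of_real y) = complex_of_real (h y)"
    using holomorphic_extension_h[of p] p by blast
  have eq: "Re (deriv H (of_real y)) = dh y" if "y \<in> {-1..1}" "\<bar>y - p\<bar> < r" for y
    using deriv_I_eq[OF h_deriv_extension[OF r(2) that] that(1)] r(3) by auto
  have "deriv H holomorphic_on ball (of_real p) r" using r(2) by (intro holomorphic_deriv) auto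
  then have "isCont (deriv H) (of_real p)"
    by (rule continuous_on_interior[OF holomorphic_on_imp_continuous_on]) (use r(1) in simp)
  then have "isCont (\<lambda>y. Re (deriv H (of_real y))) p"
    by (intro isCont_Re isCont_o2[where f = complex_of_real and g = "deriv H"] continuous_intros)
  then have "continuous (at p within {-1..1} - {0}) (\<lambda>y. Re (deriv H (of_real y)))"
    by (rule continuous_at_imp_continuous_within)
  then show "continuous (at p within {-1..1} - {0}) dh"
    by (rule continuous_transform_within[OF _ r(1)]) (use p eq in \<open>auto simp: dist_real_def\<close>)
qed

text \<open>
  Written out with difference quotients because at the endpoints only one-sided derivatives are available.
\<close>

lemma hinv_deriv:
  assumes p: "p \<in> {-1..1}" "p \<noteq> 0"
  shows "(hinv has_real_derivative 1 / dh p) (at (h p) within {-1..1})"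
  unfolding has_field_derivative_iff
proof -
  have "((\<lambda>q. (h q - h p) / (q - p)) \<longlongrightarrow> dh p) (at p within {-1..1})"
    using h_deriv[OF p(1)] by (simp add: has_field_derivative_iff)
  then have lim: "((\<lambda>q. 1 / ((h q - h p) / (q - p))) \<longlongrightarrow> 1 / dh p) (at p within {-1..1})"
    using dh_eq_0_iff p by (intro tendsto_intros) auto
  have "((hinv \<longlongrightarrow> hinv (h p)) (at (h p) within {-1..1}))"
    using cont_hinv h_mem[OF p(1)] unfolding continuous_on_def by blast
  then have "(hinv \<longlongrightarrow> p) (at (h p) within {-1..1})" by (simp only: hinv_h[OF p(1)])
  moreover have "hinv y \<in> {-1..1} \<and> hinv y \<noteq> p" if "y \<noteq> h p" "y \<in> {-1..1}" for y
    using that hinv_mem[of y] h_hinv[of y] by auto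
  then have "\<forall>\<^sub>F y in at (h p) within {-1..1}. hinv y \<in> {-1..1} \<and> hinv y \<noteq> p"
    unfolding eventually_at_filter by (intro always_eventually) blast
  ultimately have "filterlim hinv (at p within {-1..1}) (at (h p) within {-1..1})"
    unfolding filterlim_at by blast
  from filterlim_compose[OF lim this]
  have "((\<lambda>y. 1 / ((h (hinv y) - h p) / (hinv y - p))) \<longlongrightarrow> 1 / dh p) (at (h p) within {-1..1})" .
  then show "((\<lambda>y. (hinv y - hinv (h p)) / (y - h p)) \<longlongrightarrow> 1 / dh p) (at (h p) within {-1..1})"
    by (rule Lim_transform_within[OF _ zero_less_one]) (simp add: h_hinv hinv_h[OF p(1)])
qed

text \<open>
  Since \<open>h'(p) \<noteq> 0\<close>, the extension of \<open>h\<close> is injective near \<open>p\<close> and has a holomorphic inverse. Continuity of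
  \<open>hinv\<close> ensures that on the interval this inverse picks the right branch.
\<close>

lemma holomorphic_extension_hinv:
  assumes p: "p \<in> {-1..1}" "p \<noteq> 0" and "e > 0"
  obtains r G where "r > 0" "G holomorphic_on ball (complex_of_real (h p)) r"
    "G ` ball (complex_of_real (h p)) r \<subseteq> ball (of_real p) e"
    "\<And>y. y \<in> {-1..1} \<Longrightarrow> \<bar>y - h p\<bar> < r \<Longrightarrow> G (complex_of_real y) = complex_of_real (hinv y)"
proof -
  obtain s H where s: "s > 0" "H holomorphic_on ball (complex_of_real p) s"
      "\<And>y. y \<in> {-1..1} \<Longrightarrow> \<bar>y - p\<bar> < s \<Longrightarrow> y \<noteq> 0 \<and> H (complex_of_real y) = complex_of_real (h y)"
    using holomorphic_extension_h[OF p] by blast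
  have "Re (deriv H (of_real p)) = dh p"
    by (rule deriv_I_eq[symmetric]) (rule h_deriv_extension[OF s(2)], use p s in auto)
  then have "deriv H (of_real p) \<noteq> 0" using dh_eq_0_iff[OF p(1)] p(2) by auto
  then obtain t where t: "t > 0" "ball (of_real p) t \<subseteq> ball (complex_of_real p) s"
      "inj_on H (ball (of_real p) t)"
    using has_complex_derivative_locally_injective[OF s(2), of "of_real p"] s(1)
    by (metis centre_in_ball open_ball)
  define U where "U = ball (complex_of_real p) (min t e)"
  have U: "open U" "inj_on H U" "H holomorphic_on U" "of_real p \<in> U"
    using t assms(3) by (auto simp: U_def inj_on_def intro!: holomorphic_on_subset[OF s(2)])
  obtain G where G: "G holomorphic_on (H ` U)" "\<And>z. z \<in> U \<Longrightarrow> deriv H z * deriv G (H z) = 1"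
      "\<And>z. z \<in> U \<Longrightarrow> G (H z) = z"
    by (rule holomorphic_has_inverse[OF U(3,1,2)]) (rule that, assumption, blast, blast)
  have HU: "open (H ` U)" using open_mapping_thm3[OF U(3,1,2)] .
  have Hp: "H (of_real p) = of_real (h p)" using s(3)[OF p(1)] s(1) by simp
  then have "of_real (h p) \<in> H ` U" using U(4) by (metis imageI)
  then obtain r1 where r1: "r1 > 0" "ball (complex_of_real (h p)) r1 \<subseteq> H ` U"
    using HU open_contains_ball by blast
  have "min t e > 0" using t assms by simp
  then obtain r2 where r2: "r2 > 0" "\<And>y. y \<in> {-1..1} \<Longrightarrow> \<bar>y - h p\<bar> < r2 \<Longrightarrow> \<bar>hinv y - p\<bar> < min t e"
    using cont_hinv[unfolded continuous_on_iff dist_real_def, rule_format, OF h_mem[OF p(1)], of "min t e"]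
    by (auto simp only: hinv_h[OF p(1)])
  show ?thesis
  proof (rule that[of "min r1 r2" G])
    show "G holomorphic_on ball (complex_of_real (h p)) (min r1 r2)"
      using G(1) by (rule holomorphic_on_subset) (use r1 in auto)
    show "G ` ball (complex_of_real (h p)) (min r1 r2) \<subseteq> ball (of_real p) e"
    proof
      fix w assume "w \<in> G ` ball (complex_of_real (h p)) (min r1 r2)"
      then obtain v where v: "w = G v" "v \<in> H ` U" using r1 by auto
      then have "w \<in> U" using G(3) by auto
      then show "w \<in> ball (of_real p) e" by (simp add: U_def)
    qed
    fix y :: real assume y: "y \<in> {-1..1}" "\<bar>y - h p\<bar> < min r1 r2"
    then have q: "\<bar>hinv y - p\<bar> < min t e" using r2 by auto
    then have qU: "complex_of_real (hinv y) \<in> U"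
      by (simp add: U_def dist_of_real dist_real_def abs_minus_commute)
    then have "complex_of_real (hinv y) \<in> ball (of_real p) t" by (simp add: U_def)
    then have "complex_of_real (hinv y) \<in> ball (of_real p) s" using t(2) by (rule subsetD[rotated])
    then have "\<bar>hinv y - p\<bar> < s" by (simp add: dist_of_real dist_real_def abs_minus_commute)
    then have "H (complex_of_real (hinv y)) = of_real y"
      using s(3)[of "hinv y"] hinv_mem[OF y(1)] h_hinv[OF y(1)] by auto
    then show "G (complex_of_real y) = complex_of_real (hinv y)" using G(3)[OF qU] by simp
  next
    show "min r1 r2 > 0" using r1(1) r2(1) by simp
  qed
qed

lemma abs_ln_dh_bounded_away:
  assumes "e > 0"
  obtains M where "\<And>x. x \<in> {-1..1} \<Longrightarrow> \<bar>x\<bar> \<ge> e \<Longrightarrow> \<bar>ln \<bar>dh x\<bar>\<bar> \<le> M"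
proof -
  define K where "K = {-1..1} \<inter> {x::real. \<bar>x\<bar> \<ge> e}"
  have "closed {x::real. \<bar>x\<bar> \<ge> e}" by (intro closed_Collect_le continuous_intros)
  then have "compact K" unfolding K_def by (intro compact_Int_closed) auto
  moreover have K: "K \<subseteq> {-1..1} - {0}" using assms by (auto simp: K_def)
  have "continuous_on K (\<lambda>x. ln \<bar>dh x\<bar>)"
    using K dh_eq_0_iff by (intro continuous_intros continuous_on_subset[OF continuous_on_dh K]) auto
  ultimately have "bounded ((\<lambda>x. ln \<bar>dh x\<bar>) ` K)"
    by (intro compact_imp_bounded compact_continuous_image) auto
  then obtain M where "\<And>x. x \<in> K \<Longrightarrow> \<bar>ln \<bar>dh x\<bar>\<bar> \<le> M"
    unfolding bounded_iff by auto
  then show ?thesis by (intro that[of M]) (auto simp: K_def)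
qed

end

section \<open>Power laws at the critical point\<close>

lemma isCont_abs_powr: "b > 0 \<Longrightarrow> isCont (\<lambda>s::real. \<bar>s\<bar> powr b) z"
proof -
  assume "b > 0"
  then have "continuous_on UNIV (\<lambda>s::real. \<bar>s\<bar> powr b)"
    by (intro continuous_on_powr' continuous_intros) auto
  then show ?thesis by (simp add: continuous_on_eq_continuous_at)
qed

lemma DERIV_abs_powr:
  assumes "(z::real) > 0" shows "DERIV (\<lambda>s. \<bar>s\<bar> powr b) z :> b * z powr (b - 1)"
proof (rule has_field_derivative_transform_within_open)
  show "DERIV (\<lambda>s. s powr b) z :> b * z powr (b - 1)"
    using assms by (rule has_real_derivative_powr)
  show "open {(0::real)<..}" "z \<in> {0<..}" using assms by auto
qed auto

text \<open>
  If \<open>u\<close> is comparable to \<open>t\<^bsup>a+1\<^esup>\<close> and \<open>d\<close> to \<open>t\<^bsup>-a\<^esup>\<close>, then \<open>d\<close> is comparable to \<open>u\<^bsup>-l\<^esup>\<close> with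
  \<open>l = a / (a+1)\<close>. This is how the order of the critical point determines the Lorenz exponent.
\<close>

lemma reciprocal_power_comparison:
  fixes a t u d A1 A2 m1 m2 :: real
  assumes l_def: "l = a / (a + 1)" and L_def: "L = 1 / (A1 * m1 powr l) + A2 * m2 powr l"
    and pos: "a > 0" "t > 0" "A1 > 0" "A2 > 0" "m1 > 0" "m2 > 0"
    and u: "m1 * t powr (a + 1) \<le> u" "u \<le> m2 * t powr (a + 1)"
    and d: "A1 / t powr a \<le> d" "d \<le> A2 / t powr a"
  shows "1 / (L * u powr l) \<le> d" "d \<le> L / u powr l"
proof -
  have l: "l > 0" "(a + 1) * l = a" using pos by (auto simp: l_def)
  have tl: "(m * t powr (a + 1)) powr l = m powr l * t powr a" if "m > 0" for m
    using that pos l by (simp add: powr_mult powr_powr)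
  have u0: "u > 0" using u(1) pos by (smt (verit) mult_pos_pos powr_gt_zero)
  have u1: "m1 powr l * t powr a \<le> u powr l"
    using powr_mono2[OF less_imp_le[OF l(1)] _ u(1)] tl[OF pos(5)] pos by simp
  have u2: "u powr l \<le> m2 powr l * t powr a"
    using powr_mono2[OF less_imp_le[OF l(1)] _ u(2)] tl[OF pos(6)] u0 by simp
  have p: "m1 powr l > 0" "m2 powr l > 0" "t powr a > 0" "u powr l > 0" using pos u0 by auto
  have L1: "L \<ge> 1 / (A1 * m1 powr l)" and L2: "L \<ge> A2 * m2 powr l"
    using pos p by (auto simp: L_def)
  have L0: "L > 0" using L2 pos p by (smt (verit) mult_pos_pos)
  have "1 \<le> L * (A1 * m1 powr l)" using L1 pos p by (simp add: field_simps)
  then have "t powr a * 1 \<le> t powr a * (L * (A1 * m1 powr l))" using p by (intro mult_left_mono) auto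
  also have "\<dots> = L * A1 * (m1 powr l * t powr a)" by simp
  also have "\<dots> \<le> L * A1 * u powr l" using u1 L0 pos by (intro mult_left_mono) auto
  finally have "1 / (L * u powr l) \<le> A1 / t powr a" using L0 p by (simp add: field_simps)
  then show "1 / (L * u powr l) \<le> d" using d(1) by simp
  have "A2 * u powr l \<le> A2 * (m2 powr l * t powr a)" using u2 pos by (intro mult_left_mono) auto
  also have "\<dots> = (A2 * m2 powr l) * t powr a" by simp
  also have "\<dots> \<le> L * t powr a" using L2 p by (intro mult_right_mono) auto
  finally have "A2 / t powr a \<le> L / u powr l" using p by (simp add: field_simps)
  then show "d \<le> L / u powr l" using d(2) by simp
qed

context interval_homeo begin

lemma h_deriv_interior: "x \<in> {-1<..<1} \<Longrightarrow> DERIV h x :> dh x"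
  using h_deriv[of x] at_within_Icc_at[of "-1" x 1] by simp

lemma isCont_h: "x \<in> {-1<..<1} \<Longrightarrow> isCont h x"
  using h_deriv_interior DERIV_isCont by blast

text \<open>
  The derivative of \<open>h\<close> vanishes at \<open>0\<close>.
\<close>

lemma h_gap_le: "\<exists>\<delta>>0. \<forall>x. \<bar>x\<bar> < \<delta> \<longrightarrow> \<bar>h x - c\<bar> \<le> \<bar>x\<bar>"
proof -
  have "DERIV h 0 :> 0" using h_deriv_interior[of 0] dh_eq_0_iff[of 0] by simp
  then have "((\<lambda>x. (h x - h 0) / (x - 0)) \<longlongrightarrow> 0) (at 0)" unfolding has_field_derivative_iff .
  from tendstoD[OF this, of 1] have "\<forall>\<^sub>F x in at 0. \<bar>h x - h 0\<bar> / \<bar>x\<bar> < 1" by (simp add: dist_real_def)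
  then obtain \<delta> where d: "\<delta> > 0" "\<And>x. x \<noteq> 0 \<Longrightarrow> \<bar>x\<bar> < \<delta> \<Longrightarrow> \<bar>h x - h 0\<bar> / \<bar>x\<bar> < 1"
    unfolding eventually_at by (auto simp: dist_real_def)
  have "\<bar>h x - c\<bar> \<le> \<bar>x\<bar>" if "\<bar>x\<bar> < \<delta>" for x
  proof (cases "x = 0")
    case False
    then show ?thesis using d(2)[OF False that] by (simp add: c_def field_simps)
  qed (simp add: c_def)
  then show ?thesis using d(1) by blast
qed

lemma near_c:
  assumes "\<delta> > 0"
  obtains \<epsilon> where "\<epsilon> > 0" "\<And>y. \<bar>y - c\<bar> < \<epsilon> \<Longrightarrow> y \<in> {-1..1} \<and> \<bar>hinv y\<bar> < \<delta>"
proof -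
  have c0: "hinv c = 0" using hinv_h[of 0] by (simp add: c_def)
  have cI: "c \<in> {-1..1}" using c_mem by auto
  obtain e where e: "e > 0" "\<And>y. y \<in> {-1..1} \<Longrightarrow> \<bar>y - c\<bar> < e \<Longrightarrow> \<bar>hinv y - hinv c\<bar> < \<delta>"
    using cont_hinv[unfolded continuous_on_iff dist_real_def, rule_format, OF cI assms] by blast
  show ?thesis
  proof (rule that[of "Min {e, 1 - c, c + 1}"])
    show "Min {e, 1 - c, c + 1} > 0" using e(1) c_mem by auto
    fix y assume y: "\<bar>y - c\<bar> < Min {e, 1 - c, c + 1}"
    then have "y \<in> {-1..1}" by auto
    then show "y \<in> {-1..1} \<and> \<bar>hinv y\<bar> < \<delta>" using e(2)[of y] y c0 by auto
  qed
qed

lemma h_less_iff_mono: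
  "strict_mono_on {-1..1} h \<Longrightarrow> p \<in> {-1..1} \<Longrightarrow> q \<in> {-1..1} \<Longrightarrow> h p < h q \<longleftrightarrow> p < q"
  by (rule strict_mono_on_less)

lemma h_less_iff_antimono:
  assumes "strict_antimono_on {-1..1} h" "p \<in> {-1..1}" "q \<in> {-1..1}"
  shows "h p < h q \<longleftrightarrow> q < p"
proof (cases p q rule: linorder_cases)
  case less
  then have "h q < h p" using assms by (auto simp: monotone_on_def)
  then show ?thesis using less by simp
next
  case greater
  then have "h p < h q" using assms by (auto simp: monotone_on_def)
  then show ?thesis using greater by simp
qed simp

end

locale nonflat_homeo = interval_homeo +
  assumes nonflat: "non_flat h 0"
begin

text \<open>
  One-sided non-flatness at \<open>0\<close>; the sign \<open>\<sigma>\<close> selects the side, so that both sides are treated at once.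
\<close>

definition power_law :: "real \<Rightarrow> real \<Rightarrow> real \<Rightarrow> real \<Rightarrow> bool" where
  "power_law \<sigma> a M \<delta> \<longleftrightarrow> a > 0 \<and> M > 0 \<and> 0 < \<delta> \<and> \<delta> < 1 \<and>
     (\<forall>t. 0 < t \<longrightarrow> t < \<delta> \<longrightarrow>
        exp (- M) * t powr a \<le> \<bar>dh (\<sigma> * t)\<bar> \<and> \<bar>dh (\<sigma> * t)\<bar> \<le> exp M * t powr a)"

lemma power_lawD:
  assumes "power_law \<sigma> a M \<delta>" "0 < t" "t < \<delta>"
  shows "exp (- M) * t powr a \<le> \<bar>dh (\<sigma> * t)\<bar>" "\<bar>dh (\<sigma> * t)\<bar> \<le> exp M * t powr a"
  using assms unfolding power_law_def by blast+

lemma power_law_pos: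
  assumes "power_law \<sigma> a M \<delta>"
  shows "a > 0" "M > 0" "0 < \<delta>" "\<delta> < 1"
  using assms unfolding power_law_def by blast+

lemma exp_bounds_of_abs_ln:
  assumes "x > 0" "y > 0" "\<bar>ln (x / y)\<bar> \<le> M"
  shows "exp (- M) * y \<le> x" "x \<le> exp M * (y::real)"
proof -
  have "exp (ln (x / y)) \<le> exp M" "exp (- M) \<le> exp (ln (x / y))"
    unfolding exp_le_cancel_iff using assms(3) by linarith+
  then have "x / y \<le> exp M" "exp (- M) \<le> x / y" using assms(1,2) by simp_all
  then show "exp (- M) * y \<le> x" "x \<le> exp M * y" using assms by (auto simp: field_simps)
qed

lemma power_law_exists:
  assumes "\<sigma> = 1 \<or> \<sigma> = -1"
  obtains a M \<delta> where "power_law \<sigma> a M \<delta>"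
proof -
  obtain ap am M \<delta> where n: "ap > 0" "am > 0" "M > 0" "\<delta> > 0"
    and r: "\<And>x. x \<in> {0<..<0 + \<delta>} \<Longrightarrow> log_deriv_defined h x \<and> \<bar>ln (\<bar>dh x\<bar> / \<bar>x - 0\<bar> powr ap)\<bar> \<le> M"
    and l: "\<And>x. x \<in> {0 - \<delta><..<0} \<Longrightarrow> log_deriv_defined h x \<and> \<bar>ln (\<bar>dh x\<bar> / \<bar>x - 0\<bar> powr am)\<bar> \<le> M"
    using nonflat unfolding non_flat_def by metis
  define a where "a = (if \<sigma> = 1 then ap else am)"
  have "exp (- M) * t powr a \<le> \<bar>dh (\<sigma> * t)\<bar> \<and> \<bar>dh (\<sigma> * t)\<bar> \<le> exp M * t powr a"
    if t: "0 < t" "t < min \<delta> (1/2)" for t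
  proof -
    have *: "\<bar>ln (\<bar>dh (\<sigma> * t)\<bar> / t powr a)\<bar> \<le> M"
    proof (cases "\<sigma> = 1")
      case True
      then show ?thesis using r[of t] t by (simp add: a_def)
    next
      case False
      then show ?thesis using l[of "- t"] t assms by (simp add: a_def)
    qed
    have "\<sigma> * t \<in> {-1..1}" "\<sigma> * t \<noteq> 0" using t assms by auto
    then have "\<bar>dh (\<sigma> * t)\<bar> > 0" using dh_eq_0_iff[of "\<sigma> * t"] by simp
    from exp_bounds_of_abs_ln[OF this _ *] t show ?thesis by simp
  qed
  then have "power_law \<sigma> a M (min \<delta> (1/2))" using n by (auto simp: power_law_def a_def)
  then show ?thesis by (rule that)
qed

text \<open>
  Cauchy's mean value theorem for \<open>h\<close> and \<open>\<bar>s\<bar>\<^bsup>a+1\<^esup>\<close> turns bounds of \<open>\<bar>h'\<bar>\<close> into bounds of the increment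
  of \<open>h\<close> without integrating.
\<close>

lemma h_gap_power_law:
  assumes \<sigma>: "\<sigma> = 1 \<or> \<sigma> = -1" and law: "power_law \<sigma> a M \<delta>" and t: "0 < t" "t < \<delta>"
  shows "exp (- M) / (a + 1) * t powr (a + 1) \<le> \<bar>h (\<sigma> * t) - c\<bar>"
    "\<bar>h (\<sigma> * t) - c\<bar> \<le> exp M / (a + 1) * t powr (a + 1)"
proof -
  note a = power_law_pos(1)[OF law] and \<delta> = power_law_pos(4)[OF law]
  have "\<exists>z>0. z < t \<and>
      (h (\<sigma> * t) - h (\<sigma> * 0)) * ((a + 1) * z powr (a + 1 - 1)) =
      (\<bar>t\<bar> powr (a + 1) - \<bar>0\<bar> powr (a + 1)) * (dh (\<sigma> * z) * \<sigma>)"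
  proof (rule GMVT'[OF t(1)])
    fix z :: real assume z: "0 \<le> z" "z \<le> t"
    then have "\<sigma> * z \<in> {-1<..<1}" using t \<delta> \<sigma> by auto
    then have "isCont h (\<sigma> * z)" by (rule isCont_h)
    moreover have "isCont (\<lambda>s. \<sigma> * s) z" by (intro continuous_intros)
    ultimately show "isCont (\<lambda>s. h (\<sigma> * s)) z" by (rule isCont_o2[rotated])
    show "isCont (\<lambda>s. \<bar>s\<bar> powr (a + 1)) z" using a by (intro isCont_abs_powr) auto
  next
    fix z :: real assume z: "0 < z" "z < t"
    then show "DERIV (\<lambda>s. \<bar>s\<bar> powr (a + 1)) z :> (a + 1) * z powr (a + 1 - 1)"
      by (intro DERIV_abs_powr)
    have "\<sigma> * z \<in> {-1<..<1}" using z t \<delta> \<sigma> by auto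
    then have "DERIV h (\<sigma> * z) :> dh (\<sigma> * z)" by (rule h_deriv_interior)
    moreover have "DERIV (\<lambda>s. \<sigma> * s) z :> \<sigma>" by (auto intro!: derivative_eq_intros)
    ultimately show "DERIV (\<lambda>s. h (\<sigma> * s)) z :> dh (\<sigma> * z) * \<sigma>" by (rule DERIV_chain2)
  qed
  then obtain z where z: "0 < z" "z < t"
    and eq: "(h (\<sigma> * t) - c) * ((a + 1) * z powr a) = t powr (a + 1) * (dh (\<sigma> * z) * \<sigma>)"
    using t(1) by (auto simp: c_def)
  have "\<bar>\<sigma>\<bar> = 1" using \<sigma> by auto
  with arg_cong[OF eq, of abs]
  have eq': "\<bar>h (\<sigma> * t) - c\<bar> * (a + 1) * z powr a = t powr (a + 1) * \<bar>dh (\<sigma> * z)\<bar>"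
    using a by (simp add: abs_mult mult.assoc)
  have "z < \<delta>" using z t by simp
  note b = power_lawD[OF law z(1) this]
  have zp: "z powr a > 0" using z by simp
  have "(t powr (a + 1) * exp (- M)) * z powr a \<le> t powr (a + 1) * \<bar>dh (\<sigma> * z)\<bar>"
    using mult_left_mono[OF b(1), of "t powr (a + 1)"] by (simp add: mult.assoc)
  also note eq'[symmetric]
  finally have "t powr (a + 1) * exp (- M) \<le> \<bar>h (\<sigma> * t) - c\<bar> * (a + 1)"
    using zp by (rule mult_right_le_imp_le)
  then show "exp (- M) / (a + 1) * t powr (a + 1) \<le> \<bar>h (\<sigma> * t) - c\<bar>"
    using a by (simp add: field_simps)
  note eq'
  also have "t powr (a + 1) * \<bar>dh (\<sigma> * z)\<bar> \<le> (t powr (a + 1) * exp M) * z powr a"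
    using mult_left_mono[OF b(2), of "t powr (a + 1)"] by (simp add: mult.assoc)
  finally have "\<bar>h (\<sigma> * t) - c\<bar> * (a + 1) \<le> t powr (a + 1) * exp M"
    using zp by (rule mult_right_le_imp_le)
  then show "\<bar>h (\<sigma> * t) - c\<bar> \<le> exp M / (a + 1) * t powr (a + 1)"
    using a by (simp add: field_simps)
qed

lemma ln_dh_le:
  obtains a M \<delta> where "a > 0" "0 < \<delta>" "\<delta> < 1"
    "\<And>x. 0 < \<bar>x\<bar> \<Longrightarrow> \<bar>x\<bar> < \<delta> \<Longrightarrow> ln \<bar>dh x\<bar> \<le> M + a * ln \<bar>x\<bar>"
proof -
  obtain a M \<delta> where l: "power_law 1 a M \<delta>" using power_law_exists[of 1] by auto
  obtain a' M' \<delta>' where l': "power_law (-1) a' M' \<delta>'" using power_law_exists[of "-1"] by auto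
  have one: "ln \<bar>dh (\<sigma> * t)\<bar> \<le> max M M' + min a a' * ln t"
    if "\<sigma> = 1 \<or> \<sigma> = -1" "0 < t" "t < min \<delta> \<delta>'" for \<sigma> t
  proof -
    define b N where "b = (if \<sigma> = 1 then a else a')" and "N = (if \<sigma> = 1 then M else M')"
    have "power_law \<sigma> b N (if \<sigma> = 1 then \<delta> else \<delta>')" using that(1) l l' by (cases "\<sigma> = 1") (simp_all add: b_def N_def)
    from power_lawD(2)[OF this that(2)] have "\<bar>dh (\<sigma> * t)\<bar> \<le> exp N * t powr b"
      using that(3) by (simp split: if_splits)
    moreover have "\<delta> < 1" by (rule power_law_pos[OF l])
    then have "\<sigma> * t \<in> {-1..1}" "\<sigma> * t \<noteq> 0" using that by auto
    then have "\<bar>dh (\<sigma> * t)\<bar> > 0" using dh_eq_0_iff[of "\<sigma> * t"] by simp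
    ultimately have "ln \<bar>dh (\<sigma> * t)\<bar> \<le> ln (exp N * t powr b)" using that by simp
    also have "\<dots> = N + b * ln t" using that by (simp add: ln_mult ln_powr)
    also have "\<dots> \<le> max M M' + min a a' * ln t"
    proof (intro add_mono)
      have "ln t \<le> 0" using that power_law_pos(4)[OF l] by simp
      then show "b * ln t \<le> min a a' * ln t" by (intro mult_right_mono_neg) (auto simp: b_def)
    qed (auto simp: N_def)
    finally show ?thesis .
  qed
  show ?thesis
  proof (rule that[of "min a a'" "min \<delta> \<delta>'" "max M M'"])
    fix x :: real assume x: "0 < \<bar>x\<bar>" "\<bar>x\<bar> < min \<delta> \<delta>'"
    have "sgn x = 1 \<or> sgn x = -1" using x by (auto simp: sgn_if)
    from one[OF this x] show "ln \<bar>dh x\<bar> \<le> max M M' + min a a' * ln \<bar>x\<bar>"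
      by (simp add: sgn_mult_abs)
  qed (use power_law_pos[OF l] power_law_pos[OF l'] in auto)
qed

text \<open>
  Near \<open>0\<close> this is the power law, with the larger of the two exponents; elsewhere \<open>\<bar>h x - c\<bar>\<close> is bounded away
  from \<open>0\<close> by compactness.
\<close>

lemma neg_ln_h_gap_le:
  obtains b B where "b > 0" "B > 0"
    "\<And>x. x \<in> {-1..1} \<Longrightarrow> x \<noteq> 0 \<Longrightarrow> - ln \<bar>h x - c\<bar> \<le> B - b * ln \<bar>x\<bar>"
proof -
  obtain a M \<delta> where l: "power_law 1 a M \<delta>" using power_law_exists[of 1] by auto
  obtain a' M' \<delta>' where l': "power_law (-1) a' M' \<delta>'" using power_law_exists[of "-1"] by auto
  define N where "N = max (M + ln (a + 1)) (M' + ln (a' + 1))"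
  define b where "b = max a a' + 1"
  define d where "d = min \<delta> \<delta>'"
  have d: "d > 0" using power_law_pos[OF l] power_law_pos[OF l'] by (simp add: d_def)
  have near: "- ln \<bar>h (\<sigma> * t) - c\<bar> \<le> N - b * ln t"
    if s: "\<sigma> = 1 \<or> \<sigma> = -1" and t: "0 < t" "t < d" for \<sigma> t
  proof -
    define e K where "e = (if \<sigma> = 1 then a else a')" and "K = (if \<sigma> = 1 then M else M')"
    have law: "power_law \<sigma> e K (if \<sigma> = 1 then \<delta> else \<delta>')" using s l l' by (cases "\<sigma> = 1") (simp_all add: e_def K_def)
    have e: "e > 0" by (rule power_law_pos[OF law])
    have "exp (- K) / (e + 1) * t powr (e + 1) \<le> \<bar>h (\<sigma> * t) - c\<bar>"
      by (rule h_gap_power_law(1)[OF s law t(1)]) (use t(2) in \<open>simp add: d_def\<close>)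
    moreover have p: "exp (- K) / (e + 1) * t powr (e + 1) > 0" using e t by simp
    ultimately have "ln (exp (- K) / (e + 1) * t powr (e + 1)) \<le> ln \<bar>h (\<sigma> * t) - c\<bar>" by simp
    moreover have "ln (exp (- K) / (e + 1) * t powr (e + 1)) = - K - ln (e + 1) + (e + 1) * ln t"
      using e t by (simp add: ln_mult ln_div ln_powr)
    moreover have "b * ln t \<le> (e + 1) * ln t"
    proof (rule mult_right_mono_neg)
      show "ln t \<le> 0" using t power_law_pos(4)[OF l] by (simp add: d_def)
    qed (auto simp: b_def e_def)
    moreover have "K + ln (e + 1) \<le> N" by (auto simp: K_def e_def N_def)
    ultimately show ?thesis by linarith
  qed
  define K where "K = {-1..1} \<inter> {x::real. \<bar>x\<bar> \<ge> d}"
  have "closed {x::real. \<bar>x\<bar> \<ge> d}" by (intro closed_Collect_le continuous_intros)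
  then have "compact K" unfolding K_def by (intro compact_Int_closed) auto
  moreover have nz: "h x - c \<noteq> 0" if "x \<in> K" for x
    using h_eq_iff[of x 0] that d by (auto simp: K_def c_def)
  have KI: "K \<subseteq> {-1..1}" by (simp add: K_def)
  have "continuous_on K (\<lambda>x. ln \<bar>h x - c\<bar>)"
    by (intro continuous_intros continuous_on_subset[OF cont_h KI]) (use nz in auto)
  ultimately have "bounded ((\<lambda>x. ln \<bar>h x - c\<bar>) ` K)"
    by (intro compact_imp_bounded compact_continuous_image) auto
  then obtain N' where far: "\<And>x. x \<in> K \<Longrightarrow> \<bar>ln \<bar>h x - c\<bar>\<bar> \<le> N'"
    unfolding bounded_iff by auto
  show ?thesis
  proof (rule that[of b "max 1 (max N N')"])
    show "b > 0" using power_law_pos(1)[OF l] by (simp add: b_def)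
    fix x :: real assume x: "x \<in> {-1..1}" "x \<noteq> 0"
    show "- ln \<bar>h x - c\<bar> \<le> max 1 (max N N') - b * ln \<bar>x\<bar>"
    proof (cases "\<bar>x\<bar> < d")
      case True
      have "sgn x = 1 \<or> sgn x = -1" using x by (auto simp: sgn_if)
      from near[OF this _ True] x show ?thesis by (simp add: sgn_mult_abs)
    next
      case False
      have "b * ln \<bar>x\<bar> \<le> 0" using x \<open>b > 0\<close> by (intro mult_nonneg_nonpos) auto
      then show ?thesis using far[of x] x False by (auto simp: K_def)
    qed
  qed auto
qed

end

section \<open>Differentiability and returns along orbits of the tent map\<close>

context fibonacci_tent begin

lemma T_mem: "x \<in> {-1..1} \<Longrightarrow> T x \<in> {-1..1}"
  using tent_mem[of lam x] lam_range by simp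

lemma T_iter_mem: "x \<in> {-1..1} \<Longrightarrow> (T ^^ n) x \<in> {-1..1}"
  using tent_iter_mem[of lam x n] lam_range by simp

lemma T_iter_after_hit:
  assumes "(T ^^ m) p = 0" "m < n"
  shows "(T ^^ n) p \<noteq> 0"
proof -
  have "(T ^^ n) p = (T ^^ (n - m)) ((T ^^ m) p)"
    using assms(2) by (metis comp_apply funpow_add le_add_diff_inverse2 less_imp_le)
  then show ?thesis using crit_orbit_nonzero[of "n - m"] assms by (simp add: crit_orbit_def)
qed

lemma T_deriv: "x \<noteq> 0 \<Longrightarrow> (T has_real_derivative (- lam * sgn x)) (at x within S)"
proof -
  assume x: "x \<noteq> 0"
  have "((\<lambda>y. lam * (1 - sgn x * y) - 1) has_real_derivative (- lam * sgn x)) (at x)"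
    by (auto intro!: derivative_eq_intros)
  then have "(T has_real_derivative (- lam * sgn x)) (at x)"
  proof (rule has_field_derivative_transform_within_open)
    show "open {y. sgn x * y > 0}" by (intro open_Collect_less continuous_intros)
    show "x \<in> {y. sgn x * y > 0}" using x by (simp add: sgn_if)
  qed (use x in \<open>auto simp: tent_def sgn_if split: if_splits\<close>)
  then show ?thesis by (rule has_field_derivative_at_within)
qed

lemma T_iter_deriv:
  assumes "\<And>i. i < n \<Longrightarrow> (T ^^ i) p \<noteq> 0"
  shows "\<exists>D. \<bar>D\<bar> = lam ^ n \<and> ((T ^^ n) has_real_derivative D) (at p within S)"
  using assms
proof (induction n)
  case 0
  show ?case by (intro exI[of _ 1]) (auto simp: id_def)
next
  case (Suc n)
  then obtain D where D: "\<bar>D\<bar> = lam ^ n" "((T ^^ n) has_real_derivative D) (at p within S)" by auto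
  have nz: "(T ^^ n) p \<noteq> 0" using Suc.prems by simp
  have "((\<lambda>q. T ((T ^^ n) q)) has_real_derivative (- lam * sgn ((T ^^ n) p)) * D) (at p within S)"
    by (rule has_real_derivative_within_compose[OF D(2) T_deriv[OF nz] subset_UNIV])
  moreover have "\<bar>(- lam * sgn ((T ^^ n) p)) * D\<bar> = lam ^ Suc n"
    using D(1) nz lam_gt_1 by (simp add: abs_mult abs_sgn_eq)
  ultimately show ?case by (intro exI[of _ "(- lam * sgn ((T ^^ n) p)) * D"]) (simp add: o_def)
qed

lemma T_iter_endpoint: "\<bar>p\<bar> = 1 \<Longrightarrow> \<bar>(T ^^ n) p\<bar> = 1"
  by (induction n) (simp_all add: tent_def)

text \<open>
  At \<open>p\<close> the map \<open>T\<^bsup>m+1\<^esup>\<close> attains its maximum \<open>T(0)\<close>, so a derivative would have to be \<open>0\<close>; but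
  orbits of nearby points do not separate from that of \<open>p\<close> before this time, so the difference quotients have absolute value \<open>lam\<^bsup>m+1\<^esup>\<close>.
\<close>

lemma T_iter_turns:
  assumes p: "p \<in> {-1..1}" and hit: "(T ^^ m) p = 0"
  shows "\<not> (T ^^ Suc m) differentiable (at p within {-1..1})"
proof
  assume "(T ^^ Suc m) differentiable (at p within {-1..1})"
  then obtain D where D0: "((T ^^ Suc m) has_real_derivative D) (at p within {-1..1})"
    by (rule real_differentiableE)
  have "\<bar>p\<bar> \<noteq> 1" using T_iter_endpoint[of p m] hit by auto
  then have "-1 < p" "p < 1" using p by auto
  then have D: "DERIV (T ^^ Suc m) p :> D" using D0 at_within_Icc_at[of "-1" p 1] by simp
  have "(T ^^ Suc m) q \<le> (T ^^ Suc m) p" for q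
    using hit lam_gt_1 by (simp add: tent_def)
  then have "D = 0" by (intro DERIV_local_max[OF D zero_less_one]) auto
  have "\<forall>\<^sub>F q in at p. \<forall>i\<in>{..<Suc m}. (T ^^ i) q * (T ^^ i) p \<ge> 0"
  proof (intro eventually_ball_finite ballI)
    fix i
    show "\<forall>\<^sub>F q in at p. (T ^^ i) q * (T ^^ i) p \<ge> 0"
    proof (cases "(T ^^ i) p = 0")
      case False
      have "((\<lambda>q. (T ^^ i) q * (T ^^ i) p) \<longlongrightarrow> (T ^^ i) p * (T ^^ i) p) (at p)"
        using isCont_tent_iter[where s = lam and n = i and x = p] unfolding isCont_def by (rule tendsto_mult_right)
      moreover have "(T ^^ i) p * (T ^^ i) p > 0" using False by (metis not_real_square_gt_zero)
      ultimately have "\<forall>\<^sub>F q in at p. (T ^^ i) q * (T ^^ i) p > 0" by (rule order_tendstoD(1))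
      then show ?thesis by (rule eventually_mono) simp
    qed simp
  qed simp
  moreover have "\<forall>\<^sub>F q in at p. q \<noteq> p" by (simp add: eventually_at_filter)
  ultimately have "\<forall>\<^sub>F q in at p. \<bar>((T ^^ Suc m) q - (T ^^ Suc m) p) / (q - p)\<bar> = lam ^ Suc m"
  proof eventually_elim
    case (elim q)
    have "\<bar>(T ^^ Suc m) q - (T ^^ Suc m) p\<bar> = lam ^ Suc m * \<bar>q - p\<bar>"
      using elim lam_gt_1 by (intro tent_iter_same_side) auto
    then show ?case using elim by (simp only: abs_divide) simp
  qed
  then have "((\<lambda>q. \<bar>((T ^^ Suc m) q - (T ^^ Suc m) p) / (q - p)\<bar>) \<longlongrightarrow> lam ^ Suc m) (at p)"
    by (rule tendsto_eventually)
  moreover have "((\<lambda>q. \<bar>((T ^^ Suc m) q - (T ^^ Suc m) p) / (q - p)\<bar>) \<longlongrightarrow> \<bar>D\<bar>) (at p)"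
    using D unfolding has_field_derivative_iff by (rule tendsto_rabs)
  ultimately have "lam ^ Suc m = \<bar>D\<bar>" by (rule tendsto_unique[OF trivial_limit_at])
  then show False using lam_power_pos[of "Suc m"] \<open>D = 0\<close> by linarith
qed

text \<open>
  Away from its turning point \<open>T\<close> is locally invertible with affine inverse.
\<close>

lemma T_iter_differentiable_pred:
  assumes "(T ^^ Suc n) differentiable (at p within {-1..1})" "(T ^^ n) p \<noteq> 0" "p \<in> {-1..1}"
  shows "(T ^^ n) differentiable (at p within {-1..1})"
proof -
  define s where "s = sgn ((T ^^ n) p)"
  define g where "g = T ^^ Suc n"
  define u where "u q = s * (1 - (g q + 1) / lam)" for q
  obtain D where D: "(g has_real_derivative D) (at p within {-1..1})"
    using assms(1) unfolding g_def by (rule real_differentiableE)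
  have "(u has_real_derivative (s * (- (D / lam)))) (at p within {-1..1})"
    unfolding u_def using D lam_gt_1 by (auto intro!: derivative_eq_intros)
  then have u: "u differentiable (at p within {-1..1})"
    unfolding real_differentiable_def by (rule exI)
  have "((\<lambda>q. s * (T ^^ n) q) \<longlongrightarrow> s * (T ^^ n) p) (at p)"
    using isCont_tent_iter[where s = lam and n = n and x = p] unfolding isCont_def by (rule tendsto_mult_left)
  moreover have "s * (T ^^ n) p > 0" using assms(2) by (simp add: s_def sgn_if)
  ultimately have "\<forall>\<^sub>F q in at p. s * (T ^^ n) q > 0" by (rule order_tendstoD(1))
  then obtain d where d: "d > 0" "\<And>q. q \<noteq> p \<Longrightarrow> dist q p < d \<Longrightarrow> s * (T ^^ n) q > 0"
    unfolding eventually_at by auto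
  have "u q = (T ^^ n) q" if "dist q p < d" for q
  proof -
    have "s * (T ^^ n) q > 0" using d(2)[OF _ that] \<open>s * (T ^^ n) p > 0\<close> by (cases "q = p") auto
    moreover have "s = 1 \<or> s = -1" using assms(2) by (auto simp: s_def sgn_if)
    moreover have "u q = s * \<bar>(T ^^ n) q\<bar>" using lam_gt_1 by (simp add: u_def g_def tent_def)
    ultimately show ?thesis by auto
  qed
  then show ?thesis using differentiable_transform_within[OF u d(1) assms(3)] by blast
qed

lemma T_iter_not_differentiable:
  assumes "p \<in> {-1..1}" "(T ^^ m) p = 0" "m < n"
  shows "\<not> (T ^^ n) differentiable (at p within {-1..1})"
  using assms(3)
proof (induction n)
  case 0
  then show ?case by simp
next
  case (Suc n)
  show ?case
  proof (cases "n = m")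
    case True
    show ?thesis unfolding True by (rule T_iter_turns[OF assms(1,2)])
  next
    case False
    then have "m < n" using Suc.prems by simp
    then show ?thesis
      using Suc.IH T_iter_differentiable_pred[OF _ T_iter_after_hit[OF assms(2)] assms(1)] by blast
  qed
qed

text \<open>
  The returns of \<open>attractor_recurrence\<close> occur at arbitrarily late times, because finitely many points of an
  orbit that avoids \<open>0\<close> stay away from \<open>0\<close>. The quotient \<open>4\<close> bounds \<open>S(i+2) / S(i)\<close>.
\<close>

lemma attractor_close_return:
  assumes "p \<in> attractor" and nz: "\<And>n. (T ^^ n) p \<noteq> 0" and "\<delta> > 0"
  shows "\<exists>n\<ge>N. \<bar>(T ^^ n) p\<bar> < \<delta> \<and> - ln \<bar>(T ^^ n) p\<bar> \<ge> real n * ln lam / 4 - ln 22"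
proof -
  \<comment> \<open>smaller than all distances to zero before time \<open>N\<close>, which forces a return this close to come later\<close>
  define e where "e = Min (insert \<delta> ((\<lambda>n. \<bar>(T ^^ n) p\<bar>) ` {..<N}))"
  have "e > 0" unfolding e_def by (subst Min_gr_iff) (auto simp: nz assms(3))
  have "(\<lambda>i. 11 * return_dist (Suc i)) \<longlonglongrightarrow> 11 * 0"
    by (intro tendsto_intros LIMSEQ_Suc return_dist_tendsto_0)
  then have "\<forall>\<^sub>F i in sequentially. 11 * return_dist (Suc i) < e"
    by (rule order_tendstoD(2)) (use \<open>e > 0\<close> in simp)
  then obtain i where i: "11 * return_dist (Suc i) < e" by (rule eventually_happens'[OF sequentially_bot, elim_format]) blast
  obtain n where n: "n \<le> fib_time (Suc (Suc i))" "\<bar>(T ^^ n) p\<bar> \<le> 11 * return_dist (Suc i)"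
    using attractor_recurrence[OF assms(1), of "Suc i"] by auto
  have lt: "\<bar>(T ^^ n) p\<bar> < e" using n(2) i by simp
  have "n \<ge> N"
  proof (rule ccontr)
    assume "\<not> n \<ge> N"
    then have "e \<le> \<bar>(T ^^ n) p\<bar>" unfolding e_def by (intro Min_le) auto
    then show False using lt by simp
  qed
  moreover have "e \<le> \<delta>" unfolding e_def by (intro Min_le) auto
  moreover have "real n * ln lam / 4 \<le> real (fib_time i) * ln lam"
  proof -
    have "real n \<le> 4 * real (fib_time i)"
      using n(1) fib_time_Suc_le[of i] fib_time_Suc_le[of "Suc i"] by linarith
    then have "real n * ln lam \<le> 4 * real (fib_time i) * ln lam"
      using lam_gt_1 by (intro mult_right_mono) auto
    then show ?thesis by simp
  qed
  then have "- ln \<bar>(T ^^ n) p\<bar> \<ge> real n * ln lam / 4 - ln 22"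
    using neg_ln_return_dist[OF _ n(2)] nz[of n] by simp
  ultimately show ?thesis using lt by (intro exI[of _ n]) auto
qed

lemma neg_ln_crit_orbit_le:
  assumes "n \<ge> 1"
  shows "- ln \<bar>crit_orbit n\<bar> \<le> 3 * real n * ln lam - ln (lam - 1)"
proof -
  obtain k where k: "fib_time k \<le> n" "n < fib_time (Suc k)" using fib_time_bracket[OF assms] .
  have "fib_time (Suc (Suc k)) \<le> 3 * n"
    using fib_time_Suc_le[of k] k by simp
  then have "lam ^ fib_time (Suc (Suc k)) \<le> lam ^ (3 * n)" by (rule lam_power_ge)
  then have "return_dist (Suc k) * lam ^ fib_time (Suc (Suc k)) \<le> return_dist (Suc k) * lam ^ (3 * n)"
    using return_dist_nonneg by (intro mult_left_mono) auto
  then have "lam - 1 \<le> return_dist (Suc k) * lam ^ (3 * n)" using return_dist_lower[of "Suc k"] by simp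
  also have "\<dots> \<le> \<bar>crit_orbit n\<bar> * lam ^ (3 * n)"
    using crit_orbit_lower[OF assms k(2)] lam_gt_1 by (intro mult_right_mono) auto
  finally have "ln (lam - 1) \<le> ln (\<bar>crit_orbit n\<bar> * lam ^ (3 * n))" using lam_gt_1 by simp
  also have "\<dots> = ln \<bar>crit_orbit n\<bar> + real (3 * n) * ln lam"
    using crit_orbit_nonzero[OF assms] lam_gt_1 by (simp add: ln_mult ln_realpow)
  finally show ?thesis by simp
qed

end

section \<open>The conjugate map\<close>

locale conjugate_map = fibonacci_tent + nonflat_homeo
begin

definition f where "f = h \<circ> T \<circ> hinv"

lemma f_iter: "x \<in> {-1..1} \<Longrightarrow> (f ^^ n) x = h ((T ^^ n) (hinv x))"
proof (induction n)
  case (Suc n)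
  then show ?case using hinv_h[OF T_iter_mem[OF hinv_mem[OF Suc.prems], of n]] by (simp add: f_def)
qed (simp add: h_hinv)

lemma f_iter_h: "p \<in> {-1..1} \<Longrightarrow> (f ^^ n) (h p) = h ((T ^^ n) p)"
  using f_iter[OF h_mem, of p n] hinv_h[of p] by simp

lemma f_iter_deriv:
  assumes p: "p \<in> {-1..1}" "p \<noteq> 0" and nz: "\<And>i. i < n \<Longrightarrow> (T ^^ i) p \<noteq> 0"
  shows "\<exists>D. \<bar>D\<bar> = lam ^ n * \<bar>dh ((T ^^ n) p)\<bar> / \<bar>dh p\<bar> \<and>
    ((f ^^ n) has_real_derivative D) (at (h p) within {-1..1})"
proof -
  obtain D where D: "\<bar>D\<bar> = lam ^ n" "((T ^^ n) has_real_derivative D) (at p within {-1..1})"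
    using T_iter_deriv[OF nz] by blast
  have "((T ^^ n) has_real_derivative D) (at (hinv (h p)) within {-1..1})"
    using D(2) by (simp only: hinv_h[OF p(1)])
  from has_real_derivative_within_compose[OF hinv_deriv[OF p] this]
  have 1: "((\<lambda>y. (T ^^ n) (hinv y)) has_real_derivative D * (1 / dh p)) (at (h p) within {-1..1})"
    using hinv_mem by blast
  have "(h has_real_derivative dh ((T ^^ n) p)) (at ((T ^^ n) (hinv (h p))) within {-1..1})"
    using h_deriv[OF T_iter_mem[OF p(1), of n]] by (simp only: hinv_h[OF p(1)])
  from has_real_derivative_within_compose[OF 1 this]
  have "((\<lambda>y. h ((T ^^ n) (hinv y))) has_real_derivative dh ((T ^^ n) p) * (D * (1 / dh p))) (at (h p) within {-1..1})"
    using T_iter_mem hinv_mem by blast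
  then have "((f ^^ n) has_real_derivative dh ((T ^^ n) p) * (D * (1 / dh p))) (at (h p) within {-1..1})"
    by (rule has_field_derivative_transform_within[OF _ zero_less_one h_mem[OF p(1)]]) (simp only: f_iter)
  then show ?thesis
    by (intro exI[of _ "dh ((T ^^ n) p) * (D * (1 / dh p))"]) (simp add: abs_mult D(1))
qed

lemma f_deriv:
  assumes p: "p \<in> {-1..1}" "p \<noteq> 0"
  shows "f differentiable (at (h p) within {-1..1})"
    and "\<bar>deriv_I f (h p)\<bar> = lam * \<bar>dh (T p)\<bar> / \<bar>dh p\<bar>"
proof -
  have "\<exists>D. \<bar>D\<bar> = lam ^ 1 * \<bar>dh ((T ^^ 1) p)\<bar> / \<bar>dh p\<bar> \<and>
    ((f ^^ 1) has_real_derivative D) (at (h p) within {-1..1})"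
    by (rule f_iter_deriv) (use p in auto)
  then obtain D where D: "\<bar>D\<bar> = lam * \<bar>dh (T p)\<bar> / \<bar>dh p\<bar>"
      "(f has_real_derivative D) (at (h p) within {-1..1})"
    by auto
  show "f differentiable (at (h p) within {-1..1})"
    using D(2) unfolding real_differentiable_def by (rule exI)
  show "\<bar>deriv_I f (h p)\<bar> = lam * \<bar>dh (T p)\<bar> / \<bar>dh p\<bar>"
    using deriv_I_eq[OF D(2) h_mem[OF p(1)]] D(1) by simp
qed

text \<open>
  Apart from \<open>c\<close> itself, the derivative formula shows that \<open>f'\<close> vanishes exactly where \<open>h'(T p) = 0\<close>.
\<close>

lemma Sing_f: "Sing f c = h ` {p \<in> {-1..1}. p = 0 \<or> T p = 0}"
proof (intro equalityI subsetI)
  fix y assume y: "y \<in> Sing f c"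
  show "y \<in> h ` {p \<in> {-1..1}. p = 0 \<or> T p = 0}"
  proof (cases "y = c")
    case True
    then show ?thesis by (intro image_eqI[of _ _ 0]) (auto simp: c_def)
  next
    case False
    then have yI: "y \<in> {-1..1}" and d: "(f has_real_derivative 0) (at y within {-1..1})"
      using y by (auto simp: Sing_def Crit_def)
    define p where "p = hinv y"
    have p: "p \<in> {-1..1}" "h p = y" using hinv_mem[OF yI] h_hinv[OF yI] by (auto simp: p_def)
    have p0: "p \<noteq> 0" using False p(2) by (auto simp: c_def)
    have "deriv_I f (h p) = 0" using deriv_I_eq[OF d yI] p(2) by simp
    then have "dh (T p) = 0" using f_deriv(2)[OF p(1) p0] lam_gt_1 dh_eq_0_iff[OF p(1)] p0 by simp
    then have "T p = 0" using dh_eq_0_iff[OF T_mem[OF p(1)]] by simp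
    then show ?thesis using p by (intro image_eqI[of _ _ p]) auto
  qed
next
  fix y assume "y \<in> h ` {p \<in> {-1..1}. p = 0 \<or> T p = 0}"
  then obtain p where p: "p \<in> {-1..1}" "p = 0 \<or> T p = 0" "y = h p" by blast
  show "y \<in> Sing f c"
  proof (cases "p = 0")
    case True
    then show ?thesis using p by (simp add: Sing_def c_def)
  next
    case False
    then have "T p = 0" using p by simp
    then have "deriv_I f (h p) = 0"
      using f_deriv(2)[OF p(1) False] dh_eq_0_iff[of 0] by simp
    then have "h p \<in> Crit f"
      using deriv_I_differentiable[OF f_deriv(1)[OF p(1) False] h_mem[OF p(1)]] h_mem[OF p(1)]
      by (simp add: Crit_def)
    then show ?thesis by (simp add: Sing_def p(3))
  qed
qed

lemma h_mem_Sing_iff: "p \<in> {-1..1} \<Longrightarrow> h p \<in> Sing f c \<longleftrightarrow> p = 0 \<or> T p = 0"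
proof -
  assume p: "p \<in> {-1..1}"
  show ?thesis
  proof
    assume "h p \<in> Sing f c"
    then obtain q where q: "q \<in> {-1..1}" "q = 0 \<or> T q = 0" "h p = h q" unfolding Sing_f by blast
    then have "p = q" using h_eq_iff[OF p q(1)] by simp
    then show "p = 0 \<or> T p = 0" using q(2) by simp
  next
    assume "p = 0 \<or> T p = 0"
    then show "h p \<in> Sing f c" unfolding Sing_f using p by (intro imageI) simp
  qed
qed

lemma finite_Sing: "finite (Sing f c)"
proof -
  have "{p \<in> {-1..1}. p = 0 \<or> T p = 0} \<subseteq> {0, 1 - 1 / lam, - (1 - 1 / lam)}"
    using lam_gt_1 by (auto simp: tent_def abs_if field_simps split: if_splits)
  then have "finite {p \<in> {-1..1}. p = 0 \<or> T p = 0}" by (rule finite_subset) simp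
  then show ?thesis unfolding Sing_f by (rule finite_imageI)
qed

lemma cont_f: "continuous_on {-1..1} f"
proof -
  have "continuous_on {-1..1} (\<lambda>x. T (hinv x))"
    using cont_hinv unfolding tent_def by (intro continuous_intros)
  then have "continuous_on {-1..1} (\<lambda>x. h (T (hinv x)))"
    by (rule continuous_on_compose2[OF cont_h]) (use T_mem hinv_mem in blast)
  then show ?thesis by (simp add: f_def o_def)
qed

lemma f_image: "f ` {-1..1} \<subseteq> {-1..1}"
  using T_mem hinv_mem h_mem by (fastforce simp: f_def)

lemma T_less_left: "p < q \<Longrightarrow> q \<le> 0 \<Longrightarrow> T p < T q"
  and T_less_right: "p < q \<Longrightarrow> 0 \<le> p \<Longrightarrow> T q < T p"
  using lam_gt_1 by (auto simp: tent_def)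

lemma f_unimodal:
  "if strict_mono_on {-1..1} h then unimodal f c else reversed_unimodal f c"
proof -
  have fx: "f x = h (T (hinv x))" for x by (simp add: f_def)
  show ?thesis
  proof (cases "strict_mono_on {-1..1} h")
    case True
    note less = h_less_iff_mono[OF True]
    have hinv_less: "hinv x < hinv y \<longleftrightarrow> x < y" if "x \<in> {-1..1}" "y \<in> {-1..1}" for x y
      using less[OF hinv_mem[OF that(1)] hinv_mem[OF that(2)]] by (simp only: h_hinv that)
    have f_less: "f x < f y \<longleftrightarrow> T (hinv x) < T (hinv y)" if "x \<in> {-1..1}" "y \<in> {-1..1}" for x y
      unfolding fx using less[OF T_mem[OF hinv_mem[OF that(1)]] T_mem[OF hinv_mem[OF that(2)]]] .
    have c: "c \<in> {-1..1}" "hinv c = 0" using c_mem hinv_h[of 0] by (auto simp: c_def)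
    have "strict_mono_on {-1..<c} f"
    proof (rule strict_mono_onI)
      fix x y assume xy: "x \<in> {-1..<c}" "y \<in> {-1..<c}" "x < y"
      then have I: "x \<in> {-1..1}" "y \<in> {-1..1}" using c(1) by auto
      have "hinv y < 0" using hinv_less[OF I(2) c(1)] xy c(2) by simp
      then show "f x < f y" using f_less[OF I] hinv_less[OF I] xy T_less_left by simp
    qed
    moreover have "strict_antimono_on {c<..1} f"
    proof (rule monotone_onI)
      fix x y assume xy: "x \<in> {c<..1}" "y \<in> {c<..1}" "x < y"
      then have I: "x \<in> {-1..1}" "y \<in> {-1..1}" using c(1) by auto
      have "hinv x > 0" using hinv_less[OF c(1) I(1)] xy c(2) by simp
      then show "f x > f y" using f_less[OF I(2,1)] hinv_less[OF I] xy T_less_right by simp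
    qed
    ultimately show ?thesis using True cont_f f_image c_mem by (simp add: unimodal_def)
  next
    case False
    then have anti: "strict_antimono_on {-1..1} h" using h_monotone by simp
    note less = h_less_iff_antimono[OF anti]
    have hinv_less: "hinv y < hinv x \<longleftrightarrow> x < y" if "x \<in> {-1..1}" "y \<in> {-1..1}" for x y
      using less[OF hinv_mem[OF that(1)] hinv_mem[OF that(2)]] by (simp only: h_hinv that)
    have f_less: "f x < f y \<longleftrightarrow> T (hinv y) < T (hinv x)" if "x \<in> {-1..1}" "y \<in> {-1..1}" for x y
      unfolding fx using less[OF T_mem[OF hinv_mem[OF that(1)]] T_mem[OF hinv_mem[OF that(2)]]] .
    have c: "c \<in> {-1..1}" "hinv c = 0" using c_mem hinv_h[of 0] by (auto simp: c_def)
    have "strict_antimono_on {-1..<c} f"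
    proof (rule monotone_onI)
      fix x y assume xy: "x \<in> {-1..<c}" "y \<in> {-1..<c}" "x < y"
      then have I: "x \<in> {-1..1}" "y \<in> {-1..1}" using c(1) by auto
      have "hinv y > 0" using hinv_less[OF I(2) c(1)] xy c(2) by simp
      then show "f x > f y" using f_less[OF I(2,1)] hinv_less[OF I] xy T_less_right by simp
    qed
    moreover have "strict_mono_on {c<..1} f"
    proof (rule strict_mono_onI)
      fix x y assume xy: "x \<in> {c<..1}" "y \<in> {c<..1}" "x < y"
      then have I: "x \<in> {-1..1}" "y \<in> {-1..1}" using c(1) by auto
      have "hinv x < 0" using hinv_less[OF c(1) I(1)] xy c(2) by simp
      then show "f x < f y" using f_less[OF I] hinv_less[OF I] xy T_less_left by simp
    qed
    ultimately show ?thesis using False cont_f f_image c_mem by (simp add: reversed_unimodal_def)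
  qed
qed

text \<open>
  Near a point outside the singular set, \<open>f\<close> is the composition of the extension of \<open>hinv\<close>, an affine branch of
  \<open>T\<close>, and the extension of \<open>h\<close>.
\<close>

lemma f_analytic: "real_analytic_on f ({-1..1} - Sing f c)"
  unfolding real_analytic_on_def
proof
  fix y0 assume y0: "y0 \<in> {-1..1} - Sing f c"
  define p where "p = hinv y0"
  have p: "p \<in> {-1..1}" "h p = y0" using hinv_mem[of y0] h_hinv[of y0] y0 by (auto simp: p_def)
  have p0: "p \<noteq> 0" "T p \<noteq> 0" using h_mem_Sing_iff[OF p(1)] p(2) y0 by auto
  define s where "s = sgn p"
  define A where "A w = of_real lam * (1 - of_real s * w) - (1::complex)" for w
  have s: "s = 1 \<or> s = -1" using p0 by (auto simp: s_def sgn_if)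
  have AT: "A (of_real q) = of_real (T q)" if "\<bar>q - p\<bar> < \<bar>p\<bar>" for q
  proof -
    have "s * q = \<bar>q\<bar>" using that by (auto simp: s_def sgn_if abs_if split: if_splits)
    then show ?thesis unfolding A_def tent_def by (metis of_real_1 of_real_diff of_real_mult)
  qed
  obtain r H where H: "r > 0" "H holomorphic_on ball (complex_of_real (T p)) r"
    "\<And>y. y \<in> {-1..1} \<Longrightarrow> \<bar>y - T p\<bar> < r \<Longrightarrow> y \<noteq> 0 \<and> H (complex_of_real y) = complex_of_real (h y)"
    using holomorphic_extension_h[OF T_mem[OF p(1)] p0(2)] by blast
  define e where "e = min \<bar>p\<bar> (r / lam)"
  have e: "e > 0" using p0 H(1) lam_gt_1 by (simp add: e_def)
  obtain t G where G: "t > 0" "G holomorphic_on ball (complex_of_real (h p)) t"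
    "G ` ball (complex_of_real (h p)) t \<subseteq> ball (of_real p) e"
    "\<And>y. y \<in> {-1..1} \<Longrightarrow> \<bar>y - h p\<bar> < t \<Longrightarrow> G (complex_of_real y) = complex_of_real (hinv y)"
    using holomorphic_extension_hinv[OF p(1) p0(1) e] by blast
  have A_ball: "A w \<in> ball (of_real (T p)) r" if "w \<in> ball (of_real p) e" for w
  proof -
    have "A w - of_real (T p) = A w - A (of_real p)" using AT[of p] p0 by simp
    also have "\<dots> = of_real (- lam * s) * (w - of_real p)" by (simp add: A_def algebra_simps)
    finally have "norm (A w - of_real (T p)) = lam * norm (w - of_real p)"
      using s lam_gt_1 by (auto simp: norm_mult)
    also have "\<dots> < r"
      using that lam_gt_1 by (simp add: e_def dist_norm norm_minus_commute field_simps)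
    finally show ?thesis by (simp add: dist_norm norm_minus_commute)
  qed
  show "\<exists>r>0. \<exists>a. \<forall>y\<in>{-1..1} - Sing f c. \<bar>y - y0\<bar> < r \<longrightarrow> (\<lambda>n. a n * (y - y0) ^ n) sums f y"
  proof (rule power_series_of_holomorphic_extension[OF G(1), of "\<lambda>w. H (A (G w))"])
    have "(\<lambda>w. A (G w)) holomorphic_on ball (complex_of_real y0) t"
      unfolding A_def using G(2) p(2) by (intro holomorphic_intros) simp
    then have "(H \<circ> (\<lambda>w. A (G w))) holomorphic_on ball (complex_of_real y0) t"
      by (rule holomorphic_on_compose_gen[OF _ H(2)]) (use G(3) A_ball p(2) in blast)
    then show "(\<lambda>w. H (A (G w))) holomorphic_on ball (complex_of_real y0) t" by (simp add: o_def)
    fix y assume y: "y \<in> {-1..1} - Sing f c" "\<bar>y - y0\<bar> < t"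
    then have Gy: "G (of_real y) = of_real (hinv y)" using G(4)[of y] p(2) by simp
    have "complex_of_real y \<in> ball (complex_of_real (h p)) t"
      using y(2) p(2) by (simp add: dist_of_real dist_real_def abs_minus_commute)
    then have Ge: "G (of_real y) \<in> ball (of_real p) e" using G(3) by blast
    then have "\<bar>hinv y - p\<bar> < \<bar>p\<bar>"
      by (simp add: Gy e_def dist_of_real dist_real_def abs_minus_commute)
    then have AG: "A (G (of_real y)) = of_real (T (hinv y))" using AT Gy by simp
    have "\<bar>T (hinv y) - T p\<bar> < r"
      using A_ball[OF Ge] unfolding AG by (simp add: dist_of_real dist_real_def abs_minus_commute)
    then have "H (of_real (T (hinv y))) = of_real (h (T (hinv y)))"
      using H(3)[OF T_mem[OF hinv_mem[of y]]] y(1) by simp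
    then show "H (A (G (complex_of_real y))) = complex_of_real (f y)" by (simp add: AG f_def)
  qed
qed

end

section \<open>Lorenz-like singularity, pointwise exponents and recurrence\<close>

lemma frequently_apart_not_convergent:
  fixes X :: "nat \<Rightarrow> ereal"
  assumes "a < b" "\<And>N. \<exists>n\<ge>N. X n \<le> a" "\<And>N. \<exists>n\<ge>N. X n \<ge> b"
  shows "\<not> X \<longlonglongrightarrow> l"
proof
  assume lim: "X \<longlonglongrightarrow> l"
  show False
  proof (cases "l < b")
    case True
    then obtain N where "\<And>n. n \<ge> N \<Longrightarrow> X n < b"
      using order_tendstoD(2)[OF lim] unfolding eventually_sequentially by blast
    then show False using assms(3)[of N] by (meson not_less)
  next
    case False
    then have "a < l" using assms(1) by simp
    then obtain N where "\<And>n. n \<ge> N \<Longrightarrow> X n > a"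
      using order_tendstoD(1)[OF lim] unfolding eventually_sequentially by blast
    then show False using assms(2)[of N] by (meson not_less)
  qed
qed

context conjugate_map begin

text \<open>
  A distance from \<open>0\<close> that separates the critical value \<open>T(0) = lam - 1\<close> from the turning point.
\<close>

definition half_crit_value where "half_crit_value = (lam - 1) / 2"

lemma half_crit_value_pos: "half_crit_value > 0" using lam_gt_1 by (simp add: half_crit_value_def)

lemma T_away_near_0: "\<bar>x\<bar> < half_crit_value / lam \<Longrightarrow> \<bar>T x\<bar> \<ge> half_crit_value"
proof -
  assume "\<bar>x\<bar> < half_crit_value / lam"
  then have "lam * \<bar>x\<bar> < half_crit_value" using lam_gt_1 by (simp add: field_simps)
  moreover have "T x = 2 * half_crit_value - lam * \<bar>x\<bar>" by (simp add: tent_def half_crit_value_def algebra_simps)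
  ultimately show ?thesis by linarith
qed

lemma away_of_T_near_0: "\<bar>T x\<bar> < half_crit_value \<Longrightarrow> \<bar>x\<bar> \<ge> half_crit_value / lam"
  using T_away_near_0[of x] by linarith

lemma ln_deriv_f:
  assumes "p \<in> {-1..1}" "p \<noteq> 0" "T p \<noteq> 0"
  shows "ln \<bar>deriv_I f (h p)\<bar> = ln \<bar>dh (T p)\<bar> + ln lam - ln \<bar>dh p\<bar>" "deriv_I f (h p) \<noteq> 0"
proof -
  have 1: "\<bar>dh (T p)\<bar> > 0" "\<bar>dh p\<bar> > 0"
    using dh_eq_0_iff[OF T_mem[OF assms(1)]] dh_eq_0_iff[OF assms(1)] assms by simp_all
  show "ln \<bar>deriv_I f (h p)\<bar> = ln \<bar>dh (T p)\<bar> + ln lam - ln \<bar>dh p\<bar>"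
    unfolding f_deriv(2)[OF assms(1,2)] using 1 lam_gt_1 by (simp add: ln_div ln_mult)
  have "\<bar>deriv_I f (h p)\<bar> > 0"
    unfolding f_deriv(2)[OF assms(1,2)] using 1 lam_gt_1 by simp
  then show "deriv_I f (h p) \<noteq> 0" by simp
qed

text \<open>
  In \<open>\<bar>f'(h p)\<bar> = lam \<bar>h'(T p)\<bar> / \<bar>h'(p)\<bar>\<close> the numerator is bounded above and below, as \<open>T p\<close> is close to
  the critical value; the denominator and \<open>\<bar>h p - c\<bar>\<close> follow power laws in \<open>\<bar>p\<bar>\<close>.
\<close>

lemma lorenz_side:
  assumes \<sigma>: "\<sigma> = 1 \<or> \<sigma> = -1"
  shows "\<exists>l\<in>{0<..<1}. \<exists>L>0. \<exists>\<delta>>0. \<forall>t. 0 < t \<longrightarrow> t < \<delta> \<longrightarrow>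
    f differentiable (at (h (\<sigma> * t)) within {-1..1}) \<and>
    1 / (L * \<bar>h (\<sigma> * t) - c\<bar> powr l) \<le> \<bar>deriv_I f (h (\<sigma> * t))\<bar> \<and>
    \<bar>deriv_I f (h (\<sigma> * t))\<bar> \<le> L / \<bar>h (\<sigma> * t) - c\<bar> powr l"
proof -
  obtain a M \<delta> where law: "power_law \<sigma> a M \<delta>" using power_law_exists[OF \<sigma>] by blast
  note a = power_law_pos(1)[OF law] and \<delta> = power_law_pos(3,4)[OF law]
  obtain N where N: "\<And>x. x \<in> {-1..1} \<Longrightarrow> \<bar>x\<bar> \<ge> half_crit_value \<Longrightarrow> \<bar>ln \<bar>dh x\<bar>\<bar> \<le> N"
    using abs_ln_dh_bounded_away[OF half_crit_value_pos] by blast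
  define A1 A2 where "A1 = exp (- N - M) * lam" and "A2 = exp (N + M) * lam"
  define m1 m2 where "m1 = exp (- M) / (a + 1)" and "m2 = exp M / (a + 1)"
  define l where "l = a / (a + 1)"
  \<comment> \<open>the constant required by \<open>reciprocal_power_comparison\<close>\<close>
  define L where "L = 1 / (A1 * m1 powr l) + A2 * m2 powr l"
  have pos: "A1 > 0" "A2 > 0" "m1 > 0" "m2 > 0"
    using a lam_gt_1 by (auto simp: A1_def A2_def m1_def m2_def)
  have "f differentiable (at (h (\<sigma> * t)) within {-1..1}) \<and>
    1 / (L * \<bar>h (\<sigma> * t) - c\<bar> powr l) \<le> \<bar>deriv_I f (h (\<sigma> * t))\<bar> \<and>
    \<bar>deriv_I f (h (\<sigma> * t))\<bar> \<le> L / \<bar>h (\<sigma> * t) - c\<bar> powr l"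
    if t: "0 < t" "t < min \<delta> (half_crit_value / lam)" for t
  proof -
    have t\<delta>: "t < \<delta>" using t by simp
    define p where "p = \<sigma> * t"
    have ap: "\<bar>p\<bar> = t" using \<sigma> t by (auto simp: p_def)
    have p: "p \<in> {-1..1}" "p \<noteq> 0" using ap t \<delta> by auto
    have "\<bar>T p\<bar> \<ge> half_crit_value" using T_away_near_0[of p] ap t by simp
    then have "\<bar>ln \<bar>dh (T p)\<bar>\<bar> \<le> N" and "T p \<noteq> 0" using N[OF T_mem[OF p(1)]] half_crit_value_pos by auto
    moreover have "\<bar>dh (T p)\<bar> > 0" using dh_eq_0_iff[OF T_mem[OF p(1)]] \<open>T p \<noteq> 0\<close> by simp
    ultimately have hT: "exp (- N) * 1 \<le> \<bar>dh (T p)\<bar>" "\<bar>dh (T p)\<bar> \<le> exp N * 1"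
      using exp_bounds_of_abs_ln[of "\<bar>dh (T p)\<bar>" 1 N] by simp_all
    have hp: "exp (- M) * t powr a \<le> \<bar>dh p\<bar>" "\<bar>dh p\<bar> \<le> exp M * t powr a"
      using power_lawD[OF law t(1) t\<delta>] by (simp_all add: p_def)
    have tp: "t powr a > 0" using t by simp
    have hp0: "\<bar>dh p\<bar> > 0" using hp(1) tp by (smt (verit) exp_gt_zero mult_pos_pos)
    have d: "\<bar>deriv_I f (h p)\<bar> = lam * \<bar>dh (T p)\<bar> / \<bar>dh p\<bar>" by (rule f_deriv(2)[OF p])
    have "A1 / t powr a = (lam * exp (- N)) / (exp M * t powr a)"
      by (simp add: A1_def exp_diff exp_minus field_simps)
    also have "\<dots> \<le> lam * \<bar>dh (T p)\<bar> / \<bar>dh p\<bar>"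
      using hT(1) hp(2) hp0 lam_gt_1 by (intro frac_le) auto
    finally have d1: "A1 / t powr a \<le> \<bar>deriv_I f (h p)\<bar>" by (simp only: d)
    have "lam * \<bar>dh (T p)\<bar> / \<bar>dh p\<bar> \<le> (lam * exp N) / (exp (- M) * t powr a)"
      using hT(2) hp(1) tp lam_gt_1 by (intro frac_le) auto
    also have "\<dots> = A2 / t powr a" by (simp add: A2_def exp_add exp_minus field_simps)
    finally have d2: "\<bar>deriv_I f (h p)\<bar> \<le> A2 / t powr a" by (simp only: d)
    have u: "m1 * t powr (a + 1) \<le> \<bar>h p - c\<bar>" "\<bar>h p - c\<bar> \<le> m2 * t powr (a + 1)"
      unfolding m1_def m2_def p_def by (rule h_gap_power_law[OF \<sigma> law t(1) t\<delta>])+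
    show ?thesis
      using reciprocal_power_comparison[OF l_def L_def a t(1) pos u d1 d2] f_deriv(1)[OF p]
      by (simp only: p_def simp_thms)
  qed
  moreover have "l \<in> {0<..<1}" using a by (simp add: l_def)
  moreover have "1 / (A1 * m1 powr l) > 0" "A2 * m2 powr l > 0" using pos by auto
  then have "L > 0" unfolding L_def by (rule add_pos_pos)
  moreover have "min \<delta> (half_crit_value / lam) > 0" using \<delta> half_crit_value_pos lam_gt_1 by simp
  ultimately show ?thesis by blast
qed

text \<open>
  If \<open>h\<close> reverses orientation, the right-hand side of \<open>c\<close> corresponds to the left-hand side of \<open>0\<close>; this is what
  the two signs keep track of.
\<close>

lemma f_lorenz_like: "lorenz_like f c"
proof -
  have side: "\<exists>l\<in>{0<..<1}. \<exists>L>0. \<exists>\<delta>>0. \<forall>y. \<tau> * (y - c) > 0 \<longrightarrow> \<bar>y - c\<bar> < \<delta> \<longrightarrow>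
      f differentiable (at y within {-1..1}) \<and>
      1 / (L * \<bar>y - c\<bar> powr l) \<le> \<bar>deriv_I f y\<bar> \<and> \<bar>deriv_I f y\<bar> \<le> L / \<bar>y - c\<bar> powr l"
    if \<tau>: "\<tau> = 1 \<or> \<tau> = -1" for \<tau> :: real
  proof -
    define \<sigma> where "\<sigma> = (if strict_mono_on {-1..1} h then \<tau> else - \<tau>)"
    have \<sigma>: "\<sigma> = 1 \<or> \<sigma> = -1" using \<tau> by (auto simp: \<sigma>_def)
    obtain l L \<delta> where l: "l \<in> {0<..<1}" "L > 0" "\<delta> > 0"
      and b: "\<And>t. 0 < t \<Longrightarrow> t < \<delta> \<Longrightarrow>
        f differentiable (at (h (\<sigma> * t)) within {-1..1}) \<and>
        1 / (L * \<bar>h (\<sigma> * t) - c\<bar> powr l) \<le> \<bar>deriv_I f (h (\<sigma> * t))\<bar> \<and>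
        \<bar>deriv_I f (h (\<sigma> * t))\<bar> \<le> L / \<bar>h (\<sigma> * t) - c\<bar> powr l"
      using lorenz_side[OF \<sigma>] by blast
    obtain \<epsilon> where e: "\<epsilon> > 0" "\<And>y. \<bar>y - c\<bar> < \<epsilon> \<Longrightarrow> y \<in> {-1..1} \<and> \<bar>hinv y\<bar> < \<delta>"
      using near_c[OF l(3)] by blast
    have "f differentiable (at y within {-1..1}) \<and>
      1 / (L * \<bar>y - c\<bar> powr l) \<le> \<bar>deriv_I f y\<bar> \<and> \<bar>deriv_I f y\<bar> \<le> L / \<bar>y - c\<bar> powr l"
      if y: "\<tau> * (y - c) > 0" "\<bar>y - c\<bar> < \<epsilon>" for y
    proof -
      define p where "p = hinv y"
      have yI: "y \<in> {-1..1}" and pd: "\<bar>p\<bar> < \<delta>" using e(2)[OF y(2)] by (auto simp: p_def)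
      have p: "p \<in> {-1..1}" "h p = y" using hinv_mem[OF yI] h_hinv[OF yI] by (auto simp: p_def)
      have z: "(0::real) \<in> {-1..1}" by simp
      have "\<sigma> * p > 0"
      proof (cases "strict_mono_on {-1..1} h")
        case True
        have "c < y \<longleftrightarrow> 0 < p" "y < c \<longleftrightarrow> p < 0"
          using h_less_iff_mono[OF True z p(1)] h_less_iff_mono[OF True p(1) z]
          by (simp_all only: p(2) c_def)
        moreover have "\<sigma> = \<tau>" using True by (simp add: \<sigma>_def)
        ultimately show ?thesis using y(1) \<tau> by auto
      next
        case False
        then have anti: "strict_antimono_on {-1..1} h" using h_monotone by simp
        have "c < y \<longleftrightarrow> p < 0" "y < c \<longleftrightarrow> 0 < p"
          using h_less_iff_antimono[OF anti z p(1)] h_less_iff_antimono[OF anti p(1) z]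
          by (simp_all only: p(2) c_def)
        moreover have "\<sigma> = - \<tau>" using False by (simp add: \<sigma>_def)
        ultimately show ?thesis using y(1) \<tau> by auto
      qed
      moreover from this have "\<sigma> * p = \<bar>p\<bar>" using \<sigma> by auto
      moreover from this have "\<sigma> * (\<sigma> * p) = p" using \<sigma> by auto
      ultimately show ?thesis using b[of "\<sigma> * p"] pd p(2) by simp
    qed
    then show ?thesis using l(1,2) e(1) by blast
  qed
  obtain lp Lp dp where rt: "lp \<in> {0<..<1}" "Lp > 0" "dp > 0"
    "\<And>y. 1 * (y - c) > 0 \<Longrightarrow> \<bar>y - c\<bar> < dp \<Longrightarrow> f differentiable (at y within {-1..1}) \<and>
      1 / (Lp * \<bar>y - c\<bar> powr lp) \<le> \<bar>deriv_I f y\<bar> \<and> \<bar>deriv_I f y\<bar> \<le> Lp / \<bar>y - c\<bar> powr lp"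
    using side[of 1] by blast
  obtain lm Lm dm where lt: "lm \<in> {0<..<1}" "Lm > 0" "dm > 0"
    "\<And>y. (-1) * (y - c) > 0 \<Longrightarrow> \<bar>y - c\<bar> < dm \<Longrightarrow> f differentiable (at y within {-1..1}) \<and>
      1 / (Lm * \<bar>y - c\<bar> powr lm) \<le> \<bar>deriv_I f y\<bar> \<and> \<bar>deriv_I f y\<bar> \<le> Lm / \<bar>y - c\<bar> powr lm"
    using side[of "-1"] by blast
  have weaken: "1 / (max Lp Lm * u) \<le> d \<and> d \<le> max Lp Lm / u"
    if "1 / (K * u) \<le> d" "d \<le> K / u" "K = Lp \<or> K = Lm" "u > 0" for K u d :: real
  proof
    have K: "K \<le> max Lp Lm" "K > 0" using that(3) rt(2) lt(2) by auto
    have "1 / (max Lp Lm * u) \<le> 1 / (K * u)"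
      using K that(4) by (intro divide_left_mono mult_right_mono) auto
    then show "1 / (max Lp Lm * u) \<le> d" using that(1) by simp
    have "K / u \<le> max Lp Lm / u" using K that(4) by (intro divide_right_mono) auto
    then show "d \<le> max Lp Lm / u" using that(2) by simp
  qed
  show ?thesis unfolding lorenz_like_def
  proof (rule bexI[OF _ rt(1)], rule bexI[OF _ lt(1)], rule exI[of _ "max Lp Lm"], rule conjI[rotated],
      rule exI[of _ "min dp dm"], intro conjI ballI)
    show "max Lp Lm > 0" "min dp dm > 0" using rt(2,3) lt(3) by auto
  next
    fix x assume x: "x \<in> {c<..<c + min dp dm}"
    then have r: "f differentiable (at x within {-1..1}) \<and>
      1 / (Lp * \<bar>x - c\<bar> powr lp) \<le> \<bar>deriv_I f x\<bar> \<and> \<bar>deriv_I f x\<bar> \<le> Lp / \<bar>x - c\<bar> powr lp"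
      by (intro rt(4)) auto
    have "\<bar>x - c\<bar> powr lp > 0" using x by simp
    with weaken[of Lp "\<bar>x - c\<bar> powr lp" "\<bar>deriv_I f x\<bar>"] r
    show "f differentiable (at x within {-1..1})"
      "1 / (max Lp Lm * \<bar>x - c\<bar> powr lp) \<le> \<bar>deriv_I f x\<bar>"
      "\<bar>deriv_I f x\<bar> \<le> max Lp Lm / \<bar>x - c\<bar> powr lp" by simp_all
  next
    fix x assume x: "x \<in> {c - min dp dm<..<c}"
    then have r: "f differentiable (at x within {-1..1}) \<and>
      1 / (Lm * \<bar>x - c\<bar> powr lm) \<le> \<bar>deriv_I f x\<bar> \<and> \<bar>deriv_I f x\<bar> \<le> Lm / \<bar>x - c\<bar> powr lm"
      by (intro lt(4)) auto
    have "\<bar>x - c\<bar> powr lm > 0" using x by simp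
    with weaken[of Lm "\<bar>x - c\<bar> powr lm" "\<bar>deriv_I f x\<bar>"] r
    show "f differentiable (at x within {-1..1})"
      "1 / (max Lp Lm * \<bar>x - c\<bar> powr lm) \<le> \<bar>deriv_I f x\<bar>"
      "\<bar>deriv_I f x\<bar> \<le> max Lp Lm / \<bar>x - c\<bar> powr lm" by simp_all
  qed
qed

lemma closure_orbit_f:
  assumes "x \<in> closure (forward_orbit f c)"
  obtains p where "p \<in> attractor" "p \<in> {-1..1}" "x = h p"
proof -
  have sub: "attractor \<subseteq> {-1..1}"
  proof (rule closure_minimal)
    show "forward_orbit T 0 \<subseteq> {-1..1}"
      unfolding forward_orbit_def using T_iter_mem[of 0] by auto
  qed simp
  have "compact attractor"
    using sub bounded_subset[OF _ sub] by (simp add: compact_eq_bounded_closed)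
  then have "closed (h ` attractor)"
    by (intro compact_imp_closed compact_continuous_image continuous_on_subset[OF cont_h sub])
  moreover have "forward_orbit f c \<subseteq> h ` attractor"
  proof
    fix y assume "y \<in> forward_orbit f c"
    then obtain n where "y = (f ^^ n) (h 0)" by (auto simp: forward_orbit_def c_def)
    then have "y = h ((T ^^ n) 0)" using f_iter_h[of 0 n] by simp
    moreover have "(T ^^ n) 0 \<in> attractor"
      by (rule subsetD[OF closure_subset]) (auto simp: forward_orbit_def)
    ultimately show "y \<in> h ` attractor" by (rule image_eqI)
  qed
  ultimately have "closure (forward_orbit f c) \<subseteq> h ` attractor" by (rule closure_minimal[rotated])
  then obtain p where "p \<in> attractor" "x = h p" using assms by auto
  then show ?thesis using that[of p] sub by auto
qed

lemma orbit_meets_Sing_iff: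
  assumes p: "p \<in> {-1..1}"
  shows "forward_orbit f (h p) \<inter> Sing f c = {} \<longleftrightarrow> (\<forall>n. (T ^^ n) p \<noteq> 0)"
proof -
  have iff: "(f ^^ n) (h p) \<in> Sing f c \<longleftrightarrow> (T ^^ n) p = 0 \<or> (T ^^ Suc n) p = 0" for n
    using h_mem_Sing_iff[OF T_iter_mem[OF p, of n]] f_iter_h[OF p, of n] by simp
  have "forward_orbit f (h p) \<inter> Sing f c = {} \<longleftrightarrow> (\<forall>n. (f ^^ n) (h p) \<notin> Sing f c)"
    by (auto simp: forward_orbit_def)
  also have "\<dots> \<longleftrightarrow> (\<forall>n. (T ^^ n) p \<noteq> 0)" unfolding iff by blast
  finally show ?thesis .
qed

text \<open>
  Since \<open>T\<^sup>n p \<noteq> 0\<close>, the inverse of \<open>h\<close> is differentiable at \<open>h(T\<^sup>n p)\<close>, so \<open>T\<^sup>n = hinv \<circ> f\<^sup>n \<circ> h\<close> would inherit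
  differentiability at \<open>p\<close> from \<open>f\<^sup>n\<close>. Only \<open>h\<close> and not its inverse has to be differentiable at \<open>p\<close>, so \<open>p = 0\<close>
  is covered.
\<close>

lemma iterates_not_differentiable_after_hit:
  assumes p: "p \<in> {-1..1}" and hit: "(T ^^ m) p = 0" "m < n"
  shows "\<not> (f ^^ n) differentiable (at (h p) within {-1..1})"
proof
  assume "(f ^^ n) differentiable (at (h p) within {-1..1})"
  then obtain D where D: "((f ^^ n) has_real_derivative D) (at (h p) within {-1..1})"
    by (rule real_differentiableE)
  have nz: "(T ^^ n) p \<noteq> 0" by (rule T_iter_after_hit[OF hit])
  have hI: "h ` {-1..1} \<subseteq> {-1..1}" using h_mem by blast
  from has_real_derivative_within_compose[OF h_deriv[OF p] D hI]
  have 1: "((\<lambda>q. (f ^^ n) (h q)) has_real_derivative D * dh p) (at p within {-1..1})" .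
  have "(hinv has_real_derivative 1 / dh ((T ^^ n) p)) (at ((f ^^ n) (h p)) within {-1..1})"
    using hinv_deriv[OF T_iter_mem[OF p] nz] by (simp only: f_iter_h[OF p])
  moreover have "(\<lambda>q. (f ^^ n) (h q)) ` {-1..1} \<subseteq> {-1..1}"
  proof (rule image_subsetI)
    fix q :: real assume q: "q \<in> {-1..1}"
    show "(f ^^ n) (h q) \<in> {-1..1}" unfolding f_iter_h[OF q] by (rule h_mem[OF T_iter_mem[OF q]])
  qed
  ultimately have "((\<lambda>q. hinv ((f ^^ n) (h q))) has_real_derivative 1 / dh ((T ^^ n) p) * (D * dh p)) (at p within {-1..1})"
    by (rule has_real_derivative_within_compose[OF 1])
  then have "((T ^^ n) has_real_derivative 1 / dh ((T ^^ n) p) * (D * dh p)) (at p within {-1..1})"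
    by (rule has_field_derivative_transform_within[OF _ zero_less_one p])
      (simp only: f_iter_h hinv_h[OF T_iter_mem])
  then have "(T ^^ n) differentiable (at p within {-1..1})"
    unfolding real_differentiable_def by (rule exI)
  then show False using T_iter_not_differentiable[OF p hit] by simp
qed

lemma iterate_log_deriv:
  assumes p: "p \<in> {-1..1}" and nz: "\<And>n. (T ^^ n) p \<noteq> 0"
  shows "log_deriv_defined (f ^^ n) (h p)"
    and "ln \<bar>deriv_I (f ^^ n) (h p)\<bar> = real n * ln lam + ln \<bar>dh ((T ^^ n) p)\<bar> - ln \<bar>dh p\<bar>"
proof -
  have p0: "p \<noteq> 0" using nz[of 0] by simp
  obtain D where D: "\<bar>D\<bar> = lam ^ n * \<bar>dh ((T ^^ n) p)\<bar> / \<bar>dh p\<bar>"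
      "((f ^^ n) has_real_derivative D) (at (h p) within {-1..1})"
    using f_iter_deriv[OF p p0 nz] by blast
  have pos: "\<bar>dh p\<bar> > 0" "\<bar>dh ((T ^^ n) p)\<bar> > 0"
    using dh_eq_0_iff[OF p] dh_eq_0_iff[OF T_iter_mem[OF p, of n]] p0 nz[of n] by simp_all
  have eq: "deriv_I (f ^^ n) (h p) = D" by (rule deriv_I_eq[OF D(2) h_mem[OF p]])
  have "\<bar>D\<bar> > 0" unfolding D(1) using pos lam_gt_1 by simp
  moreover have "(f ^^ n) differentiable (at (h p) within {-1..1})"
    using D(2) unfolding real_differentiable_def by (rule exI)
  ultimately show "log_deriv_defined (f ^^ n) (h p)" by (simp add: log_deriv_defined_def eq)
  show "ln \<bar>deriv_I (f ^^ n) (h p)\<bar> = real n * ln lam + ln \<bar>dh ((T ^^ n) p)\<bar> - ln \<bar>dh p\<bar>"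
    unfolding eq D(1) using pos lam_gt_1 by (simp add: ln_div ln_mult ln_realpow)
qed

text \<open>
  At a close return \<open>n\<close> the average is below \<open>ln lam\<close> by at least \<open>w\<close>, up to a vanishing error; at time \<open>n + 1\<close> the orbit is near the critical value and the average is back near \<open>ln lam\<close>.
\<close>

lemma pointwise_exponent_not_convergent:
  assumes p: "p \<in> attractor" "p \<in> {-1..1}" and nz: "\<And>n. (T ^^ n) p \<noteq> 0"
  shows "\<not> (\<lambda>n. ereal (ln \<bar>deriv_I (f ^^ n) (h p)\<bar> / real n)) \<longlonglongrightarrow> l"
proof -
  obtain a M \<delta> where a: "a > 0" "0 < \<delta>"
    and near: "\<And>x. 0 < \<bar>x\<bar> \<Longrightarrow> \<bar>x\<bar> < \<delta> \<Longrightarrow> ln \<bar>dh x\<bar> \<le> M + a * ln \<bar>x\<bar>"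
    using ln_dh_le by metis
  obtain N where N: "\<And>x. x \<in> {-1..1} \<Longrightarrow> \<bar>x\<bar> \<ge> half_crit_value \<Longrightarrow> \<bar>ln \<bar>dh x\<bar>\<bar> \<le> N"
    using abs_ln_dh_bounded_away[OF half_crit_value_pos] by blast
  define \<delta>' where "\<delta>' = min \<delta> (half_crit_value / lam)"
  have \<delta>': "\<delta>' > 0" using a(2) half_crit_value_pos lam_gt_1 by (simp add: \<delta>'_def)
  define w where "w = a * ln lam / 4"
  have w: "w > 0" using a(1) lam_gt_1 by (simp add: w_def)
  define X where "X n = ln \<bar>deriv_I (f ^^ n) (h p)\<bar> / real n" for n
  \<comment> \<open>collects the terms that stay bounded; they are negligible against \<open>n w\<close>\<close>
  define K where "K = \<bar>M\<bar> + a * ln 22 + \<bar>ln \<bar>dh p\<bar>\<bar> + \<bar>N\<bar>"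
  have X: "X n * real n = real n * ln lam + ln \<bar>dh ((T ^^ n) p)\<bar> - ln \<bar>dh p\<bar>" if "n > 0" for n
    using iterate_log_deriv(2)[OF p(2) nz, of n] that by (simp add: X_def)
  have close: "\<exists>n\<ge>m. n > 0 \<and> real n * w / 3 \<ge> K \<and> \<bar>(T ^^ n) p\<bar> < \<delta>' \<and>
      - ln \<bar>(T ^^ n) p\<bar> \<ge> real n * ln lam / 4 - ln 22" for m
  proof -
    obtain k where k: "real k * (w / 3) > K" using reals_Archimedean3[of "w / 3"] w by auto
    obtain n where n: "n \<ge> max (Suc m) k" "\<bar>(T ^^ n) p\<bar> < \<delta>'"
        "- ln \<bar>(T ^^ n) p\<bar> \<ge> real n * ln lam / 4 - ln 22"
      using attractor_close_return[OF p(1) nz \<delta>', of "max (Suc m) k"] by blast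
    have "real k * (w / 3) \<le> real n * (w / 3)" using n(1) w by (intro mult_right_mono) auto
    then show ?thesis using k n by (intro exI[of _ n]) auto
  qed
  have low: "\<exists>n\<ge>m. X n \<le> ln lam - 2 / 3 * w" for m
  proof -
    obtain n where n: "n \<ge> m" "n > 0" "real n * w / 3 \<ge> K" "\<bar>(T ^^ n) p\<bar> < \<delta>'"
        "- ln \<bar>(T ^^ n) p\<bar> \<ge> real n * ln lam / 4 - ln 22"
      using close[of m] by blast
    have "ln \<bar>dh ((T ^^ n) p)\<bar> \<le> M + a * ln \<bar>(T ^^ n) p\<bar>"
      using near[of "(T ^^ n) p"] nz[of n] n(4) by (simp add: \<delta>'_def)
    moreover have "a * ln \<bar>(T ^^ n) p\<bar> \<le> a * (ln 22 - real n * ln lam / 4)"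
      using n(5) a(1) by (intro mult_left_mono) auto
    moreover have "a * (ln 22 - real n * ln lam / 4) = a * ln 22 - real n * w"
      by (simp add: w_def algebra_simps)
    ultimately have "X n * real n \<le> real n * ln lam - real n * w + K"
      unfolding X[OF n(2)] K_def by linarith
    also have "\<dots> \<le> (ln lam - 2 / 3 * w) * real n" using n(3) by (simp add: algebra_simps)
    finally have "X n \<le> ln lam - 2 / 3 * w" using n(2) by simp
    then show ?thesis using n(1) by blast
  qed
  have high: "\<exists>n\<ge>m. X n \<ge> ln lam - 1 / 3 * w" for m
  proof -
    obtain n where n: "n \<ge> m" "n > 0" "real n * w / 3 \<ge> K" "\<bar>(T ^^ n) p\<bar> < \<delta>'"
      using close[of m] by blast
    have "\<bar>(T ^^ Suc n) p\<bar> \<ge> half_crit_value" using T_away_near_0[of "(T ^^ n) p"] n(4) by (simp add: \<delta>'_def)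
    then have "\<bar>ln \<bar>dh ((T ^^ Suc n) p)\<bar>\<bar> \<le> N" by (rule N[OF T_iter_mem[OF p(2)]])
    moreover have "a * ln 22 \<ge> 0" using a(1) by simp
    ultimately have "X (Suc n) * real (Suc n) \<ge> real (Suc n) * ln lam - K"
      unfolding X[OF zero_less_Suc] K_def by linarith
    moreover have "real n * w / 3 \<le> real (Suc n) * w / 3"
      using w by (intro divide_right_mono mult_right_mono) auto
    moreover have "(ln lam - 1 / 3 * w) * r = r * ln lam - r * w / 3" for r by (simp add: algebra_simps)
    ultimately have "(ln lam - 1 / 3 * w) * real (Suc n) \<le> X (Suc n) * real (Suc n)"
      using n(3) by (metis diff_left_mono order.trans)
    then have "ln lam - 1 / 3 * w \<le> X (Suc n)" by (rule mult_right_le_imp_le) simp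
    then show ?thesis using n(1) by (intro exI[of _ "Suc n"]) auto
  qed
  have "\<not> (\<lambda>n. ereal (X n)) \<longlonglongrightarrow> l"
    by (rule frequently_apart_not_convergent[of "ereal (ln lam - 2 / 3 * w)" "ereal (ln lam - 1 / 3 * w)"])
      (use w low high in auto)
  then show ?thesis unfolding X_def .
qed

text \<open>
  The upper bound holds at all times by \<open>neg_ln_crit_orbit_le\<close>; the Fibonacci times give the lower bound.
\<close>

lemma critical_recurrence_exponent:
  "limsup (\<lambda>n. - elog \<bar>(f ^^ n) c - c\<bar> / ereal (real n)) \<in> {0<..<\<infinity>}"
proof -
  define X where "X n = - elog \<bar>(f ^^ n) c - c\<bar> / ereal (real n)" for n
  define r where "r n = - ln \<bar>h (crit_orbit n) - c\<bar>" for n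
  have cI: "crit_orbit n \<in> {-1..1}" for n unfolding crit_orbit_def by (rule T_iter_mem) simp
  have X: "X n = ereal (r n / real n)" if "n \<ge> 1" for n
  proof -
    have "(f ^^ n) c = h (crit_orbit n)" using f_iter_h[of 0 n] by (simp add: c_def crit_orbit_def)
    moreover have "h (crit_orbit n) \<noteq> c"
      using h_eq_iff[OF cI, of 0 n] crit_orbit_nonzero[OF that] by (simp add: c_def)
    ultimately show ?thesis using that by (simp add: X_def r_def elog_def)
  qed
  obtain b B where b: "b > 0" "B > 0"
    and gap_low: "\<And>x. x \<in> {-1..1} \<Longrightarrow> x \<noteq> 0 \<Longrightarrow> - ln \<bar>h x - c\<bar> \<le> B - b * ln \<bar>x\<bar>"
    using neg_ln_h_gap_le by metis
  define C where "C = 3 * b * ln lam + (B + b * \<bar>ln (lam - 1)\<bar>)"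
  have up: "X n \<le> ereal C" if n: "n \<ge> 1" for n
  proof -
    have "r n \<le> B - b * ln \<bar>crit_orbit n\<bar>"
      unfolding r_def by (rule gap_low[OF cI crit_orbit_nonzero[OF n]])
    also have "b * (- ln \<bar>crit_orbit n\<bar>) \<le> b * (3 * real n * ln lam - ln (lam - 1))"
      using neg_ln_crit_orbit_le[OF n] b(1) by (intro mult_left_mono) auto
    then have "B - b * ln \<bar>crit_orbit n\<bar> \<le> real n * (3 * b * ln lam) + (B + b * - ln (lam - 1))"
      by (simp add: algebra_simps)
    also have "\<dots> \<le> real n * (3 * b * ln lam) + real n * (B + b * \<bar>ln (lam - 1)\<bar>)"
    proof (rule add_left_mono)
      have "B + b * - ln (lam - 1) \<le> 1 * (B + b * \<bar>ln (lam - 1)\<bar>)"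
        using mult_left_mono[of "- ln (lam - 1)" "\<bar>ln (lam - 1)\<bar>" b] b(1) by simp
      also have "\<dots> \<le> real n * (B + b * \<bar>ln (lam - 1)\<bar>)"
        using n b by (intro mult_right_mono) auto
      finally show "B + b * - ln (lam - 1) \<le> real n * (B + b * \<bar>ln (lam - 1)\<bar>)" .
    qed
    also have "\<dots> = C * real n" by (simp add: C_def algebra_simps)
    finally have "r n / real n \<le> C" using n by (simp add: field_simps)
    then show ?thesis by (simp add: X[OF n])
  qed
  have "limsup X \<le> ereal C"
    by (rule Limsup_bounded) (use up in \<open>auto simp: eventually_sequentially\<close>)
  then have fin: "limsup X < \<infinity>" by (rule le_less_trans) simp
  obtain \<delta> where d: "\<delta> > 0" "\<And>x. \<bar>x\<bar> < \<delta> \<Longrightarrow> \<bar>h x - c\<bar> \<le> \<bar>x\<bar>" using h_gap_le by blast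
  define e where "e = ln lam / 4"
  have e: "e > 0" using lam_gt_1 by (simp add: e_def)
  have ev: "\<forall>\<^sub>F i in sequentially. return_dist (Suc i) < \<delta>"
    using LIMSEQ_Suc[OF return_dist_tendsto_0] d(1) by (rule order_tendstoD(2))
  obtain k where k: "real k * (2 * e) > ln 22" using reals_Archimedean3[of "2 * e"] e by auto
  have freq: "\<exists>n\<ge>m. X n \<ge> ereal e" for m
  proof -
    obtain i0 where i0: "\<And>i. i \<ge> i0 \<Longrightarrow> return_dist (Suc i) < \<delta>"
      using ev unfolding eventually_sequentially by blast
    define i where "i = max i0 (max m k)"
    define n where "n = fib_time (Suc i)"
    have n: "n \<ge> m" "n \<ge> 1" "real n \<le> 2 * real (fib_time i)"
    proof -
      have "m \<le> i" by (simp add: i_def)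
      then show "n \<ge> m" "n \<ge> 1" using fib_time_ge[of "Suc i"] by (auto simp only: n_def)
      show "real n \<le> 2 * real (fib_time i)" using fib_time_Suc_le[of i] by (simp only: n_def)
    qed
    have dn: "\<bar>crit_orbit n\<bar> = return_dist (Suc i)" by (simp add: return_dist_def n_def)
    have "return_dist (Suc i) < \<delta>" by (rule i0) (simp add: i_def)
    then have "\<bar>h (crit_orbit n) - c\<bar> \<le> \<bar>crit_orbit n\<bar>" using d(2)[of "crit_orbit n"] by (simp add: dn)
    moreover have "h (crit_orbit n) \<noteq> c"
      using h_eq_iff[OF cI, of 0 n] crit_orbit_nonzero[OF n(2)] by (simp add: c_def)
    ultimately have "ln \<bar>h (crit_orbit n) - c\<bar> \<le> ln \<bar>crit_orbit n\<bar>"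
      using crit_orbit_nonzero[OF n(2)] by simp
    then have "r n \<ge> - ln \<bar>crit_orbit n\<bar>" by (simp add: r_def)
    moreover have "- ln \<bar>crit_orbit n\<bar> \<ge> real (fib_time i) * ln lam - ln 22"
      by (intro neg_ln_return_dist) (simp_all add: dn return_dist_pos return_dist_nonneg)
    moreover have "real k \<le> real (fib_time i)" using fib_time_ge[of i] by (simp add: i_def)
    then have "real k * (2 * e) \<le> real (fib_time i) * (2 * e)" using e by (intro mult_right_mono) auto
    moreover have "real (fib_time i) * ln lam = real (fib_time i) * (2 * e) + real (fib_time i) * (2 * e)"
      by (simp add: e_def)
    moreover have "real n * e \<le> real (fib_time i) * (2 * e)"
      using mult_right_mono[OF n(3), of e] e by simp
    ultimately have "real n * e \<le> r n" using k by linarith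
    then have "e \<le> r n / real n" using n(2) by (simp add: field_simps)
    then show ?thesis using n X[OF n(2)] by (intro exI[of _ n]) simp
  qed
  have "limsup X \<ge> ereal e"
  proof (rule ccontr)
    assume "\<not> limsup X \<ge> ereal e"
    then have "limsup X < ereal e" by simp
    then have "\<forall>\<^sub>F n in sequentially. X n < ereal e" by (rule Limsup_lessD)
    then obtain m where "\<And>n. n \<ge> m \<Longrightarrow> X n < ereal e" unfolding eventually_sequentially by blast
    then show False using freq[of m] by (meson not_less)
  qed
  then have "limsup X > 0" using e by (meson ereal_less(2) less_le_trans)
  then show ?thesis using fin unfolding X_def by simp
qed

end

section \<open>Divergence of the integrals\<close>

locale conjugate_measure = conjugate_map + fibonacci_measure
begin

definition \<nu> where "\<nu> = distr \<mu> borel_I h"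

lemma h_measurable: "h \<in> measurable \<mu> borel_I"
proof (rule measurable_restrict_space2)
  show "h \<in> space \<mu> \<rightarrow> {-1..1}" using h_mem by (simp add: space_mu Pi_iff)
  show "h \<in> borel_measurable \<mu>"
    by (subst measurable_cong_sets[OF sets_mu refl])
      (rule borel_measurable_continuous_on_restrict[OF cont_h])
qed

lemma hinv_measurable: "hinv \<in> measurable borel_I \<mu>"
proof -
  have "hinv \<in> measurable borel_I borel_I"
  proof (rule measurable_restrict_space2)
    show "hinv \<in> space borel_I \<rightarrow> {-1..1}" using hinv_mem by (simp add: space_restrict_space Pi_iff)
  qed (rule borel_measurable_continuous_on_restrict[OF cont_hinv])
  then show ?thesis by (subst measurable_cong_sets[OF refl sets_mu])
qed

text \<open>
  The measurable minorant makes the statement meaningful for an integrand that is not known to be measurable,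
  such as the derivative of \<open>f\<close>, which has arbitrary values where it does not exist.
\<close>

lemma nn_integral_nu_infinite:
  assumes g: "g \<in> borel_measurable \<mu>" "(\<integral>\<^sup>+p. g p \<partial>\<mu>) = \<infinity>"
    and le: "\<And>p. p \<in> {-1..1} \<Longrightarrow> g p \<le> \<phi> (h p)"
  shows "(\<integral>\<^sup>+x. \<phi> x \<partial>\<nu>) = \<infinity>"
proof -
  have "(\<integral>\<^sup>+x. g (hinv x) \<partial>\<nu>) = (\<integral>\<^sup>+p. g (hinv (h p)) \<partial>\<mu>)"
    unfolding \<nu>_def
    by (rule nn_integral_distr[OF h_measurable])
      (simp add: measurable_compose[OF hinv_measurable g(1)])
  also have "\<dots> = (\<integral>\<^sup>+p. g p \<partial>\<mu>)"
    by (rule nn_integral_cong) (simp only: space_mu hinv_h)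
  finally have "\<infinity> = (\<integral>\<^sup>+x. g (hinv x) \<partial>\<nu>)" using g(2) by simp
  also have "\<dots> \<le> (\<integral>\<^sup>+x. \<phi> x \<partial>\<nu>)"
  proof (rule nn_integral_mono)
    fix x assume "x \<in> space \<nu>"
    then have x: "x \<in> {-1..1}" by (simp add: \<nu>_def space_restrict_space)
    show "g (hinv x) \<le> \<phi> x" using le[OF hinv_mem[OF x]] by (simp only: h_hinv[OF x])
  qed
  finally show ?thesis by (simp add: top.extremum_unique)
qed

lemma elog_positive_part: "t > 0 \<Longrightarrow> e2ennreal (elog t) = ennreal (ln t)"
  and elog_negative_part: "t > 0 \<Longrightarrow> e2ennreal (- elog t) = ennreal (- ln t)"
  by (simp_all add: elog_def e2ennreal_ereal)

text \<open>
  The positive part is infinite because of the pole of \<open>-ln \<bar>h'(p)\<bar>\<close> at \<open>p = 0\<close>, the negative part because of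
  the pole of \<open>ln \<bar>h'(T p)\<bar>\<close> at \<open>T p = 0\<close>. The two poles are apart, so in each case the other term is bounded.
\<close>

lemma lyapunov_integral_undefined:
  "\<not> extended_integral_exists \<nu> (\<lambda>x. elog \<bar>deriv_I f x\<bar>)"
proof -
  obtain a M \<delta> where a: "a > 0" "0 < \<delta>" "\<delta> < 1"
    and near: "\<And>x. 0 < \<bar>x\<bar> \<Longrightarrow> \<bar>x\<bar> < \<delta> \<Longrightarrow> ln \<bar>dh x\<bar> \<le> M + a * ln \<bar>x\<bar>"
    using ln_dh_le by metis
  obtain N where N: "\<And>x. x \<in> {-1..1} \<Longrightarrow> \<bar>x\<bar> \<ge> half_crit_value \<Longrightarrow> \<bar>ln \<bar>dh x\<bar>\<bar> \<le> N"
    using abs_ln_dh_bounded_away[OF half_crit_value_pos] by blast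
  have "half_crit_value / lam > 0" using half_crit_value_pos lam_gt_1 by simp
  then obtain N' where N': "\<And>x. x \<in> {-1..1} \<Longrightarrow> \<bar>x\<bar> \<ge> half_crit_value / lam \<Longrightarrow> \<bar>ln \<bar>dh x\<bar>\<bar> \<le> N'"
    using abs_ln_dh_bounded_away by blast
  have "(\<integral>\<^sup>+x. e2ennreal (elog \<bar>deriv_I f x\<bar>) \<partial>\<nu>) = \<infinity>"
  proof (rule nn_integral_nu_infinite)
    show "log_pole a (N + M - ln lam) (min \<delta> (half_crit_value / lam)) \<in> borel_measurable \<mu>"
      by (intro borel_measurable_mu log_pole_measurable)
    show "(\<integral>\<^sup>+p. log_pole a (N + M - ln lam) (min \<delta> (half_crit_value / lam)) p \<partial>\<mu>) = \<infinity>"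
      by (rule nn_integral_log_pole) (use a half_crit_value_pos lam_gt_1 in auto)
    fix p :: real assume p: "p \<in> {-1..1}"
    show "log_pole a (N + M - ln lam) (min \<delta> (half_crit_value / lam)) p \<le> e2ennreal (elog \<bar>deriv_I f (h p)\<bar>)"
    proof (cases "0 < \<bar>p\<bar> \<and> \<bar>p\<bar> < min \<delta> (half_crit_value / lam)")
      case True
      then have p0: "p \<noteq> 0" and T: "\<bar>T p\<bar> \<ge> half_crit_value" using T_away_near_0[of p] by auto
      then have T0: "T p \<noteq> 0" using half_crit_value_pos by auto
      have "- a * ln \<bar>p\<bar> - (N + M - ln lam) \<le> ln \<bar>deriv_I f (h p)\<bar>"
      proof -
        have "ln \<bar>dh p\<bar> \<le> M + a * ln \<bar>p\<bar>" using near[of p] True by simp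
        moreover have "\<bar>ln \<bar>dh (T p)\<bar>\<bar> \<le> N" by (rule N[OF T_mem[OF p] T])
        ultimately show ?thesis using ln_deriv_f(1)[OF p p0 T0] by linarith
      qed
      then show ?thesis
        using True ln_deriv_f(2)[OF p p0 T0] by (simp add: log_pole_def elog_positive_part ennreal_leI)
    qed (auto simp: log_pole_def)
  qed
  moreover have "(\<integral>\<^sup>+x. e2ennreal (- elog \<bar>deriv_I f x\<bar>) \<partial>\<nu>) = \<infinity>"
  proof (rule nn_integral_nu_infinite)
    show "(\<lambda>p. log_pole a (M + N' + ln lam) (min \<delta> half_crit_value) (T p)) \<in> borel_measurable \<mu>"
      by (rule measurable_compose[OF T_measurable]) (intro borel_measurable_mu log_pole_measurable)
    show "(\<integral>\<^sup>+p. log_pole a (M + N' + ln lam) (min \<delta> half_crit_value) (T p) \<partial>\<mu>) = \<infinity>"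
      by (rule nn_integral_log_pole_T) (use a half_crit_value_pos in auto)
    fix p :: real assume p: "p \<in> {-1..1}"
    show "log_pole a (M + N' + ln lam) (min \<delta> half_crit_value) (T p) \<le> e2ennreal (- elog \<bar>deriv_I f (h p)\<bar>)"
    proof (cases "0 < \<bar>T p\<bar> \<and> \<bar>T p\<bar> < min \<delta> half_crit_value")
      case True
      then have T0: "T p \<noteq> 0" and P: "\<bar>p\<bar> \<ge> half_crit_value / lam" using away_of_T_near_0[of p] by auto
      then have p0: "p \<noteq> 0" using \<open>half_crit_value / lam > 0\<close> by auto
      have "- a * ln \<bar>T p\<bar> - (M + N' + ln lam) \<le> - ln \<bar>deriv_I f (h p)\<bar>"
      proof -
        have "ln \<bar>dh (T p)\<bar> \<le> M + a * ln \<bar>T p\<bar>" using near[of "T p"] True by simp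
        moreover have "\<bar>ln \<bar>dh p\<bar>\<bar> \<le> N'" by (rule N'[OF p P])
        ultimately show ?thesis using ln_deriv_f(1)[OF p p0 T0] by linarith
      qed
      then show ?thesis
        using True ln_deriv_f(2)[OF p p0 T0] by (simp add: log_pole_def elog_negative_part ennreal_leI)
    qed (auto simp: log_pole_def)
  qed
  ultimately show ?thesis by (simp add: extended_integral_exists_def)
qed

text \<open>
  The distance to the singular set is at most \<open>\<bar>h p - c\<bar> \<le> \<bar>p\<bar>\<close> near \<open>0\<close>.
\<close>

lemma log_distance_not_integrable:
  "\<not> integrable \<nu> (\<lambda>x. ln (infdist x (Sing f c)))"
proof
  assume "integrable \<nu> (\<lambda>x. ln (infdist x (Sing f c)))"
  then have fin: "(\<integral>\<^sup>+x. ennreal (norm (ln (infdist x (Sing f c)))) \<partial>\<nu>) < \<infinity>"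
    by (simp add: integrable_iff_bounded)
  obtain \<delta> where d: "\<delta> > 0" "\<And>x. \<bar>x\<bar> < \<delta> \<Longrightarrow> \<bar>h x - c\<bar> \<le> \<bar>x\<bar>" using h_gap_le by blast
  define \<delta>' where "\<delta>' = min (min \<delta> 1) (half_crit_value / lam)"
  have \<delta>': "\<delta>' > 0" using d(1) half_crit_value_pos lam_gt_1 by (simp add: \<delta>'_def)
  have "(\<integral>\<^sup>+x. ennreal (norm (ln (infdist x (Sing f c)))) \<partial>\<nu>) = \<infinity>"
  proof (rule nn_integral_nu_infinite)
    show "log_pole 1 0 \<delta>' \<in> borel_measurable \<mu>" by (intro borel_measurable_mu log_pole_measurable)
    show "(\<integral>\<^sup>+p. log_pole 1 0 \<delta>' p \<partial>\<mu>) = \<infinity>" by (rule nn_integral_log_pole[OF zero_less_one \<delta>'])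
    fix p :: real assume p: "p \<in> {-1..1}"
    show "log_pole 1 0 \<delta>' p \<le> ennreal (norm (ln (infdist (h p) (Sing f c))))"
    proof (cases "0 < \<bar>p\<bar> \<and> \<bar>p\<bar> < \<delta>'")
      case True
      then have "p \<noteq> 0" "T p \<noteq> 0" using T_away_near_0[of p] half_crit_value_pos by (auto simp: \<delta>'_def)
      then have out: "h p \<notin> Sing f c" using h_mem_Sing_iff[OF p] by simp
      have cS: "c \<in> Sing f c" by (simp add: Sing_def)
      have "infdist (h p) (Sing f c) > 0"
        by (rule infdist_pos_not_in_closed[OF finite_imp_closed[OF finite_Sing] _ out]) (use cS in auto)
      moreover have "infdist (h p) (Sing f c) \<le> \<bar>p\<bar>"
        using infdist_le[OF cS, of "h p"] d(2)[of p] True by (simp add: dist_real_def \<delta>'_def)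
      ultimately have "ln (infdist (h p) (Sing f c)) \<le> ln \<bar>p\<bar>" by simp
      then have "- ln \<bar>p\<bar> \<le> norm (ln (infdist (h p) (Sing f c)))" by simp
      then show ?thesis using True by (simp add: log_pole_def ennreal_leI)
    qed (auto simp: log_pole_def)
  qed
  then show False using fin by simp
qed

lemma conjugate_dynamics:
  "(if strict_mono_on {-1..1} h then unimodal f c else reversed_unimodal f c) \<and>
     real_analytic_on f ({-1..1} - Sing f c) \<and>
     lorenz_like f c \<and>
     \<not> extended_integral_exists \<nu> (\<lambda>x. elog \<bar>deriv_I f x\<bar>) \<and>
     (\<forall>x\<in>closure (forward_orbit f c).
        (forward_orbit f x \<inter> Sing f c = {} \<longrightarrow>
           (\<forall>n. log_deriv_defined (f ^^ n) x) \<and>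
           \<not> (\<exists>l::ereal. (\<lambda>n. ereal (ln \<bar>deriv_I (f ^^ n) x\<bar> / real n)) \<longlonglongrightarrow> l)) \<and>
        (forward_orbit f x \<inter> Sing f c \<noteq> {} \<longrightarrow>
           (\<forall>\<^sub>F n in sequentially. \<not> log_deriv_defined (f ^^ n) x))) \<and>
     \<not> integrable \<nu> (\<lambda>x. ln (infdist x (Sing f c))) \<and>
     limsup (\<lambda>n. - elog \<bar>(f ^^ n) c - c\<bar> / ereal (real n)) \<in> {0<..<\<infinity>}"
proof (intro conjI f_unimodal f_analytic f_lorenz_like lyapunov_integral_undefined
    log_distance_not_integrable critical_recurrence_exponent ballI impI allI)
  fix x assume x: "x \<in> closure (forward_orbit f c)"
  obtain p where p: "p \<in> attractor" "p \<in> {-1..1}" "x = h p" using closure_orbit_f[OF x] .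
  {
    assume "forward_orbit f x \<inter> Sing f c = {}"
    then have nz: "(T ^^ n) p \<noteq> 0" for n using orbit_meets_Sing_iff[OF p(2)] p(3) by simp
    show "log_deriv_defined (f ^^ n) x" for n
      unfolding p(3) by (rule iterate_log_deriv(1)[OF p(2) nz])
    show "\<not> (\<exists>l::ereal. (\<lambda>n. ereal (ln \<bar>deriv_I (f ^^ n) x\<bar> / real n)) \<longlonglongrightarrow> l)"
      unfolding p(3) using pointwise_exponent_not_convergent[OF p(1,2) nz] by blast
  next
    assume "forward_orbit f x \<inter> Sing f c \<noteq> {}"
    then obtain m where m: "(T ^^ m) p = 0" using orbit_meets_Sing_iff[OF p(2)] p(3) by auto
    show "\<forall>\<^sub>F n in sequentially. \<not> log_deriv_defined (f ^^ n) x"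
      using eventually_gt_at_top[of m]
    proof eventually_elim
      case (elim n)
      then show ?case
        using iterates_not_differentiable_after_hit[OF p(2) m] p(3) by (simp add: log_deriv_defined_def)
    qed
  }
qed

end

theorem theorem1:
  fixes lam c :: real and \<mu> \<nu> :: "real measure" and h hinv f :: "real \<Rightarrow> real"
  assumes "lam \<in> {0<..2}" and "fibonacci_recurrence lam"
    and "ergodic_prob (tent lam) \<mu>"
    and "supported_on \<mu> (closure (forward_orbit (tent lam) 0))"
    and "homeomorphism {-1..1} {-1..1} h hinv"
    and "real_analytic_on h ({-1..1} - {0})"
    and "Crit h = {0}" and "non_flat h 0"
    and "\<nu> = distr \<mu> borel_I h"
    and "f = h \<circ> tent lam \<circ> hinv"
    and "c = h 0"
  shows
    "(if strict_mono_on {-1..1} h then unimodal f c else reversed_unimodal f c) \<and>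
     real_analytic_on f ({-1..1} - Sing f c) \<and>
     lorenz_like f c \<and>
     \<not> extended_integral_exists \<nu> (\<lambda>x. elog \<bar>deriv_I f x\<bar>) \<and>
     (\<forall>x\<in>closure (forward_orbit f c).
        (forward_orbit f x \<inter> Sing f c = {} \<longrightarrow>
           (\<forall>n. log_deriv_defined (f ^^ n) x) \<and>
           \<not> (\<exists>l::ereal. (\<lambda>n. ereal (ln \<bar>deriv_I (f ^^ n) x\<bar> / real n)) \<longlonglongrightarrow> l)) \<and>
        (forward_orbit f x \<inter> Sing f c \<noteq> {} \<longrightarrow>
           (\<forall>\<^sub>F n in sequentially. \<not> log_deriv_defined (f ^^ n) x))) \<and>
     \<not> integrable \<nu> (\<lambda>x. ln (infdist x (Sing f c))) \<and>
     limsup (\<lambda>n. - elog \<bar>(f ^^ n) c - c\<bar> / ereal (real n)) \<in> {0<..<\<infinity>}"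
proof -
  interpret conjugate_measure lam h hinv \<mu>
    by unfold_locales (fact assms)+
  have eqs: "local.f = f" "local.\<nu> = \<nu>" "local.c = c"
    using assms by (simp_all add: f_def \<nu>_def c_def)
  show ?thesis using conjugate_dynamics unfolding eqs .
qed

end
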